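(* Fix $\phi\in(-\pi,\pi)$. There is a subset $\Lambda_{\phi,\infty}\subset\Lambda_\phi$ of density one such that for all observables $f\in C^\infty(\mathbb{T}^2)$, $$\int_{\mathbb{T}^2} f(x)\,g_\lambda(x)^2\,dx\;\longrightarrow\;\frac{1}{\operatorname{area}(\mathbb{T}^2)}\int_{\mathbb{T}^2} f(x)\,dx$$ as $\lambda\to\infty$ along the subsequence $\Lambda_{\phi,\infty}$.
   Context: Torus: fix $a>0$, let $\mathcal{L}_0=\mathbb{Z}(1/a,0)\oplus\mathbb{Z}(0,a)$ and $\mathbb{T}^2=\mathbb{R}^2/2\pi\mathcal{L}_0$ (a flat rectangular torus of area $4\pi^2$). The dual lattice is $\mathcal{L}=\{(ma,n/a):m,n\in\mathbb{Z}\}$. The functions $\frac1{2\pi}e^{i\langle x,\xi\rangle}$, $\xi\in\mathcal{L}$, form an orthonormal basis of $L^2(\mathbb{T}^2)$ of eigenfunctions of $-\Delta$ with eigenvalues $|\xi|^2$; the spectrum of $-\Delta$ is $\sigma(-\Delta)=\{|\xi|^2:\xi\in\mathcal{L}\}$. Fix a point $x_0\in\mathbb{T}^2$ (the scatterer). Point scatterer: the self-adjoint extensions of $-\Delta$ restricted to $C_c^\infty(\mathbb{T}^2\setminus\{x_0\})$ form a one-parameter family $-\Delta_{x_0,\phi}$, $\phi\in(-\pi,\pi]$, with $\phi=\pi$ the standard Laplacian. The domain of $-\Delta_{x_0,\phi}$ consists of the functions $f$ in the domain of the adjoint of the restricted operator such that, for some $C\in\mathbb{C}$, $f(x)=C\left(\cos\frac\phi2\cdot\frac{\log|x-x_0|}{2\pi}+\sin\frac\phi2\right)+o(1)$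 as $x\to x_0$. For $\phi\ne\pi$, $\Lambda_\phi$ denotes the set of new (perturbed) eigenvalues of this operator, namely the set of real $\lambda\notin\sigma(-\Delta)$ satisfying the spectral equation $$\sum_{\xi\in\mathcal{L}}\left\{\frac1{|\xi|^2-\lambda}-\frac{|\xi|^2}{|\xi|^4+1}\right\}=c_0\tan\frac\phi2,\qquad c_0=\sum_{\xi\in\mathcal{L}}\frac1{|\xi|^4+1}.$$ The eigenfunction corresponding to $\lambda\in\Lambda_\phi$ is the Green's function $G_\lambda(x;x_0)=(\Delta+\lambda)^{-1}\delta_{x_0}$, with $L^2$-expansion $$G_\lambda(x;x_0)=-\frac1{4\pi^2}\sum_{\xi\in\mathcal{L}}\frac{e^{i\langle\xi,x-x_0\rangle}}{|\xi|^2-\lambda},$$ and $g_\lambda(x)=G_\lambda(x;x_0)/\|G_\lambda\|_2$ is the ($L^2$-normalized, real-valued) Green's function. Density: a subset $\Lambda'\subset\Lambda_\phi$ has density one if $\#\{\lambda\in\Lambda':\lambda\le X\}/\#\{\lambda\in\Lambda_\phi:\lambda\le X\}\to1$ as $X\to\infty$. *)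

theory Defs
  imports "HOL-Analysis.Analysis"
begin

text \<open>
  Functions on the torus \<open>\<real>\<^sup>2 / 2\<pi>\<L>\<^sub>0\<close> are functions on the plane that are periodic with respect to
  \<open>2\<pi>\<L>\<^sub>0\<close>; integrals over the torus are taken over a fundamental rectangle.
\<close>

definition period_lattice :: "real \<Rightarrow> (real \<times> real) set" where
  "period_lattice a = {(2 * pi * (of_int m / a), 2 * pi * (of_int n * a)) | m n :: int. True}"

definition torus_periodic :: "real \<Rightarrow> (real \<times> real \<Rightarrow> 'b) \<Rightarrow> bool" where
  "torus_periodic a f \<longleftrightarrow> (\<forall>x. \<forall>v\<in>period_lattice a. f (x + v) = f x)"

definition torus_dom :: "real \<Rightarrow> (real \<times> real) set" where
  "torus_dom a = {0..<2 * pi / a} \<times> {0..<2 * pi * a}"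

definition torus_area :: "real \<Rightarrow> real" where
  "torus_area a = measure lborel (torus_dom a)"

definition torus_integral ::
    "real \<Rightarrow> (real \<times> real \<Rightarrow> 'b::{banach, second_countable_topology}) \<Rightarrow> 'b" where
  "torus_integral a f = (LINT x:torus_dom a|lborel. f x)"

text \<open>\<open>Ck k f\<close>: \<open>f\<close> is \<open>k\<close> times continuously differentiable on the whole space.\<close>

primrec Ck :: "nat \<Rightarrow> ('a::euclidean_space \<Rightarrow> 'b::real_normed_vector) \<Rightarrow> bool" where
  "Ck 0 f \<longleftrightarrow> continuous_on UNIV f"
| "Ck (Suc k) f \<longleftrightarrow> (\<forall>x. f differentiable (at x)) \<and>
     (\<forall>b\<in>Basis. Ck k (\<lambda>x. frechet_derivative f (at x) b))"

definition torus_smooth :: "real \<Rightarrow> (real \<times> real \<Rightarrow> complex) set" where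
  "torus_smooth a = {f. torus_periodic a f \<and> (\<forall>k. Ck k f)}"

definition dual_lattice :: "real \<Rightarrow> (real \<times> real) set" where
  "dual_lattice a = {(of_int m * a, of_int n / a) | m n :: int. True}"

definition laplace_spectrum :: "real \<Rightarrow> real set" where
  "laplace_spectrum a = {(norm \<xi>)\<^sup>2 | \<xi>. \<xi> \<in> dual_lattice a}"

definition scatterer_c0 :: "real \<Rightarrow> real" where
  "scatterer_c0 a = (\<Sum>\<^sub>\<infinity>\<xi>\<in>dual_lattice a. 1 / ((norm \<xi>) ^ 4 + 1))"

text \<open>
  The new eigenvalues \<open>\<Lambda>\<^sub>\<phi>\<close> of the point scatterer. The lattice sum converges absolutely for \<open>\<mu>\<close>
  outside the spectrum, so the default value of \<^const>\<open>infsum\<close> plays no role.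
\<close>

definition perturbed_eigenvalues :: "real \<Rightarrow> real \<Rightarrow> real set" where
  "perturbed_eigenvalues a \<phi> = {\<mu>. \<mu> \<notin> laplace_spectrum a \<and>
     (\<Sum>\<^sub>\<infinity>\<xi>\<in>dual_lattice a. 1 / ((norm \<xi>)\<^sup>2 - \<mu>) - (norm \<xi>)\<^sup>2 / ((norm \<xi>) ^ 4 + 1))
       = scatterer_c0 a * tan (\<phi> / 2)}"

definition green_partial_sum ::
    "real \<times> real \<Rightarrow> real \<Rightarrow> (real \<times> real) set \<Rightarrow> real \<times> real \<Rightarrow> complex" where
  "green_partial_sum x0 \<mu> F x =
     - (1 / (4 * of_real pi ^ 2)) *
       (\<Sum>\<xi>\<in>F. exp (\<i> * of_real (\<xi> \<bullet> (x - x0))) / of_real ((norm \<xi>)\<^sup>2 - \<mu>))"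

text \<open>
  \<open>G\<close> is a representative of the \<open>L\<^sup>2\<close>-class \<open>G\<^sub>\<mu>(\<cdot>; x\<^sub>0) = (\<Delta> + \<mu>)\<^bsup>-1\<^esup> \<delta>\<^bsub>x0\<^esub>\<close>, that is, the sum of the
  eigenfunction expansion of the resolvent kernel, converging unconditionally in \<open>L\<^sup>2\<close> of the torus.
  For \<open>\<mu>\<close> outside the spectrum it exists (Riesz--Fischer) and is determined up to a null set.
\<close>

definition is_green :: "real \<Rightarrow> real \<times> real \<Rightarrow> real \<Rightarrow> (real \<times> real \<Rightarrow> complex) \<Rightarrow> bool" where
  "is_green a x0 \<mu> G \<longleftrightarrow>
     G \<in> borel_measurable borel \<and> torus_periodic a G \<and>
     set_integrable lborel (torus_dom a) (\<lambda>x. (norm (G x))\<^sup>2) \<and>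
     ((\<lambda>F. torus_integral a (\<lambda>x. (norm (green_partial_sum x0 \<mu> F x - G x))\<^sup>2)) \<longlongrightarrow> 0)
       (finite_subsets_at_top (dual_lattice a))"

definition torus_L2_norm :: "real \<Rightarrow> (real \<times> real \<Rightarrow> complex) \<Rightarrow> real" where
  "torus_L2_norm a G = sqrt (torus_integral a (\<lambda>x. (norm (G x))\<^sup>2))"

definition L2_normalize ::
    "real \<Rightarrow> (real \<times> real \<Rightarrow> complex) \<Rightarrow> real \<times> real \<Rightarrow> complex" where
  "L2_normalize a G x = G x / of_real (torus_L2_norm a G)"

definition density_one_subset :: "real set \<Rightarrow> real set \<Rightarrow> bool" where
  "density_one_subset S T \<longleftrightarrow> S \<subseteq> T \<and>
     ((\<lambda>X. real (card {\<mu>\<in>S. \<mu> \<le> X}) / real (card {\<mu>\<in>T. \<mu> \<le> X})) \<longlongrightarrow> 1) at_top"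

end

theory Submission
  imports Defs
begin

text \<open>
  Index the frequencies \<open>\<xi> = (m a, n / a)\<close> of the torus by pairs of integers and let \<open>q (m, n) = |\<xi>|\<^sup>2\<close>.
  By Parseval, the Fourier coefficient of \<open>g\<^sub>\<mu>\<^sup>2\<close> at a nonzero frequency \<open>\<zeta>\<close> is at most
  \<open>(\<Sum>\<xi>. 1 / (|h(\<xi>)| |h(\<xi> + \<zeta>)|)) / (\<Sum>\<xi>. 1 / h(\<xi>)\<^sup>2)\<close> with \<open>h(\<xi>) = |\<xi>|\<^sup>2 - \<mu>\<close>, up to a constant, while the
  coefficient at \<open>0\<close> is fixed by the normalization because the Green's function is real. Trigonometric
  polynomials are uniformly dense among continuous functions on the torus, so it is enough that this
  quotient tends to \<open>0\<close> for each \<open>\<zeta> \<noteq> 0\<close>, along a set of \<open>\<mu>\<close> of density one.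

  If \<open>\<xi>\<close> and \<open>\<xi> + \<zeta>\<close> are never both within \<open>L = \<mu>\<^bsup>1/5\<^esup>\<close> of the circle \<open>|\<xi>|\<^sup>2 = \<mu>\<close>, then one factor of each
  product belongs to the tail \<open>T\<close>, the sum of \<open>1 / h\<^sup>2\<close> over \<open>|h| \<ge> L\<close>, and Cauchy--Schwarz bounds the quotient by
  \<open>2 sqrt (T / D)\<close>, where \<open>D\<close> is the full sum of \<open>1 / h\<^sup>2\<close> (\<open>sum_shifted_products_le\<close>). Three events
  have to be excluded, each for a set of \<open>\<mu>\<close> of density zero: that \<open>D\<close> is small, that \<open>T\<close> is large, and
  that \<open>\<xi>\<close> and \<open>\<xi> + \<zeta>\<close> are simultaneously close to the circle.

  All counting rests on one estimate, which makes no difference between rational and irrational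
  \<open>a\<^sup>4\<close> (\<open>q_energy\<close>): the number of pairs of frequencies below \<open>X\<close> whose eigenvalues differ by less
  than \<open>1\<close> is \<open>O(X\<^bsup>1+\<eta>\<^esup>)\<close>. Differences of squares factor, so such a pair is a near solution of
  \<open>a\<^sup>2 u v + w z / a\<^sup>2 = 0\<close> in integers; the Schur test reduces near solutions to exact solutions of
  \<open>u v = w z\<close>, and those are counted by gcd sums (\<open>mult_energy_nat\<close>).

  Consequences of the energy estimate. First, by Cauchy--Schwarz there are \<open>\<gg> X\<^bsup>1-\<eta>\<^esup>\<close> distinct norms
  below \<open>X\<close>. The spectral function increases from \<open>-\<infinity>\<close> to \<open>\<infinity>\<close> between consecutive norms, so new
  eigenvalues interlace with the norms and are equally numerous; hence exceptional sets may have up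
  to \<open>O(X\<^bsup>99/100\<^esup>)\<close> elements below \<open>X\<close> (\<open>negligible_eigsI\<close>). Second, most new eigenvalues
  are close to the next norm, which makes \<open>D\<close> large (\<open>negligible_gap_exceptions\<close>). Third, the mean of \<open>T\<close> over the new
  eigenvalues is a correlation sum that the Schur test bounds by the energy, so Markov's inequality
  controls large \<open>T\<close> (\<open>negligible_tail_exceptions\<close>). Fourth, if \<open>\<xi>\<close> and \<open>\<xi> + \<zeta>\<close> are both close to the circle then
  \<open>\<xi>\<close> lies in a strip of width \<open>O(L)\<close> along the line orthogonal to \<open>\<zeta>\<close>; such strips contain few lattice points,
  hence touch few unit intervals, and few unit intervals contain few eigenvalues, again by
  Cauchy--Schwarz and the energy (\<open>negligible_strip_exceptions\<close>). A diagonal argument over the countably many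
  \<open>\<zeta>\<close> gives a single exceptional set (\<open>negligible_eigs_diagonal\<close>).
\<close>

section \<open>Multiplicative energy of an interval\<close>

text \<open>By \<open>2 x y \<le> x\<^sup>2 + y\<^sup>2\<close>, correlating two sequences against a nonnegative kernel with bounded row and
  column sums costs no more than their energies. This replaces a count of near coincidences by a
  count of exact ones.\<close>

lemma schur_test:
  fixes w :: "'a \<Rightarrow> 'b \<Rightarrow> real" and x :: "'a \<Rightarrow> real" and y :: "'b \<Rightarrow> real"
  assumes w: "\<And>i j. i \<in> I \<Longrightarrow> j \<in> J \<Longrightarrow> 0 \<le> w i j"
    and row: "\<And>i. i \<in> I \<Longrightarrow> (\<Sum>j\<in>J. w i j) \<le> \<kappa>"
    and col: "\<And>j. j \<in> J \<Longrightarrow> (\<Sum>i\<in>I. w i j) \<le> \<kappa>"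
  shows "(\<Sum>i\<in>I. \<Sum>j\<in>J. w i j * (x i * y j)) \<le> \<kappa> / 2 * ((\<Sum>i\<in>I. (x i)\<^sup>2) + (\<Sum>j\<in>J. (y j)\<^sup>2))"
proof -
  have "(\<Sum>i\<in>I. \<Sum>j\<in>J. w i j * (x i * y j))
      \<le> (\<Sum>i\<in>I. \<Sum>j\<in>J. w i j * (x i)\<^sup>2 / 2 + w i j * (y j)\<^sup>2 / 2)"
  proof (intro sum_mono)
    fix i j assume ij: "i \<in> I" "j \<in> J"
    have "x i * y j \<le> ((x i)\<^sup>2 + (y j)\<^sup>2) / 2"
      using sum_squares_bound[of "x i" "y j"] by simp
    from mult_left_mono[OF this w[OF ij]]
    show "w i j * (x i * y j) \<le> w i j * (x i)\<^sup>2 / 2 + w i j * (y j)\<^sup>2 / 2"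
      by (simp add: algebra_simps)
  qed
  also have "\<dots> = (\<Sum>i\<in>I. (\<Sum>j\<in>J. w i j) * (x i)\<^sup>2 / 2) + (\<Sum>j\<in>J. (\<Sum>i\<in>I. w i j) * (y j)\<^sup>2 / 2)"
    unfolding sum.distrib by (subst (2) sum.swap) (simp add: sum_distrib_right sum_divide_distrib)
  also have "\<dots> \<le> (\<Sum>i\<in>I. \<kappa> * (x i)\<^sup>2 / 2) + (\<Sum>j\<in>J. \<kappa> * (y j)\<^sup>2 / 2)"
    using row col by (intro add_mono sum_mono divide_right_mono mult_right_mono) auto
  also have "\<dots> = \<kappa> / 2 * ((\<Sum>i\<in>I. (x i)\<^sup>2) + (\<Sum>j\<in>J. (y j)\<^sup>2))"
    by (simp add: sum_distrib_left sum_divide_distrib algebra_simps)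
  finally show ?thesis .
qed

lemma card_multiples_le:
  assumes "k > 0"
  shows "real (card {v\<in>{1..M}. k dvd v}) \<le> real M / real k"
proof -
  have "card {v\<in>{1..M}. k dvd v} \<le> card {1..M div k}"
  proof (rule card_inj_on_le[where f = "\<lambda>v. v div k"])
    show "inj_on (\<lambda>v. v div k) {v\<in>{1..M}. k dvd v}"
      by (intro inj_onI) (auto simp: dvd_div_eq_iff)
    show "(\<lambda>v. v div k) ` {v\<in>{1..M}. k dvd v} \<subseteq> {1..M div k}"
      using assms by (auto simp: div_le_mono dvd_imp_le div_greater_zero_iff Suc_le_eq)
  qed auto
  then have "real (card {v\<in>{1..M}. k dvd v}) \<le> real (M div k)" by simp
  also have "\<dots> \<le> real M / real k" by (rule of_nat_div_le_of_nat)
  finally show ?thesis .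
qed

text \<open>Bound the gcd by the sum of all common divisors: a divisor \<open>g\<close> of \<open>w\<close> divides at most \<open>M / g\<close> of
  the numbers \<open>u\<close> and so contributes at most \<open>M\<close>.\<close>

lemma sum_gcd_le:
  assumes "w > 0"
  shows "(\<Sum>u\<in>{1..M}. real (gcd u w)) \<le> real M * real (card {g. g dvd w})"
proof -
  have fin: "finite {g. g dvd w}" using assms by simp
  have "(\<Sum>u\<in>{1..M}. real (gcd u w)) \<le> (\<Sum>u\<in>{1..M}. \<Sum>g\<in>{g. g dvd w}. if g dvd u then real g else 0)"
  proof (intro sum_mono)
    fix u
    have "real (gcd u w) = (\<Sum>g\<in>{gcd u w}. if g dvd u then real g else 0)" by simp
    also have "\<dots> \<le> (\<Sum>g\<in>{g. g dvd w}. if g dvd u then real g else 0)"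
      using fin by (intro sum_mono2) auto
    finally show "real (gcd u w) \<le> (\<Sum>g\<in>{g. g dvd w}. if g dvd u then real g else 0)" .
  qed
  also have "\<dots> = (\<Sum>g\<in>{g. g dvd w}. \<Sum>u\<in>{1..M}. if g dvd u then real g else 0)"
    by (rule sum.swap)
  also have "\<dots> = (\<Sum>g\<in>{g. g dvd w}. real g * real (card {u\<in>{1..M}. g dvd u}))"
    by (intro sum.cong refl) (simp add: sum.inter_filter[symmetric])
  also have "\<dots> \<le> (\<Sum>g\<in>{g. g dvd w}. real M)"
  proof (intro sum_mono)
    fix g assume "g \<in> {g. g dvd w}"
    then have "g > 0" using assms by (auto intro: Nat.gr0I)
    then show "real g * real (card {u\<in>{1..M}. g dvd u}) \<le> real M"
      using card_multiples_le[of g M] by (simp add: field_simps)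
  qed
  finally show ?thesis by (simp add: mult.commute)
qed

text \<open>Writing \<open>w = g h\<close> embeds the sum into the product of two harmonic sums.\<close>

lemma sum_divisor_count_le:
  "(\<Sum>w\<in>{1..M}. real (card {g. g dvd w}) / real w) \<le> (harm M)\<^sup>2"
proof -
  have "(\<Sum>w\<in>{1..M}. real (card {g. g dvd w}) / real w)
      = (\<Sum>w\<in>{1..M}. \<Sum>g\<in>{g. g dvd w}. 1 / real w)" by simp
  also have "\<dots> = (\<Sum>(w,g)\<in>(SIGMA w:{1..M}. {g. g dvd w}). 1 / real w)"
    by (subst sum.Sigma) auto
  also have "\<dots> \<le> (\<Sum>(g,h)\<in>{1..M}\<times>{1..M}. 1 / (real g * real h))"
  proof -
    let ?A = "SIGMA w:{1..M}. {g. g dvd w}" and ?f = "\<lambda>(w,g). (g, w div g)"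
    have inj: "inj_on ?f ?A"
    proof (rule inj_onI)
      fix x y assume xy: "x \<in> ?A" "y \<in> ?A" "?f x = ?f y"
      obtain w g where x: "x = (w, g)" by (cases x)
      obtain w' g' where y: "y = (w', g')" by (cases y)
      have "w = w div g * g" "w' = w' div g' * g'" "w div g = w' div g'" "g = g'"
        using xy unfolding x y by auto
      then show "x = y" unfolding x y by metis
    qed
    have "(\<Sum>(w,g)\<in>?A. 1 / real w) = (\<Sum>x\<in>?A. case ?f x of (g,h) \<Rightarrow> 1 / (real g * real h))"
    proof (intro sum.cong refl)
      fix x assume "x \<in> ?A"
      then obtain w g where x: "x = (w, g)" "g dvd w" "w \<ge> 1" by auto
      have "real g * real (w div g) = real w"
        using x by (metis dvd_mult_div_cancel of_nat_mult)
      then show "(case x of (w,g) \<Rightarrow> 1 / real w) = (case ?f x of (g,h) \<Rightarrow> 1 / (real g * real h))"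
        by (simp add: x)
    qed
    also have "\<dots> = (\<Sum>(g,h)\<in>?f ` ?A. 1 / (real g * real h))"
      by (subst sum.reindex[OF inj]) (simp only: o_def)
    also have "\<dots> \<le> (\<Sum>(g,h)\<in>{1..M}\<times>{1..M}. 1 / (real g * real h))"
    proof (rule sum_mono2)
      show "?f ` ?A \<subseteq> {1..M} \<times> {1..M}"
      proof
        fix y assume "y \<in> ?f ` ?A"
        then obtain w g where y: "y = (g, w div g)" "g dvd w" "1 \<le> w" "w \<le> M" by auto
        have "g > 0" using y by (auto intro: Nat.gr0I)
        moreover have "g \<le> w" using y by (auto dest: dvd_imp_le)
        moreover have "w div g > 0" using \<open>g \<le> w\<close> \<open>g > 0\<close> by (simp add: div_greater_zero_iff)
        moreover have "w div g \<le> M" using y by (meson div_le_dividend le_trans)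
        ultimately show "y \<in> {1..M} \<times> {1..M}" using y by (auto simp: Suc_le_eq)
      qed
    qed auto
    finally show ?thesis .
  qed
  also have "\<dots> = (harm M)\<^sup>2"
    by (simp add: harm_def power2_eq_square sum_product sum.cartesian_product divide_simps)
  finally show ?thesis .
qed

text \<open>In a solution of \<open>u v = w z\<close> the pair \<open>(u, w)\<close> forces \<open>v\<close> to be a multiple of \<open>w / gcd u w\<close>, which leaves
  at most \<open>M gcd u w / w\<close> choices, and then \<open>z\<close> is determined.\<close>

lemma mult_energy_nat:
  fixes M :: nat
  defines "P \<equiv> {1..M} \<times> {1..M}"
  shows "real (card {(x, y) \<in> P \<times> P. fst x * snd x = fst y * snd y}) \<le> (real M)\<^sup>2 * (harm M)\<^sup>2"
proof -
  let ?E = "{(x, y) \<in> P \<times> P. fst x * snd x = fst y * snd y}"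
  let ?S = "SIGMA w:{1..M}. SIGMA u:{1..M}. {v\<in>{1..M}. w dvd u * v}"
  have finP: "finite P" by (simp add: P_def)
  have "card ?E \<le> card ?S"
  proof (rule card_inj_on_le[where f = "\<lambda>(x, y). (fst y, fst x, snd x)"])
    show "inj_on (\<lambda>(x, y). (fst y, fst x, snd x)) ?E"
      by (intro inj_onI) (auto simp: P_def)
    show "(\<lambda>(x, y). (fst y, fst x, snd x)) ` ?E \<subseteq> ?S"
      by (auto simp: P_def)
    show "finite ?S" by simp
  qed
  also have "card ?S = (\<Sum>w\<in>{1..M}. \<Sum>u\<in>{1..M}. card {v\<in>{1..M}. w dvd u * v})"
    by simp
  finally have "real (card ?E) \<le> (\<Sum>w\<in>{1..M}. \<Sum>u\<in>{1..M}. real (card {v\<in>{1..M}. w dvd u * v}))"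
    by (metis (mono_tags, lifting) of_nat_le_iff of_nat_sum sum.cong)
  also have "\<dots> \<le> (\<Sum>w\<in>{1..M}. \<Sum>u\<in>{1..M}. real M * real (gcd u w) / real w)"
  proof (intro sum_mono)
    fix w u assume "w \<in> {1..M}" "u \<in> {1..M}"
    define g where "g = gcd u w"
    have g: "g > 0" "g dvd w" "g dvd u" using \<open>w \<in> _\<close> by (auto simp: g_def)
    have wg: "w div g > 0" using g \<open>w \<in> _\<close> by (auto simp: div_greater_zero_iff dvd_imp_le)
    have "{v\<in>{1..M}. w dvd u * v} \<subseteq> {v\<in>{1..M}. w div g dvd v}"
    proof safe
      fix v assume "w dvd u * v"
      have "coprime (u div g) (w div g)" using g unfolding g_def
        by (intro div_gcd_coprime) auto
      then have cop: "coprime (w div g) (u div g)" by (simp add: coprime_commute)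
      have "(w div g) * g dvd ((u div g) * v) * g"
      proof -
        have "(w div g) * g = w" "((u div g) * v) * g = ((u div g) * g) * v" "(u div g) * g = u"
          using g by (auto simp: mult_ac)
        then show ?thesis using \<open>w dvd u * v\<close> by metis
      qed
      then have "w div g dvd (u div g) * v" using g dvd_times_right_cancel_iff[of g "w div g" "(u div g) * v"] by blast
      then show "w div g dvd v" using cop by (simp add: coprime_dvd_mult_right_iff)
    qed
    then have "real (card {v\<in>{1..M}. w dvd u * v}) \<le> real (card {v\<in>{1..M}. w div g dvd v})"
      by (intro of_nat_mono card_mono) auto
    also have "\<dots> \<le> real M / real (w div g)" by (rule card_multiples_le[OF wg])
    also have "\<dots> = real M * real g / real w" using g by (simp add: real_of_nat_div)
    finally show "real (card {v\<in>{1..M}. w dvd u * v}) \<le> real M * real (gcd u w) / real w"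
      by (simp add: g_def)
  qed
  also have "\<dots> = (\<Sum>w\<in>{1..M}. real M / real w * (\<Sum>u\<in>{1..M}. real (gcd u w)))"
    by (simp add: sum_distrib_left)
  also have "\<dots> \<le> (\<Sum>w\<in>{1..M}. real M / real w * (real M * real (card {g. g dvd w})))"
    by (intro sum_mono mult_left_mono sum_gcd_le) auto
  also have "\<dots> = (real M)\<^sup>2 * (\<Sum>w\<in>{1..M}. real (card {g. g dvd w}) / real w)"
    by (simp add: sum_distrib_left power2_eq_square field_simps)
  also have "\<dots> \<le> (real M)\<^sup>2 * (harm M)\<^sup>2"
    by (intro mult_left_mono sum_divisor_count_le) auto
  finally show ?thesis .
qed

text \<open>A solution with nonzero products is a positive solution together with four signs; in the other
  solutions both pairs lie on the coordinate axes, which contain at most \<open>4 M + 2\<close> points of the square.\<close>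

lemma mult_energy_int:
  fixes M :: nat
  defines "P \<equiv> {- int M..int M} \<times> {- int M..int M}"
  shows "real (card {(x, y) \<in> P \<times> P. fst x * snd x = fst y * snd y})
           \<le> 16 * ((real M)\<^sup>2 * (harm M)\<^sup>2) + (4 * real M + 2)\<^sup>2"
proof -
  let ?E = "{(x, y) \<in> P \<times> P. fst x * snd x = fst y * snd y}"
  let ?Z = "{x \<in> P. fst x * snd x = 0}"
  let ?Pn = "{1..M} \<times> {1..M}"
  let ?N = "{(x, y) \<in> ?Pn \<times> ?Pn. fst x * snd x = fst y * snd y}"
  have finP: "finite P" by (simp add: P_def)
  let ?sg = "{-1, 1::int}"
  let ?G = "(\<lambda>((s1,s2,s3,s4), ((u,v),(w,z))). ((s1 * int u, s2 * int v), (s3 * int w, s4 * int z)))"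
  have sub: "?E \<subseteq> ?Z \<times> ?Z \<union> ?G ` ((?sg \<times> ?sg \<times> ?sg \<times> ?sg) \<times> ?N)"
  proof
    fix e assume e: "e \<in> ?E"
    obtain u v w z where uv: "e = ((u,v),(w,z))" by (metis prod.collapse)
    have eq: "u * v = w * z" and b: "(u,v) \<in> P" "(w,z) \<in> P" using e by (auto simp: uv)
    show "e \<in> ?Z \<times> ?Z \<union> ?G ` ((?sg \<times> ?sg \<times> ?sg \<times> ?sg) \<times> ?N)"
    proof (cases "u * v = 0")
      case True
      then have "e \<in> ?Z \<times> ?Z" using eq b by (auto simp: uv)
      then show ?thesis by blast
    next
      case False
      then have nz: "u \<noteq> 0" "v \<noteq> 0" "w \<noteq> 0" "z \<noteq> 0" using eq by auto
      have "nat \<bar>u\<bar> * nat \<bar>v\<bar> = nat \<bar>w\<bar> * nat \<bar>z\<bar>"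
        using eq by (metis abs_mult nat_abs_mult_distrib)
      then have "((nat \<bar>u\<bar>, nat \<bar>v\<bar>), (nat \<bar>w\<bar>, nat \<bar>z\<bar>)) \<in> ?N"
      proof -
        have "nat \<bar>i\<bar> \<in> {1..M}" if "i \<noteq> 0" "i \<in> {- int M..int M}" for i
          using that by (simp add: nat_le_iff abs_le_iff)
        note inM = this
        have "u \<in> {- int M..int M}" "v \<in> {- int M..int M}" "w \<in> {- int M..int M}" "z \<in> {- int M..int M}"
          using b unfolding P_def by (simp_all only: mem_Sigma_iff)
        then show ?thesis using inM nz \<open>nat \<bar>u\<bar> * nat \<bar>v\<bar> = nat \<bar>w\<bar> * nat \<bar>z\<bar>\<close>
          by (simp only: mem_Collect_eq case_prod_conv mem_Sigma_iff fst_conv snd_conv simp_thms)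
      qed
      moreover have "(sgn u, sgn v, sgn w, sgn z) \<in> ?sg \<times> ?sg \<times> ?sg \<times> ?sg"
        using nz by (auto simp: sgn_if)
      moreover have "e = ?G ((sgn u, sgn v, sgn w, sgn z), ((nat \<bar>u\<bar>, nat \<bar>v\<bar>), (nat \<bar>w\<bar>, nat \<bar>z\<bar>)))"
        by (simp add: uv sgn_mult_abs)
      ultimately show ?thesis by blast
    qed
  qed
  have finN: "finite ?N" by (rule finite_subset[of _ "?Pn \<times> ?Pn"]) auto
  have "card ?E \<le> card (?Z \<times> ?Z \<union> ?G ` ((?sg \<times> ?sg \<times> ?sg \<times> ?sg) \<times> ?N))"
    using finP finN by (intro card_mono sub finite_UnI finite_cartesian_product finite_imageI) auto
  also have "\<dots> \<le> card (?Z \<times> ?Z) + card (?G ` ((?sg \<times> ?sg \<times> ?sg \<times> ?sg) \<times> ?N))"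
    by (rule card_Un_le)
  also have "\<dots> \<le> card ?Z * card ?Z + card ((?sg \<times> ?sg \<times> ?sg \<times> ?sg) \<times> ?N)"
    using finN by (intro add_mono card_image_le finite_cartesian_product) (auto simp: card_cartesian_product)
  also have "card ((?sg \<times> ?sg \<times> ?sg \<times> ?sg) \<times> ?N) = 16 * card ?N"
    by (simp add: card_cartesian_product)
  finally have 1: "real (card ?E) \<le> real (card ?Z) * real (card ?Z) + 16 * real (card ?N)"
    by (metis (no_types, lifting) of_nat_add of_nat_le_iff of_nat_mult of_nat_numeral)
  have "card ?Z \<le> card ({0} \<times> {- int M..int M} \<union> {- int M..int M} \<times> {0})"
    by (intro card_mono) (auto simp: P_def)
  also have "\<dots> \<le> card ({0::int} \<times> {- int M..int M}) + card ({- int M..int M} \<times> {0::int})"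
    by (rule card_Un_le)
  also have "\<dots> = 4 * M + 2" by (simp add: card_cartesian_product nat_add_distrib)
  finally have 2: "real (card ?Z) \<le> 4 * real M + 2" by linarith
  have "real (card ?E) \<le> (4 * real M + 2) * (4 * real M + 2) + 16 * ((real M)\<^sup>2 * (harm M)\<^sup>2)"
    using 1 mult_mono[OF 2 2] mult_energy_nat[of M] by simp
  then show ?thesis by (simp add: power2_eq_square)
qed

lemma harm_le_powr:
  assumes "\<eta> > 0" "M \<ge> 1"
  shows "harm M \<le> (1 + 1 / \<eta>) * real M powr \<eta>"
proof -
  have "harm M \<le> ln (real M) + 1" using euler_mascheroni_sequence_decreasing[of 1 M] assms by (simp add: harm_def)
  also have "\<dots> \<le> real M powr \<eta> / \<eta> + real M powr \<eta>"
    using assms by (intro add_mono ln_powr_bound ge_one_powr_ge_zero) auto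
  finally show ?thesis by (simp add: algebra_simps)
qed

lemma mult_energy_powr:
  fixes \<eta> :: real
  assumes "\<eta> > 0"
  shows "\<exists>C>0. \<forall>M\<ge>1. real (card {(x, y) \<in> ({- int M..int M} \<times> {- int M..int M}) \<times> ({- int M..int M} \<times> {- int M..int M}).
           fst x * snd x = fst y * snd y}) \<le> C * real M powr (2 + \<eta>)"
proof (intro exI conjI allI impI)
  let ?C = "16 * (1 + 1 / (\<eta>/2))\<^sup>2 + 36"
  show "?C > 0" by (simp add: add_nonneg_pos)
  fix M :: nat assume M: "M \<ge> 1"
  have M2: "(real M)\<^sup>2 = real M powr 2" using M by (simp add: powr_numeral)
  have "(harm M)\<^sup>2 \<le> ((1 + 1 / (\<eta>/2)) * real M powr (\<eta>/2))\<^sup>2"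
    using assms M by (intro power_mono harm_le_powr harm_nonneg) auto
  also have "\<dots> = (1 + 1 / (\<eta>/2))\<^sup>2 * real M powr \<eta>"
    unfolding power_mult_distrib by (simp add: power2_eq_square[of "_ powr _"] powr_add[symmetric])
  finally have "(real M)\<^sup>2 * (harm M)\<^sup>2 \<le> (1 + 1 / (\<eta>/2))\<^sup>2 * real M powr (2 + \<eta>)"
    unfolding powr_add using mult_left_mono[of _ _ "real M powr 2"] by (simp only: M2) (simp add: mult.left_commute)
  moreover have "(4 * real M + 2)\<^sup>2 \<le> 36 * real M powr (2 + \<eta>)"
  proof -
    have "(4 * real M + 2)\<^sup>2 \<le> (6 * real M)\<^sup>2" using M by (intro power_mono) auto
    also have "\<dots> = 36 * real M powr 2" using M by (simp add: power_mult_distrib powr_numeral)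
    also have "\<dots> \<le> 36 * real M powr (2 + \<eta>)"
      using M assms by (intro mult_left_mono powr_mono) auto
    finally show ?thesis .
  qed
  ultimately show "real (card {(x, y) \<in> ({- int M..int M} \<times> {- int M..int M}) \<times> ({- int M..int M} \<times> {- int M..int M}).
           fst x * snd x = fst y * snd y}) \<le> ?C * real M powr (2 + \<eta>)"
    using mult_energy_int[of M] by (simp add: distrib_right)
qed

section \<open>Lattice points in discs, annuli and strips\<close>

lemma nat_floor_succ:
  fixes X :: real
  assumes "X \<ge> 1"
  shows "X < real (nat \<lfloor>X\<rfloor> + 1)" "real (nat \<lfloor>X\<rfloor> + 1) \<le> 2 * X" "nat \<lfloor>X\<rfloor> + 1 \<ge> 1"
proof -
  have "real (nat \<lfloor>X\<rfloor> + 1) = of_int \<lfloor>X\<rfloor> + 1" using assms by simp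
  then show "X < real (nat \<lfloor>X\<rfloor> + 1)" "real (nat \<lfloor>X\<rfloor> + 1) \<le> 2 * X" using assms by linarith+
qed simp

lemma card_int_interval_le:
  fixes x y :: real
  assumes "x \<le> y"
  shows "finite {k::int. x \<le> of_int k \<and> of_int k \<le> y}"
    and "real (card {k::int. x \<le> of_int k \<and> of_int k \<le> y}) \<le> y - x + 1"
proof -
  have eq: "{k::int. x \<le> of_int k \<and> of_int k \<le> y} = {\<lceil>x\<rceil>..\<lfloor>y\<rfloor>}"
    by (auto simp: ceiling_le_iff le_floor_iff)
  show "finite {k::int. x \<le> of_int k \<and> of_int k \<le> y}" unfolding eq by simp
  show "real (card {k::int. x \<le> of_int k \<and> of_int k \<le> y}) \<le> y - x + 1"
    unfolding eq using assms by simp linarith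
qed

lemma card_int_interval_ge:
  fixes x y :: real
  assumes "x \<le> y"
  shows "y - x - 1 \<le> real (card {k::int. x \<le> of_int k \<and> of_int k \<le> y})"
proof -
  have eq: "{k::int. x \<le> of_int k \<and> of_int k \<le> y} = {\<lceil>x\<rceil>..\<lfloor>y\<rfloor>}"
    by (auto simp: ceiling_le_iff le_floor_iff)
  show ?thesis unfolding eq using assms by simp linarith
qed

text \<open>Grouping pairs by the values of \<open>f\<close> brings the count into the shape of the Schur test, and with
  equality for \<open>K\<close> it expresses the energy.\<close>

lemma card_related_pairs:
  fixes K :: "'b \<Rightarrow> 'b \<Rightarrow> bool" and f :: "'a \<Rightarrow> 'b" and P
  assumes P: "finite P"
  defines "r \<equiv> (\<lambda>i. real (card {x\<in>P. f x = i}))"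
  shows "real (card {(x, y) \<in> P \<times> P. K (f x) (f y)})
           = (\<Sum>i\<in>f ` P. \<Sum>j\<in>f ` P. of_bool (K i j) * (r i * r j))"
proof -
  have "real (card {(x, y) \<in> P \<times> P. K (f x) (f y)})
      = (\<Sum>z\<in>P \<times> P. of_bool (K (f (fst z)) (f (snd z))))"
  proof -
    have "{(x, y) \<in> P \<times> P. K (f x) (f y)} = {z\<in>P \<times> P. K (f (fst z)) (f (snd z))}" by auto
    then show ?thesis using P by (simp add: sum.inter_filter[symmetric] of_bool_def)
  qed
  also have "\<dots> = (\<Sum>x\<in>P. \<Sum>y\<in>P. of_bool (K (f x) (f y)))"
    by (simp add: sum.cartesian_product case_prod_beta)
  also have "\<dots> = (\<Sum>i\<in>f ` P. \<Sum>x\<in>{x\<in>P. f x = i}. \<Sum>y\<in>P. of_bool (K (f x) (f y)))"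
    by (rule sum.image_gen[OF P])
  also have "\<dots> = (\<Sum>i\<in>f ` P. \<Sum>x\<in>{x\<in>P. f x = i}. \<Sum>j\<in>f ` P. \<Sum>y\<in>{y\<in>P. f y = j}. of_bool (K (f x) (f y)))"
    by (intro sum.cong refl sum.image_gen[OF P])
  also have "\<dots> = (\<Sum>i\<in>f ` P. \<Sum>x\<in>{x\<in>P. f x = i}. \<Sum>j\<in>f ` P. \<Sum>y\<in>{y\<in>P. f y = j}. of_bool (K i j))"
    by (intro sum.cong refl) auto
  also have "\<dots> = (\<Sum>i\<in>f ` P. \<Sum>j\<in>f ` P. of_bool (K i j) * (r i * r j))"
    by (simp add: r_def sum_distrib_left mult_ac)
  finally show ?thesis .
qed

lemma card_equal_pairs:
  fixes f :: "'a \<Rightarrow> 'b"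
  assumes "finite P"
  shows "real (card {(x, y) \<in> P \<times> P. f x = f y}) = (\<Sum>i\<in>f ` P. (real (card {x\<in>P. f x = i}))\<^sup>2)"
  unfolding card_related_pairs[OF assms]
proof (intro sum.cong refl)
  fix i assume i: "i \<in> f ` P"
  let ?r = "\<lambda>i. real (card {x\<in>P. f x = i})"
  have "(\<Sum>j\<in>f ` P. of_bool (i = j) * (?r i * ?r j)) = (\<Sum>j\<in>f ` P. if i = j then (?r i)\<^sup>2 else 0)"
    by (intro sum.cong) (auto simp: power2_eq_square)
  also have "\<dots> = (?r i)\<^sup>2"
    using sum.delta'[OF finite_imageI[OF assms, of f], of i "\<lambda>_. (?r i)\<^sup>2"] i by simp
  finally show "(\<Sum>j\<in>f ` P. of_bool (i = j) * (?r i * ?r j)) = (?r i)\<^sup>2" .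
qed

lemma card_linear_band_le:
  fixes c d :: real
  assumes "c > 0" and "finite J"
  shows "(\<Sum>j\<in>J. of_bool (\<bar>d + c * of_int j\<bar> < 1) :: real) \<le> 2 / c + 1"
proof -
  let ?I = "{j::int. - d / c - 1 / c \<le> of_int j \<and> of_int j \<le> - d / c + 1 / c}"
  have le: "- d / c - 1 / c \<le> - d / c + 1 / c" using assms by simp
  have "(\<Sum>j\<in>J. of_bool (\<bar>d + c * of_int j\<bar> < 1) :: real) = real (card {j\<in>J. \<bar>d + c * of_int j\<bar> < 1})"
    using assms by (simp add: sum_of_bool_eq Int_def)
  also have "\<dots> \<le> real (card ?I)"
    using assms by (intro of_nat_mono card_mono card_int_interval_le(1)[OF le]) (auto simp: field_simps abs_less_iff)
  also have "\<dots> \<le> 2 / c + 1" using card_int_interval_le(2)[OF le] by simp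
  finally show ?thesis .
qed

text \<open>
  The rectangular torus with side ratio given by \<open>a\<close>. The function \<open>q\<close> gives the Laplace eigenvalue \<open>|\<xi>|\<^sup>2\<close>
  of the frequency \<open>\<xi> = (m a, n / a)\<close>.
\<close>

locale rect_torus =
  fixes a :: real
  assumes a_pos: "a > 0"
begin

definition q :: "int \<times> int \<Rightarrow> real" where
  "q p = (a * of_int (fst p))\<^sup>2 + (of_int (snd p) / a)\<^sup>2"

lemma q_nonneg [simp]: "q p \<ge> 0"
  by (simp add: q_def)

lemma abs_coords_le:
  assumes "q p \<le> X"
  shows "\<bar>real_of_int (fst p)\<bar> \<le> sqrt X / a" "\<bar>real_of_int (snd p)\<bar> \<le> a * sqrt X"
proof -
  have "(a * of_int (fst p))\<^sup>2 \<le> X" "(of_int (snd p) / a)\<^sup>2 \<le> X"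
    using assms unfolding q_def by (smt (verit) zero_le_power2)+
  then have "\<bar>a * of_int (fst p)\<bar> \<le> sqrt X" "\<bar>of_int (snd p) / a\<bar> \<le> sqrt X"
    by (metis real_sqrt_abs real_sqrt_le_iff)+
  then show "\<bar>real_of_int (fst p)\<bar> \<le> sqrt X / a" "\<bar>real_of_int (snd p)\<bar> \<le> a * sqrt X"
    using a_pos by (simp_all add: abs_mult field_simps)
qed

lemma q_ball_subset:
  "{p. q p \<le> X} \<subseteq> {k. - (sqrt X / a) \<le> of_int k \<and> of_int k \<le> sqrt X / a} \<times> {k. - (a * sqrt X) \<le> of_int k \<and> of_int k \<le> a * sqrt X}"
  using abs_coords_le by (fastforce simp: abs_le_iff)

lemma finite_q_le [simp]: "finite {p. q p \<le> X}"
proof (cases "X \<ge> 0")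
  case True
  then show ?thesis using a_pos
    by (intro finite_subset[OF q_ball_subset] finite_cartesian_product card_int_interval_le)
       (simp_all add: order_trans[of _ 0])
next
  case False
  then have "\<And>p. \<not> q p \<le> X" using q_nonneg order_trans by blast
  then have "{p. q p \<le> X} = {}" by blast
  then show ?thesis by (simp only: finite.emptyI)
qed

lemma finite_q_less [simp]: "finite {p. q p < X}"
  by (rule finite_subset[OF _ finite_q_le[of X]]) auto

lemma card_q_le_upper:
  "\<exists>C>0. \<forall>X\<ge>1. real (card {p. q p \<le> X}) \<le> C * X"
proof (intro exI conjI allI impI)
  let ?C = "(2 / a + 1) * (2 * a + 1)"
  show "?C > 0" using a_pos by (simp add: add_pos_pos)
  fix X :: real assume X: "X \<ge> 1"
  let ?A = "{k::int. - (sqrt X / a) \<le> of_int k \<and> of_int k \<le> sqrt X / a}"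
  let ?B = "{k::int. - (a * sqrt X) \<le> of_int k \<and> of_int k \<le> a * sqrt X}"
  have le: "- (sqrt X / a) \<le> sqrt X / a" "- (a * sqrt X) \<le> a * sqrt X"
    using a_pos X by (simp_all add: order_trans[of _ 0])
  have s1: "sqrt X \<ge> 1" using X by simp
  have "card {p. q p \<le> X} \<le> card (?A \<times> ?B)"
    using card_int_interval_le(1)[OF le(1)] card_int_interval_le(1)[OF le(2)]
    by (intro card_mono q_ball_subset finite_cartesian_product)
  then have "real (card {p. q p \<le> X}) \<le> real (card ?A) * real (card ?B)"
    by (simp add: card_cartesian_product flip: of_nat_mult)
  also have "\<dots> \<le> (sqrt X / a - - (sqrt X / a) + 1) * (a * sqrt X - - (a * sqrt X) + 1)"
    using le by (intro mult_mono card_int_interval_le(2)) simp_all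
  also have "\<dots> \<le> ((2 / a + 1) * sqrt X) * ((2 * a + 1) * sqrt X)"
    using s1 a_pos by (intro mult_mono) (simp_all add: algebra_simps)
  also have "\<dots> = ?C * (sqrt X * sqrt X)" by (simp only: mult_ac)
  also have "\<dots> = ?C * X" using X by simp
  finally show "real (card {p. q p \<le> X}) \<le> ?C * X" .
qed

lemma card_sym_interval_ge:
  fixes y :: real
  assumes "y \<ge> 0"
  shows "y \<le> real (card {k::int. - y \<le> of_int k \<and> of_int k \<le> y})"
proof (cases "y \<ge> 1")
  case True
  then show ?thesis using card_int_interval_ge[of "-y" y] by simp
next
  case False
  have "card {0::int} \<le> card {k::int. - y \<le> of_int k \<and> of_int k \<le> y}"
    using assms card_int_interval_le(1)[of "-y" y] by (intro card_mono) auto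
  then show ?thesis using False by simp
qed

lemma card_q_le_lower:
  assumes "X \<ge> 0"
  shows "X / 2 \<le> real (card {p. q p \<le> X})"
proof -
  define s where "s = sqrt (X / 2)"
  have s: "s \<ge> 0" "s * s = X / 2" using assms by (simp_all add: s_def)
  let ?A = "{k::int. - (s / a) \<le> of_int k \<and> of_int k \<le> s / a}"
  let ?B = "{k::int. - (s * a) \<le> of_int k \<and> of_int k \<le> s * a}"
  have "X / 2 = (s / a) * (s * a)" using a_pos s by simp
  also have "\<dots> \<le> real (card ?A) * real (card ?B)"
    using a_pos s by (intro mult_mono card_sym_interval_ge) simp_all
  also have "\<dots> = real (card (?A \<times> ?B))" by (simp add: card_cartesian_product)
  also have "\<dots> \<le> real (card {p. q p \<le> X})"
  proof (intro of_nat_mono card_mono finite_q_le subsetI)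
    fix p assume "p \<in> ?A \<times> ?B"
    then have "\<bar>a * of_int (fst p)\<bar> \<le> s" "\<bar>of_int (snd p) / a\<bar> \<le> s"
      using a_pos by (auto simp: abs_le_iff field_simps)
    then have "(a * of_int (fst p))\<^sup>2 \<le> s\<^sup>2" "(of_int (snd p) / a)\<^sup>2 \<le> s\<^sup>2"
      using s by (simp_all only: abs_le_square_iff[symmetric] abs_of_nonneg)
    then have "q p \<le> s\<^sup>2 + s\<^sup>2" unfolding q_def by (rule add_mono)
    then show "p \<in> {p. q p \<le> X}" using s by (simp add: power2_eq_square)
  qed
  finally show ?thesis .
qed

abbreviation close_pairs :: "real \<Rightarrow> ((int \<times> int) \<times> (int \<times> int)) set" where
  "close_pairs X \<equiv> {(p, p'). q p \<le> X \<and> q p' \<le> X \<and> \<bar>q p - q p'\<bar> < 1}"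

text \<open>The arithmetic heart of the proof. For frequencies \<open>(m, n)\<close> and \<open>(m', n')\<close> put \<open>u = m - m'\<close>, \<open>v = m + m'\<close>,
  \<open>w = n - n'\<close>, \<open>z = n + n'\<close>; then the eigenvalues differ by \<open>a\<^sup>2 u v + w z / a\<^sup>2\<close>. If this is less than \<open>1\<close> in modulus,
  each of the integers \<open>u v\<close> and \<open>w z\<close> determines the other up to boundedly many choices, so the
  Schur test reduces the count to the multiplicative energy of an interval of length \<open>O(sqrt X)\<close>.\<close>

lemma q_energy:
  fixes \<eta> :: real
  assumes "\<eta> > 0"
  shows "\<exists>C>0. \<forall>X\<ge>1. real (card (close_pairs X)) \<le> C * X powr (1 + \<eta>)"
proof -
  from mult_energy_powr[of "2 * \<eta>"] assms obtain C0 where C0: "C0 > 0"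
    "\<And>M. M \<ge> 1 \<Longrightarrow> real (card {(x, y) \<in> ({- int M..int M} \<times> {- int M..int M}) \<times> ({- int M..int M} \<times> {- int M..int M}).
           fst x * snd x = fst y * snd y}) \<le> C0 * real M powr (2 + 2 * \<eta>)" by auto
  \<comment> \<open>a bound for the number of integers \<open>j\<close> with \<open>|a\<^sup>2 i + j / a\<^sup>2| < 1\<close> for given \<open>i\<close>, and vice versa\<close>
  define \<kappa> where "\<kappa> = 2 * a\<^sup>2 + 2 / a\<^sup>2 + 1"
  \<comment> \<open>with this \<open>c\<close> the sums and differences of coordinates are bounded by \<open>c sqrt X\<close>\<close>
  define c where "c = 2 / a + 2 * a"
  have c: "c > 0" using a_pos by (simp add: c_def add_pos_pos)
  have \<kappa>: "\<kappa> > 0" using a_pos by (simp add: \<kappa>_def add_nonneg_pos)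
  let ?C = "\<kappa> * (C0 * (c + 1) powr (2 + 2 * \<eta>))"
  show ?thesis
  proof (intro exI conjI allI impI)
    show "?C > 0" using c \<kappa> C0 by simp
    fix X :: real assume X: "X \<ge> 1"
    define M where "M = nat \<lceil>c * sqrt X\<rceil>"
    have cs: "c * sqrt X > 0" using c X by simp
    have M1: "M \<ge> 1" using cs unfolding M_def by linarith
    have Mge: "c * sqrt X \<le> real M" using cs unfolding M_def by linarith
    have Mle: "real M \<le> (c + 1) * sqrt X"
    proof -
      have "real M \<le> c * sqrt X + 1" using cs unfolding M_def by linarith
      also have "\<dots> \<le> (c + 1) * sqrt X" using X by (simp add: algebra_simps)
      finally show ?thesis .
    qed
    define P where "P = {- int M..int M} \<times> {- int M..int M}"
    define f where "f = (\<lambda>x::int \<times> int. fst x * snd x)"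
    define K where "K = (\<lambda>i j::int. \<bar>a\<^sup>2 * of_int i + of_int j / a\<^sup>2\<bar> < 1)"
    define r where "r = (\<lambda>i. real (card {x\<in>P. f x = i}))"
    have finP: "finite P" by (simp add: P_def)
    let ?E = "close_pairs X"
    let ?g = "\<lambda>(p, p'). ((fst p - fst p', fst p + fst p'), (snd p - snd p', snd p + snd p')) :: (int \<times> int) \<times> (int \<times> int)"
    let ?T = "{(x, y) \<in> P \<times> P. K (f x) (f y)}"
    have "card ?E \<le> card ?T"
    proof (rule card_inj_on_le[where f = ?g])
      show "inj_on ?g ?E" by (intro inj_onI) (auto simp: prod_eq_iff)
      show "finite ?T" using finP by (auto intro: finite_subset[of _ "P \<times> P"])
      show "?g ` ?E \<subseteq> ?T"
      proof
        fix e assume "e \<in> ?g ` ?E"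
        then obtain p p' where p: "e = ?g (p, p')" "q p \<le> X" "q p' \<le> X" "\<bar>q p - q p'\<bar> < 1" by auto
        have b: "sqrt X / a + sqrt X / a \<le> real M" "a * sqrt X + a * sqrt X \<le> real M"
          using Mge a_pos X unfolding c_def by (simp_all add: algebra_simps) (smt (verit) divide_nonneg_pos mult_nonneg_nonneg real_sqrt_ge_zero)+
        have "\<bar>real_of_int (fst p)\<bar> + \<bar>real_of_int (fst p')\<bar> \<le> real M"
             "\<bar>real_of_int (snd p)\<bar> + \<bar>real_of_int (snd p')\<bar> \<le> real M"
          using abs_coords_le[OF p(2)] abs_coords_le[OF p(3)] b by linarith+
        then have "\<bar>fst p\<bar> + \<bar>fst p'\<bar> \<le> int M" "\<bar>snd p\<bar> + \<bar>snd p'\<bar> \<le> int M" by linarith+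
        then have inP: "(fst p - fst p', fst p + fst p') \<in> P" "(snd p - snd p', snd p + snd p') \<in> P"
          unfolding P_def by auto
        have "q p - q p' = a\<^sup>2 * of_int ((fst p - fst p') * (fst p + fst p')) + of_int ((snd p - snd p') * (snd p + snd p')) / a\<^sup>2"
          by (simp add: q_def power2_eq_square algebra_simps diff_divide_distrib add_divide_distrib)
        then show "e \<in> ?T" using p inP by (simp add: K_def f_def)
      qed
    qed
    also have "real (card ?T) = (\<Sum>i\<in>f ` P. \<Sum>j\<in>f ` P. of_bool (K i j) * (r i * r j))"
      unfolding r_def by (rule card_related_pairs[OF finP])
    finally have "real (card ?E) \<le> (\<Sum>i\<in>f ` P. \<Sum>j\<in>f ` P. of_bool (K i j) * (r i * r j))" by simp
    also have "\<dots> \<le> \<kappa> / 2 * ((\<Sum>i\<in>f ` P. (r i)\<^sup>2) + (\<Sum>i\<in>f ` P. (r i)\<^sup>2))"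
    proof (rule schur_test)
      have a2: "a\<^sup>2 > 0" "1 / a\<^sup>2 > 0" using a_pos by simp_all
      show "(\<Sum>j\<in>f ` P. of_bool (K i j)) \<le> \<kappa>" for i
      proof -
        have "(\<Sum>j\<in>f ` P. of_bool (K i j)) \<le> 2 / (1 / a\<^sup>2) + 1"
          using card_linear_band_le[OF a2(2) finite_imageI[OF finP, of f], of "a\<^sup>2 * of_int i"] by (simp add: K_def)
        also have "\<dots> \<le> \<kappa>" by (simp add: \<kappa>_def)
        finally show ?thesis .
      qed
      show "(\<Sum>i\<in>f ` P. of_bool (K i j)) \<le> \<kappa>" for j
      proof -
        have "(\<Sum>i\<in>f ` P. of_bool (K i j)) \<le> 2 / a\<^sup>2 + 1"
          using card_linear_band_le[OF a2(1) finite_imageI[OF finP, of f], of "of_int j / a\<^sup>2"]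
          by (simp add: K_def add.commute)
        also have "\<dots> \<le> \<kappa>" by (simp add: \<kappa>_def)
        finally show ?thesis .
      qed
    qed simp
    also have "\<dots> = \<kappa> * (\<Sum>i\<in>f ` P. (r i)\<^sup>2)" by simp
    also have "(\<Sum>i\<in>f ` P. (r i)\<^sup>2) = real (card {(x, y) \<in> P \<times> P. f x = f y})"
      unfolding r_def by (rule card_equal_pairs[OF finP, symmetric])
    also have "\<dots> \<le> C0 * real M powr (2 + 2 * \<eta>)"
      using C0(2)[OF M1] unfolding P_def f_def .
    also have "real M powr (2 + 2 * \<eta>) \<le> ((c + 1) * sqrt X) powr (2 + 2 * \<eta>)"
      using Mle assms by (intro powr_mono2) auto
    also have "\<dots> = (c + 1) powr (2 + 2 * \<eta>) * X powr (1 + \<eta>)"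
    proof -
      have "sqrt X powr (2 + 2 * \<eta>) = X powr (1 + \<eta>)"
        using X by (simp add: powr_half_sqrt[symmetric] powr_powr add_divide_distrib)
      then show ?thesis using c X by (simp add: powr_mult)
    qed
    finally show "real (card ?E) \<le> ?C * X powr (1 + \<eta>)" using \<kappa> C0 by (simp add: mult_ac)
  qed
qed

end

lemma summable_on_int_powr:
  "(\<lambda>k::int. (1 + \<bar>real_of_int k\<bar>) powr (-3/2)) summable_on UNIV"
proof -
  have "summable (\<lambda>n. real (Suc n) powr (-3/2))"
    using summable_real_powr_iff[of "-3/2"] by (subst summable_Suc_iff) simp
  then have nat: "(\<lambda>n::nat. (1 + real n) powr (-3/2)) summable_on UNIV"
    by (subst summable_on_UNIV_nonneg_real_iff) (simp_all add: add.commute)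
  have "(\<lambda>k::int. (1 + \<bar>real_of_int k\<bar>) powr (-3/2)) summable_on range int"
    using nat by (subst summable_on_reindex) (simp_all add: o_def)
  moreover have "(\<lambda>k::int. (1 + \<bar>real_of_int k\<bar>) powr (-3/2)) summable_on range (\<lambda>n. - int n)"
    using nat by (subst summable_on_reindex) (simp_all add: o_def inj_def)
  ultimately have "(\<lambda>k::int. (1 + \<bar>real_of_int k\<bar>) powr (-3/2)) summable_on (range int \<union> range (\<lambda>n. - int n))"
    by (rule summable_on_union)
  moreover have "range int \<union> range (\<lambda>n. - int n) = UNIV"
  proof (intro set_eqI iffI UNIV_I)
    fix k :: int
    have "k = int (nat k) \<or> k = - int (nat (- k))" by linarith
    then show "k \<in> range int \<union> range (\<lambda>n. - int n)" by blast
  qed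
  ultimately show ?thesis by simp
qed

abbreviation in_strip :: "real \<Rightarrow> real \<Rightarrow> real \<Rightarrow> int \<times> int \<Rightarrow> bool" where
  "in_strip b c R p \<equiv> \<bar>b * of_int (fst p) + c * of_int (snd p)\<bar> \<le> R"

lemma card_linear_strip:
  fixes b c R :: real
  assumes "c \<noteq> 0" "R \<ge> 0" "finite A"
  shows "finite {p::int \<times> int. fst p \<in> A \<and> in_strip b c R p}"
    and "real (card {p::int \<times> int. fst p \<in> A \<and> in_strip b c R p})
           \<le> real (card A) * (2 * R / \<bar>c\<bar> + 1)"
proof -
  let ?B = "\<lambda>m::int. {n::int. - (b * of_int m / c) - R / \<bar>c\<bar> \<le> of_int n \<and> of_int n \<le> - (b * of_int m / c) + R / \<bar>c\<bar>}"
  have R: "R / \<bar>c\<bar> \<ge> 0" using assms by simp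
  have eq: "{p. fst p \<in> A \<and> in_strip b c R p} = Sigma A ?B"
  proof -
    have "\<bar>b * of_int m + c * of_int n\<bar> \<le> R \<longleftrightarrow> n \<in> ?B m" for m n
    proof -
      have "\<bar>b * of_int m + c * of_int n\<bar> = \<bar>c\<bar> * \<bar>b * of_int m / c + of_int n\<bar>"
        using assms(1) by (simp flip: abs_mult add: distrib_left)
      then have "\<bar>b * of_int m + c * of_int n\<bar> \<le> R \<longleftrightarrow> \<bar>b * of_int m / c + of_int n\<bar> \<le> R / \<bar>c\<bar>"
        using assms(1) by (simp add: field_simps)
      then show ?thesis by (auto simp: abs_le_iff)
    qed
    then show ?thesis
      by (intro set_eqI) (simp only: mem_Collect_eq Sigma_def UN_iff singleton_iff prod_eq_iff fst_conv snd_conv, blast)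
  qed
  have finB: "finite (?B m)" for m using R by (intro card_int_interval_le(1)) simp
  show "finite {p. fst p \<in> A \<and> in_strip b c R p}"
    unfolding eq using assms finB by blast
  have "real (card (Sigma A ?B)) = (\<Sum>m\<in>A. real (card (?B m)))"
    using assms finB by simp
  also have "\<dots> \<le> (\<Sum>m\<in>A. 2 * R / \<bar>c\<bar> + 1)"
  proof (intro sum_mono)
    fix m
    have "- (b * of_int m / c) - R / \<bar>c\<bar> \<le> - (b * of_int m / c) + R / \<bar>c\<bar>" using R by linarith
    from card_int_interval_le(2)[OF this] show "real (card (?B m)) \<le> 2 * R / \<bar>c\<bar> + 1" by simp
  qed
  finally show "real (card {p. fst p \<in> A \<and> in_strip b c R p})
           \<le> real (card A) * (2 * R / \<bar>c\<bar> + 1)"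
    unfolding eq by simp
qed

context rect_torus begin

lemma card_strip_aux:
  fixes d :: real
  assumes "c \<noteq> 0" "X \<ge> 1" "R \<ge> 1" "d > 0"
  shows "real (card {p::int \<times> int. \<bar>of_int (fst p)\<bar> \<le> d * sqrt X \<and> in_strip b c R p})
           \<le> (2 * d + 1) * (2 / \<bar>c\<bar> + 1) * (R * sqrt X)" (is "real (card ?S) \<le> _")
    and "finite {p::int \<times> int. \<bar>of_int (fst p)\<bar> \<le> d * sqrt X \<and> in_strip b c R p}"
proof -
  let ?A = "{k::int. - (d * sqrt X) \<le> of_int k \<and> of_int k \<le> d * sqrt X}"
  have le: "- (d * sqrt X) \<le> d * sqrt X" using assms by (simp add: order_trans[of _ 0])
  have S: "?S = {p. fst p \<in> ?A \<and> in_strip b c R p}"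
    by (auto simp: abs_le_iff)
  have s1: "sqrt X \<ge> 1" using assms by simp
  show "finite ?S" unfolding S using assms card_int_interval_le(1)[OF le] by (intro card_linear_strip(1)) auto
  have "real (card ?S) \<le> real (card ?A) * (2 * R / \<bar>c\<bar> + 1)"
    unfolding S using assms card_int_interval_le(1)[OF le] by (intro card_linear_strip(2)) auto
  also have "\<dots> \<le> ((2 * d + 1) * sqrt X) * ((2 / \<bar>c\<bar> + 1) * R)"
  proof (intro mult_mono)
    have "real (card ?A) \<le> 2 * (d * sqrt X) + 1" using card_int_interval_le(2)[OF le] by simp
    also have "\<dots> \<le> (2 * d + 1) * sqrt X" using s1 by (simp add: algebra_simps)
    finally show "real (card ?A) \<le> (2 * d + 1) * sqrt X" .
    show "2 * R / \<bar>c\<bar> + 1 \<le> (2 / \<bar>c\<bar> + 1) * R" using assms by (simp add: algebra_simps)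
  qed (use assms in auto)
  finally show "real (card ?S) \<le> (2 * d + 1) * (2 / \<bar>c\<bar> + 1) * (R * sqrt X)" by (simp add: mult_ac)
qed

text \<open>A coordinate with nonzero coefficient is confined to an interval of length \<open>O(R)\<close> as soon as the other coordinate is
  fixed, which can be done in \<open>O(sqrt X)\<close> ways.\<close>

lemma card_strip:
  assumes "b \<noteq> 0 \<or> c \<noteq> 0"
  shows "\<exists>C>0. \<forall>X\<ge>1. \<forall>R\<ge>1. real (card {p. q p \<le> X \<and> in_strip b c R p}) \<le> C * (R * sqrt X)"
proof (cases "c \<noteq> 0")
  case True
  show ?thesis
  proof (intro exI conjI allI impI)
    show "(2 * (1/a) + 1) * (2 / \<bar>c\<bar> + 1) > 0" using a_pos by (simp add: add_pos_nonneg add_nonneg_pos)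
    fix X R :: real assume XR: "X \<ge> 1" "R \<ge> 1"
    have "card {p. q p \<le> X \<and> in_strip b c R p} \<le>
       card {p::int \<times> int. \<bar>of_int (fst p)\<bar> \<le> 1/a * sqrt X \<and> in_strip b c R p}"
      using True XR a_pos abs_coords_le by (intro card_mono card_strip_aux(2)) auto
    then show "real (card {p. q p \<le> X \<and> in_strip b c R p}) \<le> (2 * (1/a) + 1) * (2 / \<bar>c\<bar> + 1) * (R * sqrt X)"
      using card_strip_aux(1)[OF True XR, of "1/a" b] a_pos by simp
  qed
next
  case False
  then have b: "b \<noteq> 0" using assms by simp
  show ?thesis
  proof (intro exI conjI allI impI)
    show "(2 * a + 1) * (2 / \<bar>b\<bar> + 1) > 0" using a_pos by (simp add: add_pos_nonneg add_nonneg_pos)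
    fix X R :: real assume XR: "X \<ge> 1" "R \<ge> 1"
    let ?T = "{p::int \<times> int. \<bar>of_int (fst p)\<bar> \<le> a * sqrt X \<and> \<bar>c * of_int (fst p) + b * of_int (snd p)\<bar> \<le> R}"
    have fin: "finite ?T" using b XR a_pos by (rule card_strip_aux(2))
    have "card {p. q p \<le> X \<and> in_strip b c R p} \<le> card ?T"
      using abs_coords_le(2) fin
      by (intro card_inj_on_le[where f = prod.swap]) (auto simp: add.commute)
    then show "real (card {p. q p \<le> X \<and> in_strip b c R p}) \<le> (2 * a + 1) * (2 / \<bar>b\<bar> + 1) * (R * sqrt X)"
      using card_strip_aux(1)[OF b XR a_pos, of c] by simp
  qed
qed

text \<open>Up to a constant \<open>(1 + |m|) (1 + |n|) \<le> 1 + q (m, n)\<close>, so the lattice sum is dominated by a product of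
  two convergent series.\<close>

lemma summable_on_q_powr: "(\<lambda>p. (1 + q p) powr (-3/2)) summable_on UNIV"
proof (rule summable_on_comparison_test)
  let ?K = "2 + 1 / a\<^sup>2 + a\<^sup>2"
  let ?\<phi> = "\<lambda>k::int. (1 + \<bar>real_of_int k\<bar>) powr (-3/2)"
  have "(\<lambda>p. case p of (m, n) \<Rightarrow> ?\<phi> m * ?\<phi> n) summable_on (UNIV \<times> UNIV)"
  proof (rule summable_on_SigmaI)
    show "((\<lambda>n. case (m, n) of (m, n) \<Rightarrow> ?\<phi> m * ?\<phi> n) has_sum (?\<phi> m * infsum ?\<phi> UNIV)) UNIV" for m
      using has_sum_cmult_right[OF has_sum_infsum[OF summable_on_int_powr]] by simp
    show "(\<lambda>m. ?\<phi> m * infsum ?\<phi> UNIV) summable_on UNIV"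
      by (intro summable_on_cmult_left summable_on_int_powr)
  qed auto
  then show "(\<lambda>p. ?K powr (3/2) * (?\<phi> (fst p) * ?\<phi> (snd p))) summable_on UNIV"
    by (intro summable_on_cmult_right) (simp add: case_prod_beta)
  fix p :: "int \<times> int"
  define x y where "x = \<bar>real_of_int (fst p)\<bar>" and "y = \<bar>real_of_int (snd p)\<bar>"
  have xy: "x \<ge> 0" "y \<ge> 0" by (simp_all add: x_def y_def)
  have K: "?K > 0" using a_pos by (simp add: add_pos_nonneg)
  have "(1 + x) * (1 + y) \<le> 2 + x\<^sup>2 + y\<^sup>2"
    using sum_squares_bound[of x y] sum_squares_bound[of x 1] sum_squares_bound[of y 1] by (simp add: algebra_simps)
  also have "\<dots> \<le> ?K * (1 + q p)"
  proof -
    have "q p = a\<^sup>2 * x\<^sup>2 + y\<^sup>2 / a\<^sup>2" by (simp add: q_def x_def y_def power_mult_distrib power_divide)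
    then have "?K * (1 + q p) = ?K * (1 + (a\<^sup>2 * x\<^sup>2 + y\<^sup>2 / a\<^sup>2))" by simp
    also have "\<dots> = (2 + x\<^sup>2 + y\<^sup>2) + (1 / a\<^sup>2 + a\<^sup>2 + 2 * (a\<^sup>2 * x\<^sup>2 + y\<^sup>2 / a\<^sup>2) + y\<^sup>2 / a^4 + a^4 * x\<^sup>2)"
      using a_pos by (simp add: field_simps power2_eq_square power4_eq_xxxx)
    finally have "?K * (1 + q p) = (2 + x\<^sup>2 + y\<^sup>2) + (1 / a\<^sup>2 + a\<^sup>2 + 2 * (a\<^sup>2 * x\<^sup>2 + y\<^sup>2 / a\<^sup>2) + y\<^sup>2 / a^4 + a^4 * x\<^sup>2)" .
    moreover have "0 \<le> 1 / a\<^sup>2 + a\<^sup>2 + 2 * (a\<^sup>2 * x\<^sup>2 + y\<^sup>2 / a\<^sup>2) + y\<^sup>2 / a^4 + a^4 * x\<^sup>2"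
      using a_pos by (intro add_nonneg_nonneg mult_nonneg_nonneg divide_nonneg_nonneg) auto
    ultimately show ?thesis by linarith
  qed
  finally have "((1 + x) * (1 + y)) / ?K \<le> 1 + q p" using K by (simp add: field_simps)
  then have "(1 + q p) powr (-3/2) \<le> (((1 + x) * (1 + y)) / ?K) powr (-3/2)"
    using xy K by (intro powr_mono2') auto
  also have "\<dots> = ?K powr (3/2) * (?\<phi> (fst p) * ?\<phi> (snd p))"
  proof -
    have "(((1 + x) * (1 + y)) / ?K) powr (-3/2) = ((1 + x) powr (-3/2) * (1 + y) powr (-3/2)) / ?K powr (-3/2)"
      using xy K by (subst powr_divide, simp, simp, subst powr_mult) simp_all
    moreover have "?K powr (-3/2) = 1 / ?K powr (3/2)" using powr_minus_divide[of ?K "3/2"] by simp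
    ultimately show ?thesis by (simp add: x_def y_def)
  qed
  finally show "(1 + q p) powr (-3/2) \<le> ?K powr (3/2) * (?\<phi> (fst p) * ?\<phi> (snd p))" .
qed simp

lemma summable_on_inverse_q_sq: "(\<lambda>p. 1 / (1 + (q p)\<^sup>2)) summable_on UNIV"
proof (rule summable_on_comparison_test)
  show "(\<lambda>p. 2 * (1 + q p) powr (-3/2)) summable_on UNIV"
    by (intro summable_on_cmult_right summable_on_q_powr)
  fix p
  have "(1 + q p) powr (3/2) \<le> (1 + q p) powr 2" by (intro powr_mono) simp_all
  also have "\<dots> = (1 + q p)\<^sup>2" using q_nonneg[of p] by (intro powr_numeral) linarith
  also have "\<dots> \<le> 2 * (1 + (q p)\<^sup>2)" using sum_squares_bound[of "q p" 1] by (simp add: algebra_simps power2_eq_square)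
  finally have "(1 + q p) powr (3/2) \<le> 2 * (1 + (q p)\<^sup>2)" .
  moreover have "1 + q p > 0" using q_nonneg[of p] by linarith
  moreover have "(1 + q p) powr (3/2) > 0" using \<open>1 + q p > 0\<close> by simp
  moreover have "1 + (q p)\<^sup>2 > 0" by (simp add: add_pos_nonneg)
  ultimately show "1 / (1 + (q p)\<^sup>2) \<le> 2 * (1 + q p) powr (-3/2)"
    by (simp add: powr_minus field_simps)
qed simp

text \<open>The exponent \<open>-1/2\<close> comes from the gap between \<open>q\<^sup>2\<close> and the summable power \<open>q\<^bsup>3/2\<^esup>\<close>.\<close>

lemma infsum_far_tail:
  "\<exists>C>0. \<forall>X\<ge>1. (\<lambda>p. 1 / (q p)\<^sup>2) summable_on {p. X \<le> q p} \<and> (\<Sum>\<^sub>\<infinity>p\<in>{p. X \<le> q p}. 1 / (q p)\<^sup>2) \<le> C * X powr (-1/2)"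
proof (intro exI conjI allI impI)
  let ?S = "\<Sum>\<^sub>\<infinity>p. (1 + q p) powr (-3/2)"
  have S: "?S \<ge> 0" by (intro infsum_nonneg) simp
  show "4 * (?S + 1) > 0" using S by simp
  fix X :: real assume X: "X \<ge> 1"
  have bound: "1 / (q p)\<^sup>2 \<le> (4 * X powr (-1/2)) * (1 + q p) powr (-3/2)" if "p \<in> {p. X \<le> q p}" for p
  proof -
    have q: "q p \<ge> X" "q p \<ge> 1" using that X by auto
    have "X powr (1/2) * (1 + q p) powr (3/2) \<le> (1 + q p) powr (1/2) * (1 + q p) powr (3/2)"
      using q X by (intro mult_right_mono powr_mono2) auto
    also have "\<dots> = (1 + q p)\<^sup>2" using q by (simp add: powr_add[symmetric] powr_numeral)
    also have "\<dots> \<le> (2 * q p)\<^sup>2" using q by (intro power_mono) auto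
    also have "\<dots> = 4 * (q p)\<^sup>2" by (simp add: power_mult_distrib)
    finally show ?thesis using q X by (simp add: powr_minus field_simps)
  qed
  have sm: "(\<lambda>p. (4 * X powr (-1/2)) * (1 + q p) powr (-3/2)) summable_on {p. X \<le> q p}"
    by (intro summable_on_cmult_right summable_on_subset[OF summable_on_q_powr]) auto
  show sm1: "(\<lambda>p. 1 / (q p)\<^sup>2) summable_on {p. X \<le> q p}"
    by (rule summable_on_comparison_test[OF sm bound]) auto
  have "(\<Sum>\<^sub>\<infinity>p\<in>{p. X \<le> q p}. 1 / (q p)\<^sup>2) \<le> (\<Sum>\<^sub>\<infinity>p\<in>{p. X \<le> q p}. (4 * X powr (-1/2)) * (1 + q p) powr (-3/2))"
    by (rule infsum_mono[OF sm1 sm bound])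
  also have "\<dots> = (4 * X powr (-1/2)) * (\<Sum>\<^sub>\<infinity>p\<in>{p. X \<le> q p}. (1 + q p) powr (-3/2))"
    by (intro infsum_cmult_right summable_on_subset[OF summable_on_q_powr]) auto
  also have "\<dots> \<le> (4 * X powr (-1/2)) * ?S"
    by (intro mult_left_mono infsum_mono_neutral summable_on_subset[OF summable_on_q_powr] summable_on_q_powr) auto
  also have "\<dots> \<le> 4 * (?S + 1) * X powr (-1/2)" by (simp add: algebra_simps)
  finally show "(\<Sum>\<^sub>\<infinity>p\<in>{p. X \<le> q p}. 1 / (q p)\<^sup>2) \<le> 4 * (?S + 1) * X powr (-1/2)" .
qed

definition bin :: "nat \<Rightarrow> (int \<times> int) set" where
  "bin k = {p. real k \<le> q p \<and> q p < real k + 1}"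

lemma finite_bin [simp]: "finite (bin k)"
  unfolding bin_def by (rule finite_subset[OF _ finite_q_less[of "real k + 1"]]) auto

text \<open>Two frequencies in the same bin have eigenvalues less than \<open>1\<close> apart.\<close>

lemma sum_bin_sq_le:
  assumes "\<eta> > 0"
  shows "\<exists>C>0. \<forall>K\<ge>1. (\<Sum>k<K. (real (card (bin k)))\<^sup>2) \<le> C * real K powr (1 + \<eta>)"
proof -
  from q_energy[OF assms] obtain C where C: "C > 0"
    "\<And>X. X \<ge> 1 \<Longrightarrow> real (card (close_pairs X)) \<le> C * X powr (1 + \<eta>)" by auto
  show ?thesis
  proof (intro exI[of _ C] conjI allI impI C(1))
    fix K :: nat assume K: "K \<ge> 1"
    let ?E = "{(p, p'). q p \<le> real K \<and> q p' \<le> real K \<and> \<bar>q p - q p'\<bar> < 1}"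
    have finE: "finite ?E" by (rule finite_subset[of _ "{p. q p \<le> real K} \<times> {p. q p \<le> real K}"]) auto
    have "(\<Sum>k<K. (real (card (bin k)))\<^sup>2) = real (\<Sum>k<K. card (bin k \<times> bin k))"
      by (simp add: card_cartesian_product power2_eq_square)
    also have "(\<Sum>k<K. card (bin k \<times> bin k)) = card (\<Union>k<K. bin k \<times> bin k)"
    proof (rule card_UN_disjoint[symmetric])
      show "\<forall>i\<in>{..<K}. \<forall>j\<in>{..<K}. i \<noteq> j \<longrightarrow> (bin i \<times> bin i) \<inter> (bin j \<times> bin j) = {}"
        by (auto simp: bin_def)
    qed auto
    also have "real (card (\<Union>k<K. bin k \<times> bin k)) \<le> real (card ?E)"
      by (intro of_nat_mono card_mono finE) (auto simp: bin_def)
    also have "\<dots> \<le> C * real K powr (1 + \<eta>)" using C(2)[of "real K"] K by simp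
    finally show "(\<Sum>k<K. (real (card (bin k)))\<^sup>2) \<le> C * real K powr (1 + \<eta>)" .
  qed
qed

text \<open>Cauchy--Schwarz: if the frequencies took few distinct norms, there would be more coincidences among
  the norms than the energy allows.\<close>

lemma card_norms_lower:
  assumes "\<eta> > 0"
  shows "\<exists>c>0. \<forall>X\<ge>1. c * X powr (1 - \<eta>) \<le> real (card (q ` {p. q p \<le> X}))"
proof -
  from q_energy[OF assms] obtain C where C: "C > 0"
    "\<And>X. X \<ge> 1 \<Longrightarrow> real (card (close_pairs X)) \<le> C * X powr (1 + \<eta>)" by auto
  show ?thesis
  proof (intro exI[of _ "1 / (4 * C)"] conjI allI impI)
    show "1 / (4 * C) > 0" using C by simp
    fix X :: real assume X: "X \<ge> 1"
    define P where "P = {p. q p \<le> X}"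
    define r where "r = (\<lambda>s. real (card {p\<in>P. q p = s}))"
    have finP: "finite P" by (simp add: P_def)
    have "(\<Sum>s\<in>q ` P. (r s)\<^sup>2) = real (card {(x, y) \<in> P \<times> P. q x = q y})"
      unfolding r_def by (rule card_equal_pairs[OF finP, symmetric])
    also have "\<dots> \<le> real (card (close_pairs X))"
      by (intro of_nat_mono card_mono finite_subset[of "close_pairs X" "P \<times> P"])
         (auto simp: P_def)
    finally have r2: "(\<Sum>s\<in>q ` P. (r s)\<^sup>2) \<le> C * X powr (1 + \<eta>)" using C(2)[OF X] by linarith
    have "real (card P) = (\<Sum>s\<in>q ` P. r s)"
      using sum.image_gen[OF finP, of "\<lambda>_. 1::real" q] by (simp add: r_def)
    then have "X / 2 \<le> (\<Sum>s\<in>q ` P. r s * 1)" using card_q_le_lower[of X] X by (simp add: P_def)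
    then have "(X / 2)\<^sup>2 \<le> (\<Sum>s\<in>q ` P. r s * 1)\<^sup>2" using X by (intro power_mono) auto
    also have "\<dots> \<le> (\<Sum>s\<in>q ` P. (r s)\<^sup>2) * (\<Sum>s\<in>q ` P. 1\<^sup>2)"
      by (rule Cauchy_Schwarz_ineq_sum)
    also have "\<dots> \<le> (C * X powr (1 + \<eta>)) * real (card (q ` P))"
      using r2 by (simp add: mult_right_mono)
    finally have "X\<^sup>2 \<le> (4 * C * X powr (1 + \<eta>)) * real (card (q ` P))" by (simp add: power_divide)
    moreover have "X\<^sup>2 = X powr (1 - \<eta>) * X powr (1 + \<eta>)"
      using X by (simp add: powr_add[symmetric] powr_numeral)
    ultimately have "X powr (1 + \<eta>) * X powr (1 - \<eta>) \<le> X powr (1 + \<eta>) * (4 * C * real (card (q ` P)))"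
      by (simp add: mult_ac)
    then have "X powr (1 - \<eta>) \<le> 4 * C * real (card (q ` P))" using X by simp
    then show "1 / (4 * C) * X powr (1 - \<eta>) \<le> real (card (q ` {p. q p \<le> X}))"
      using C by (simp add: P_def field_simps)
  qed
qed

end

section \<open>The spectral equation and interlacing\<close>

context rect_torus begin

definition lattice_point :: "int \<times> int \<Rightarrow> real \<times> real" where
  "lattice_point p = (of_int (fst p) * a, of_int (snd p) / a)"

lemma inj_lattice_point: "inj lattice_point"
  using a_pos by (auto simp: inj_def lattice_point_def prod_eq_iff)

lemma dual_lattice_eq: "dual_lattice a = range lattice_point"
proof -
  have "dual_lattice a = {lattice_point (m, n) | m n. True}"
    by (simp add: dual_lattice_def lattice_point_def)
  also have "\<dots> = range lattice_point" by auto
  finally show ?thesis .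
qed

lemma norm_lattice_point: "(norm (lattice_point p))\<^sup>2 = q p"
  by (simp add: lattice_point_def norm_prod_def q_def power_mult_distrib power_divide mult.commute)

lemma laplace_spectrum_eq: "laplace_spectrum a = range q"
proof -
  have "laplace_spectrum a = {(norm \<xi>)\<^sup>2 | \<xi>. \<xi> \<in> range lattice_point}"
    by (simp only: laplace_spectrum_def dual_lattice_eq)
  also have "\<dots> = (\<lambda>p. (norm (lattice_point p))\<^sup>2) ` UNIV" by blast
  finally show ?thesis by (simp only: norm_lattice_point)
qed

definition spectral_term :: "real \<Rightarrow> int \<times> int \<Rightarrow> real" where
  "spectral_term \<mu> p = 1 / (q p - \<mu>) - q p / ((q p)\<^sup>2 + 1)"

definition spectral_fun :: "real \<Rightarrow> real" where
  "spectral_fun \<mu> = (\<Sum>\<^sub>\<infinity>p. spectral_term \<mu> p)"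

definition eigs :: "real \<Rightarrow> real set" where
  "eigs y = {\<mu>. \<mu> \<notin> range q \<and> spectral_fun \<mu> = y}"

lemma perturbed_eigenvalues_eq:
  "perturbed_eigenvalues a \<phi> = eigs (scatterer_c0 a * tan (\<phi> / 2))"
proof -
  have "(norm (lattice_point p)) ^ 4 = (q p)\<^sup>2" for p
    by (simp flip: norm_lattice_point)
  then have "(\<Sum>\<^sub>\<infinity>\<xi>\<in>dual_lattice a. 1 / ((norm \<xi>)\<^sup>2 - \<mu>) - (norm \<xi>)\<^sup>2 / ((norm \<xi>) ^ 4 + 1)) = spectral_fun \<mu>" for \<mu>
    unfolding dual_lattice_eq spectral_fun_def spectral_term_def
    by (subst infsum_reindex) (simp_all add: inj_lattice_point o_def norm_lattice_point)
  then show ?thesis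
    by (simp add: perturbed_eigenvalues_def eigs_def laplace_spectrum_eq)
qed

text \<open>The constant depends on \<open>\<mu>\<close> only through a bound for \<open>|\<mu>|\<close> and the distance to the spectrum, which
  makes the lattice sums converge uniformly on compact subsets of the resolvent set.\<close>

lemma inverse_shift_bound:
  assumes "\<bar>\<mu>\<bar> \<le> B" "0 < \<delta>" "\<delta> \<le> 1" "\<delta> \<le> \<bar>q p - \<mu>\<bar>"
  shows "1 / \<bar>q p - \<mu>\<bar> \<le> ((2 * B + 4) / \<delta>) / (1 + q p)"
proof -
  have B: "B \<ge> 0" and qp: "q p \<ge> 0" using assms by auto
  have "(1 + q p) * \<delta> \<le> (2 * B + 4) * \<bar>q p - \<mu>\<bar>"
  proof (cases "q p \<ge> 2 * B + 2")
    case True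
    then have "q p / 2 + 1 \<le> \<bar>q p - \<mu>\<bar>" using assms by linarith
    then have "4 * (q p / 2 + 1) \<le> (2 * B + 4) * \<bar>q p - \<mu>\<bar>"
      using B qp by (intro mult_mono) auto
    moreover have "(1 + q p) * \<delta> \<le> (1 + q p) * 1" using assms qp by (intro mult_left_mono) auto
    moreover have "(1 + q p) * 1 \<le> 4 * (q p / 2 + 1)" using qp by (simp add: algebra_simps)
    ultimately show ?thesis by linarith
  next
    case False
    then show ?thesis using assms B qp by (intro mult_mono) auto
  qed
  moreover have "(1 + q p) * \<delta> > 0" using assms(2) qp by (intro mult_pos_pos) linarith+
  moreover have "\<bar>q p - \<mu>\<bar> > 0" using assms by linarith
  ultimately have "1 / \<bar>q p - \<mu>\<bar> \<le> (2 * B + 4) / ((1 + q p) * \<delta>)"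
    by (simp add: divide_le_eq le_divide_eq mult.commute)
  then show ?thesis by (simp add: mult.commute)
qed

lemma spectral_term_bound:
  assumes "\<bar>\<mu>\<bar> \<le> B" "0 < \<delta>" "\<delta> \<le> 1" "\<delta> \<le> \<bar>q p - \<mu>\<bar>"
  shows "\<bar>spectral_term \<mu> p\<bar> \<le> ((1 + B) * ((2 * B + 4) / \<delta>)) * (1 / (1 + (q p)\<^sup>2))"
proof -
  have B: "B \<ge> 0" and qp: "q p \<ge> 0" and nz: "q p - \<mu> \<noteq> 0" using assms by auto
  have nz2: "(q p)\<^sup>2 + 1 > 0" by (simp add: add_nonneg_pos)
  have "spectral_term \<mu> p = (1 + q p * \<mu>) / (q p - \<mu>) / (1 + (q p)\<^sup>2)"
    using nz nz2 unfolding spectral_term_def by (simp add: field_simps power2_eq_square)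
  then have "\<bar>spectral_term \<mu> p\<bar> = \<bar>1 + q p * \<mu>\<bar> * (1 / \<bar>q p - \<mu>\<bar>) * (1 / (1 + (q p)\<^sup>2))"
    using nz2 by (simp add: abs_mult)
  also have "\<dots> \<le> ((1 + B) * (1 + q p)) * (((2 * B + 4) / \<delta>) / (1 + q p)) * (1 / (1 + (q p)\<^sup>2))"
  proof (intro mult_right_mono mult_mono inverse_shift_bound assms)
    have "\<bar>1 + q p * \<mu>\<bar> \<le> 1 + q p * \<bar>\<mu>\<bar>" using qp abs_triangle_ineq[of 1 "q p * \<mu>"] by (simp add: abs_mult)
    also have "\<dots> \<le> 1 + q p * B" using assms qp by (intro add_left_mono mult_left_mono)
    also have "\<dots> \<le> (1 + B) * (1 + q p)" using B qp by (simp add: algebra_simps)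
    finally show "\<bar>1 + q p * \<mu>\<bar> \<le> (1 + B) * (1 + q p)" .
  qed (use B qp in auto)
  also have "\<dots> = ((1 + B) * ((2 * B + 4) / \<delta>)) * (1 / (1 + (q p)\<^sup>2))"
  proof -
    have "1 + q p \<noteq> 0" using qp by linarith
    then show ?thesis by simp
  qed
  finally show ?thesis .
qed

lemma dist_spectrum_pos:
  assumes "\<And>p. q p \<notin> {\<alpha>..\<beta>}" "\<alpha> \<le> \<beta>"
  shows "\<exists>\<delta>>0. \<delta> \<le> 1 \<and> (\<forall>\<mu>\<in>{\<alpha>..\<beta>}. \<forall>p. \<delta> \<le> \<bar>q p - \<mu>\<bar>)"
proof -
  let ?S = "q ` {p. q p \<le> \<beta> + 1}"
  let ?D = "insert 1 ((\<lambda>s. \<bar>s - \<alpha>\<bar>) ` ?S \<union> (\<lambda>s. \<bar>s - \<beta>\<bar>) ` ?S)"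
  have fin: "finite ?D" by simp
  have "Min ?D \<in> ?D" using fin by (intro Min_in) auto
  moreover have "\<forall>d\<in>?D. d > 0" using assms by fastforce
  ultimately have pos: "Min ?D > 0" by blast
  show ?thesis
  proof (intro exI[of _ "Min ?D"] conjI ballI allI pos)
    show "Min ?D \<le> 1" using fin by (intro Min_le) auto
    fix \<mu> p assume \<mu>: "\<mu> \<in> {\<alpha>..\<beta>}"
    show "Min ?D \<le> \<bar>q p - \<mu>\<bar>"
    proof (cases "q p \<le> \<beta> + 1")
      case True
      then have "\<bar>q p - \<alpha>\<bar> \<in> ?D" "\<bar>q p - \<beta>\<bar> \<in> ?D" by auto
      then have "Min ?D \<le> \<bar>q p - \<alpha>\<bar>" "Min ?D \<le> \<bar>q p - \<beta>\<bar>" using fin by (auto intro!: Min_le simp del: Min_le_iff)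
      then show ?thesis using \<mu> assms(1)[of p] by auto
    next
      case False
      have "Min ?D \<le> 1" using fin by (intro Min_le) auto
      moreover have "1 \<le> \<bar>q p - \<mu>\<bar>" using False \<mu> by auto
      ultimately show ?thesis by linarith
    qed
  qed
qed

lemma dist_spectrum_pos_point:
  assumes "\<mu> \<notin> range q"
  shows "\<exists>\<delta>>0. \<delta> \<le> 1 \<and> (\<forall>p. \<delta> \<le> \<bar>q p - \<mu>\<bar>)"
  using dist_spectrum_pos[of \<mu> \<mu>] assms by auto

lemma summable_on_spectral_term:
  assumes "\<mu> \<notin> range q"
  shows "spectral_term \<mu> summable_on UNIV"
proof -
  from dist_spectrum_pos_point[OF assms] obtain \<delta> where \<delta>: "\<delta> > 0" "\<delta> \<le> 1" "\<And>p. \<delta> \<le> \<bar>q p - \<mu>\<bar>" by auto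
  have "(\<lambda>p. norm (spectral_term \<mu> p)) summable_on UNIV"
  proof (rule summable_on_comparison_test)
    show "(\<lambda>p. ((1 + \<bar>\<mu>\<bar>) * ((2 * \<bar>\<mu>\<bar> + 4) / \<delta>)) * (1 / (1 + (q p)\<^sup>2))) summable_on UNIV"
      by (intro summable_on_cmult_right summable_on_inverse_q_sq)
    show "norm (spectral_term \<mu> p) \<le> ((1 + \<bar>\<mu>\<bar>) * ((2 * \<bar>\<mu>\<bar> + 4) / \<delta>)) * (1 / (1 + (q p)\<^sup>2))" for p
      using spectral_term_bound[of \<mu> "\<bar>\<mu>\<bar>" \<delta> p] \<delta> by simp
  qed auto
  then show ?thesis by (rule abs_summable_summable)
qed

lemma summable_on_inverse_shift_sq:
  assumes "\<mu> \<notin> range q"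
  shows "(\<lambda>p. 1 / (q p - \<mu>)\<^sup>2) summable_on A"
proof -
  from dist_spectrum_pos_point[OF assms] obtain \<delta> where \<delta>: "\<delta> > 0" "\<delta> \<le> 1" "\<And>p. \<delta> \<le> \<bar>q p - \<mu>\<bar>" by auto
  let ?K = "(2 * \<bar>\<mu>\<bar> + 4) / \<delta>"
  have "(\<lambda>p. 1 / (q p - \<mu>)\<^sup>2) summable_on UNIV"
  proof (rule summable_on_comparison_test)
    show "(\<lambda>p. ?K\<^sup>2 * (1 / (1 + (q p)\<^sup>2))) summable_on UNIV"
      by (intro summable_on_cmult_right summable_on_inverse_q_sq)
    fix p
    have "1 / (q p - \<mu>)\<^sup>2 = (1 / \<bar>q p - \<mu>\<bar>)\<^sup>2" by (simp add: power_divide)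
    also have "\<dots> \<le> (?K / (1 + q p))\<^sup>2"
      using inverse_shift_bound[of \<mu> "\<bar>\<mu>\<bar>" \<delta> p] \<delta> by (intro power_mono) auto
    also have "\<dots> = ?K\<^sup>2 * (1 / (1 + q p)\<^sup>2)" by (simp add: power_divide power_mult_distrib)
    also have "\<dots> \<le> ?K\<^sup>2 * (1 / (1 + (q p)\<^sup>2))"
    proof (intro mult_left_mono divide_left_mono)
      show "1 + (q p)\<^sup>2 \<le> (1 + q p)\<^sup>2" using q_nonneg[of p] by (simp add: power2_eq_square algebra_simps)
      have "1 + q p > 0" "1 + (q p)\<^sup>2 > 0" using q_nonneg[of p] by (linarith, simp add: add_pos_nonneg)
      then show "0 < (1 + q p)\<^sup>2 * (1 + (q p)\<^sup>2)" by simp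
    qed auto
    finally show "1 / (q p - \<mu>)\<^sup>2 \<le> ?K\<^sup>2 * (1 / (1 + (q p)\<^sup>2))" .
  qed auto
  then show ?thesis by (rule summable_on_subset) auto
qed

text \<open>The Weierstrass test with the majorant from \<open>spectral_term_bound\<close>.\<close>

lemma continuous_on_spectral_fun:
  assumes "\<And>p. q p \<notin> {\<alpha>..\<beta>}" "\<alpha> \<le> \<beta>"
  shows "continuous_on {\<alpha>..\<beta>} spectral_fun"
proof -
  from dist_spectrum_pos[OF assms] obtain \<delta> where \<delta>: "\<delta> > 0" "\<delta> \<le> 1"
    "\<And>\<mu> p. \<mu> \<in> {\<alpha>..\<beta>} \<Longrightarrow> \<delta> \<le> \<bar>q p - \<mu>\<bar>" by auto
  define B where "B = max \<bar>\<alpha>\<bar> \<bar>\<beta>\<bar>"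
  have "uniform_limit {\<alpha>..\<beta>} (\<lambda>F \<mu>. \<Sum>p\<in>F. spectral_term \<mu> p) (\<lambda>\<mu>. \<Sum>\<^sub>\<infinity>p. spectral_term \<mu> p) (finite_subsets_at_top UNIV)"
  proof (rule Weierstrass_m_test_general)
    show "(\<lambda>p. ((1 + B) * ((2 * B + 4) / \<delta>)) * (1 / (1 + (q p)\<^sup>2))) summable_on UNIV"
      by (intro summable_on_cmult_right summable_on_inverse_q_sq)
    show "norm (spectral_term \<mu> p) \<le> ((1 + B) * ((2 * B + 4) / \<delta>)) * (1 / (1 + (q p)\<^sup>2))"
      if "\<mu> \<in> {\<alpha>..\<beta>}" for p \<mu>
    proof -
      have "\<bar>\<mu>\<bar> \<le> B" using that by (auto simp: B_def)
      then show ?thesis using spectral_term_bound[of \<mu> B \<delta> p] \<delta> that by simp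
    qed
  qed
  moreover have "continuous_on {\<alpha>..\<beta>} (\<lambda>\<mu>. \<Sum>p\<in>F. spectral_term \<mu> p)" for F
    unfolding spectral_term_def using assms(1) by (intro continuous_intros) auto
  ultimately have "continuous_on {\<alpha>..\<beta>} (\<lambda>\<mu>. \<Sum>\<^sub>\<infinity>p. spectral_term \<mu> p)"
    by (intro uniform_limit_theorem[where F = "finite_subsets_at_top UNIV"]) (auto intro!: always_eventually)
  then show ?thesis by (simp add: spectral_fun_def[abs_def])
qed

lemma spectral_term_strict_mono:
  assumes "\<mu> < \<mu>'" "q p < \<mu> \<or> \<mu>' < q p"
  shows "spectral_term \<mu> p < spectral_term \<mu>' p"
proof -
  have "1 / (q p - \<mu>) < 1 / (q p - \<mu>')"
    using assms by (auto intro: divide_strict_left_mono divide_strict_left_mono_neg simp: divide_less_cancel mult_neg_neg frac_less2)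
      (simp add: divide_simps mult_neg_neg)?
  then show ?thesis by (simp add: spectral_term_def)
qed

lemma spectral_fun_strict_mono:
  assumes "\<mu> < \<mu>'" "\<And>p. q p \<notin> {\<mu>..\<mu>'}"
  shows "spectral_fun \<mu> < spectral_fun \<mu>'"
proof -
  have lt: "spectral_term \<mu> p < spectral_term \<mu>' p" for p
    using assms(2)[of p] by (intro spectral_term_strict_mono assms) auto
  have "\<mu> \<notin> range q" "\<mu>' \<notin> range q" using assms by (force, metis atLeastAtMost_iff less_imp_le order_refl rangeE)
  then have "spectral_term \<mu> summable_on UNIV" "spectral_term \<mu>' summable_on UNIV"
    by (auto intro: summable_on_spectral_term)
  then show ?thesis unfolding spectral_fun_def
    using lt by (intro has_sum_strict_mono[OF has_sum_infsum has_sum_infsum, of _ UNIV _ "(0,0)"]) (auto intro: less_imp_le)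
qed

lemma spectral_fun_remove:
  assumes "\<mu> \<notin> range q"
  shows "spectral_fun \<mu> = spectral_term \<mu> p0 + (\<Sum>\<^sub>\<infinity>p\<in>-{p0}. spectral_term \<mu> p)"
proof -
  have "UNIV = {p0} \<union> - {p0}" by auto
  then have "spectral_fun \<mu> = (\<Sum>\<^sub>\<infinity>p\<in>{p0} \<union> - {p0}. spectral_term \<mu> p)" by (simp add: spectral_fun_def)
  also have "\<dots> = (\<Sum>\<^sub>\<infinity>p\<in>{p0}. spectral_term \<mu> p) + (\<Sum>\<^sub>\<infinity>p\<in>-{p0}. spectral_term \<mu> p)"
    by (intro infsum_Un_disjoint summable_on_subset[OF summable_on_spectral_term[OF assms]]) auto
  finally show ?thesis by simp
qed

text \<open>The term of a frequency with norm \<open>s\<close> tends to \<open>-\<infinity>\<close> at the left end of the gap and that of a frequency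
  with norm \<open>s'\<close> tends to \<open>\<infinity>\<close> at the right end. The other terms increase along the gap, so towards either
  end their sum is bounded on the required side by its value at the midpoint; then the intermediate
  value theorem applies.\<close>

lemma eigenvalue_in_gap:
  assumes "s \<in> range q" "s' \<in> range q" "s < s'" "\<And>p. q p \<notin> {s<..<s'}"
  shows "\<exists>\<mu>. s < \<mu> \<and> \<mu> < s' \<and> \<mu> \<in> eigs y"
proof -
  obtain p0 p1 where p: "q p0 = s" "q p1 = s'" using assms by auto
  define m where "m = (s + s') / 2"
  have m: "s < m" "m < s'" using assms by (auto simp: m_def)
  have gap: "\<mu> \<notin> range q" if "s < \<mu>" "\<mu> < s'" for \<mu> using assms(4) that by auto
  have gap2: "q p < \<mu> \<or> \<mu>' < q p" if "s < \<mu>" "\<mu>' < s'" "\<mu> \<le> \<mu>'" for \<mu> \<mu>' p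
  proof -
    have "q p \<le> s \<or> s' \<le> q p" using assms(4)[of p] by auto
    then show ?thesis using that by linarith
  qed
  have mono: "(\<Sum>\<^sub>\<infinity>p\<in>-{r}. spectral_term \<mu> p) \<le> (\<Sum>\<^sub>\<infinity>p\<in>-{r}. spectral_term \<mu>' p)"
    if "s < \<mu>" "\<mu>' < s'" "\<mu> \<le> \<mu>'" for \<mu> \<mu>' r
  proof (rule infsum_mono)
    show "spectral_term \<mu> summable_on - {r}" "spectral_term \<mu>' summable_on - {r}"
      using gap[of \<mu>] gap[of \<mu>'] that
      by (auto intro!: summable_on_subset[OF summable_on_spectral_term] simp del: image_iff)
    show "spectral_term \<mu> p \<le> spectral_term \<mu>' p" for p
      using spectral_term_strict_mono[of \<mu> \<mu>' p] gap2[OF that, of p] that by (cases "\<mu> = \<mu>'") auto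
  qed
  \<comment> \<open>\<open>A\<close> dominates everything except the pole, so at distance at most \<open>1 / A\<close> from the end the pole decides the sign\<close>
  define A where "A = \<bar>y\<bar> + \<bar>\<Sum>\<^sub>\<infinity>p\<in>-{p0}. spectral_term m p\<bar> + \<bar>\<Sum>\<^sub>\<infinity>p\<in>-{p1}. spectral_term m p\<bar> + \<bar>s / (s\<^sup>2 + 1)\<bar> + \<bar>s' / (s'\<^sup>2 + 1)\<bar> + 1"
  have A: "A > 0" unfolding A_def by linarith
  define d where "d = min (1 / A) ((s' - s) / 2)"
  have d: "d > 0" "d \<le> (s' - s) / 2" "d \<le> 1 / A" using A assms(3) unfolding d_def by (simp_all only: min_less_iff_conj min.cobounded1 min.cobounded2) simp_all
  have dA: "1 / d \<ge> A" using d A by (simp add: field_simps)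
  define l where "l = s + d"
  define u where "u = s' - d"
  have l: "s < l" "l \<le> m" and u: "m \<le> u" "u < s'" using d by (auto simp: l_def u_def m_def field_simps)
  have "spectral_fun l = spectral_term l p0 + (\<Sum>\<^sub>\<infinity>p\<in>-{p0}. spectral_term l p)"
    using l m by (intro spectral_fun_remove gap) auto
  also have "\<dots> \<le> spectral_term l p0 + (\<Sum>\<^sub>\<infinity>p\<in>-{p0}. spectral_term m p)"
    using l m by (intro add_left_mono mono) auto
  also have "spectral_term l p0 = - (1 / d) - s / (s\<^sup>2 + 1)" by (simp add: spectral_term_def p l_def)
  finally have Fl: "spectral_fun l \<le> y" using dA unfolding A_def by linarith
  have "spectral_term u p1 + (\<Sum>\<^sub>\<infinity>p\<in>-{p1}. spectral_term m p) \<le> spectral_term u p1 + (\<Sum>\<^sub>\<infinity>p\<in>-{p1}. spectral_term u p)"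
    using u m by (intro add_left_mono mono) auto
  also have "\<dots> = spectral_fun u"
    using u m by (intro spectral_fun_remove[symmetric] gap) auto
  also have "spectral_term u p1 = 1 / d - s' / (s'\<^sup>2 + 1)" by (simp add: spectral_term_def p u_def)
  finally have Fu: "y \<le> spectral_fun u" using dA unfolding A_def by linarith
  have "continuous_on {l..u} spectral_fun"
  proof (rule continuous_on_spectral_fun)
    show "q p \<notin> {l..u}" for p using assms(4)[of p] l u by auto
    show "l \<le> u" using l u by linarith
  qed
  then obtain \<mu> where "l \<le> \<mu>" "\<mu> \<le> u" "spectral_fun \<mu> = y"
    using IVT'[of spectral_fun l y u] Fl Fu l u by auto
  then show ?thesis using l u gap[of \<mu>] by (intro exI[of _ \<mu>]) (auto simp: eigs_def)
qed

definition next_norm :: "real \<Rightarrow> real" where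
  "next_norm x = (LEAST s. s \<in> range q \<and> x < s)"

lemma ex_norm_gt: "\<exists>p. x < q p"
proof -
  obtain k :: nat where k: "(\<bar>x\<bar> + 1) / a\<^sup>2 < real k" using reals_Archimedean2 by blast
  then have "\<bar>x\<bar> + 1 < a\<^sup>2 * real k" using a_pos by (simp add: field_simps)
  also have "\<dots> \<le> a\<^sup>2 * (real k)\<^sup>2"
    by (intro mult_left_mono) (auto simp: power2_eq_square, metis le_square of_nat_le_iff of_nat_mult)
  also have "\<dots> = q (int k, 0)" by (simp add: q_def power_mult_distrib)
  finally have "x < q (int k, 0)" by linarith
  then show ?thesis ..
qed

lemma next_norm:
  shows "next_norm x \<in> range q" "x < next_norm x" "\<And>p. x < q p \<Longrightarrow> next_norm x \<le> q p"
proof -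
  obtain p0 where p0: "x < q p0" using ex_norm_gt by blast
  let ?S = "q ` {p. x < q p \<and> q p \<le> q p0}"
  have fin: "finite ?S" by (intro finite_imageI finite_subset[OF _ finite_q_le[of "q p0"]]) auto
  have "q p0 \<in> ?S" using p0 by blast
  then have "Min ?S \<in> ?S" by (intro Min_in fin) blast
  then have 1: "Min ?S \<in> range q" "x < Min ?S" "Min ?S \<le> q p0" by auto
  have 2: "Min ?S \<le> q p" if "x < q p" for p
  proof (cases "q p \<le> q p0")
    case True
    then have "q p \<in> ?S" using that by auto
    then show ?thesis by (rule Min_le[OF fin])
  next
    case False
    then show ?thesis using 1 by linarith
  qed
  have "next_norm x = Min ?S" unfolding next_norm_def
    using 1 2 by (intro Least_equality) blast+
  then show "next_norm x \<in> range q" "x < next_norm x" "\<And>p. x < q p \<Longrightarrow> next_norm x \<le> q p"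
    using 1 2 by simp_all
qed

text \<open>The spectral function is injective on a gap, so a norm separates any two solutions.\<close>

lemma next_norm_less_eig:
  assumes "\<mu> \<in> eigs y" "\<mu>' \<in> eigs y" "\<mu> < \<mu>'"
  shows "next_norm \<mu> < \<mu>'"
proof -
  have "\<exists>p. q p \<in> {\<mu>..\<mu>'}"
    using spectral_fun_strict_mono[OF assms(3)] assms(1,2) by (force simp: eigs_def)
  then obtain p where p: "\<mu> \<le> q p" "q p \<le> \<mu>'" by auto
  moreover have "q p \<noteq> \<mu>" "q p \<noteq> \<mu>'" using assms(1,2) by (auto simp: eigs_def)
  ultimately show ?thesis using next_norm(3)[of \<mu> p] by linarith
qed

lemma inj_on_next_norm: "inj_on next_norm (eigs y)"
proof (rule linorder_inj_onI')
  fix \<mu> \<mu>' assume "\<mu> \<in> eigs y" "\<mu>' \<in> eigs y" "\<mu> < \<mu>'"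
  then show "next_norm \<mu> \<noteq> next_norm \<mu>'"
    using next_norm_less_eig[of \<mu> y \<mu>'] next_norm(2)[of \<mu>'] by linarith
qed

text \<open>The next norm separates eigenvalues, hence is an injective function of them; only the last eigenvalue
  below \<open>X\<close> can have its next norm beyond \<open>X\<close>.\<close>

lemma eigs_cut_subset:
  assumes "M \<subseteq> eigs y" "\<And>\<mu>. \<mu> \<in> M \<Longrightarrow> \<mu> < X" "finite S" "\<And>\<mu>. \<mu> \<in> M \<Longrightarrow> next_norm \<mu> < X \<Longrightarrow> next_norm \<mu> \<in> S"
  shows "finite M" "card M \<le> card S + 1"
proof -
  let ?M1 = "{\<mu>\<in>M. next_norm \<mu> < X}" and ?M2 = "{\<mu>\<in>M. next_norm \<mu> \<ge> X}"
  have inj: "inj_on next_norm ?M1" using assms(1) by (intro inj_on_subset[OF inj_on_next_norm[of y]]) auto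
  have sub: "next_norm ` ?M1 \<subseteq> S" using assms(4) by auto
  have fin1: "finite ?M1" using inj sub assms(3) by (meson finite_imageD finite_subset)
  have c1: "card ?M1 \<le> card S" using inj sub assms(3) by (rule card_inj_on_le)
  have M2: "x = z" if "x \<in> ?M2" "z \<in> ?M2" for x z
  proof (rule ccontr)
    assume "x \<noteq> z"
    then consider "x < z" | "z < x" by linarith
    then show False
    proof cases
      case 1
      then have "next_norm x < z" using that assms(1) by (intro next_norm_less_eig) auto
      then show False using that assms(2)[of z] by auto
    next
      case 2
      then have "next_norm z < x" using that assms(1) by (intro next_norm_less_eig) auto
      then show False using that assms(2)[of x] by auto
    qed
  qed
  have fin2: "finite ?M2" and c2: "card ?M2 \<le> 1"
  proof -
    have "?M2 = {} \<or> (\<exists>x. ?M2 = {x})" using M2 by blast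
    then show "finite ?M2" "card ?M2 \<le> 1" by (elim disjE exE; simp only: finite.emptyI finite.insertI card.empty; simp)+
  qed
  have M: "M = ?M1 \<union> ?M2" by auto
  then show "finite M" using fin1 fin2 by (metis (no_types, lifting) finite_UnI)
  have "card M \<le> card ?M1 + card ?M2" by (subst M) (rule card_Un_le)
  then show "card M \<le> card S + 1" using c1 c2 by linarith
qed

lemma eigs_le_upper:
  shows "finite {\<mu>\<in>eigs y. \<mu> \<le> X}" and "card {\<mu>\<in>eigs y. \<mu> \<le> X} \<le> card {p. q p \<le> X + 1} + 1"
proof -
  have *: "finite {\<mu>\<in>eigs y. \<mu> \<le> X}" "card {\<mu>\<in>eigs y. \<mu> \<le> X} \<le> card (q ` {p. q p \<le> X + 1}) + 1"
    by (rule eigs_cut_subset[where y = y and X = "X + 1" and S = "q ` {p. q p \<le> X + 1}"]; use next_norm(1) in fastforce)+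
  show "finite {\<mu>\<in>eigs y. \<mu> \<le> X}" by fact
  have "card (q ` {p. q p \<le> X + 1}) \<le> card {p. q p \<le> X + 1}" by (intro card_image_le) simp
  then show "card {\<mu>\<in>eigs y. \<mu> \<le> X} \<le> card {p. q p \<le> X + 1} + 1" using * by linarith
qed

definition eig_bin :: "real \<Rightarrow> nat \<Rightarrow> real set" where
  "eig_bin y k = {\<mu>\<in>eigs y. real k \<le> \<mu> \<and> \<mu> < real k + 1}"

lemma eig_bin_le:
  shows "finite (eig_bin y k)" "card (eig_bin y k) \<le> card (bin k) + 1"
proof -
  have S: "next_norm \<mu> \<in> q ` bin k" if "\<mu> \<in> eig_bin y k" "next_norm \<mu> < real k + 1" for \<mu>
  proof -
    obtain p where p: "next_norm \<mu> = q p" using next_norm(1)[of \<mu>] by auto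
    moreover have "real k \<le> q p" using that next_norm(2)[of \<mu>] p by (auto simp: eig_bin_def)
    ultimately show ?thesis using that by (auto simp: bin_def)
  qed
  have *: "finite (eig_bin y k)" "card (eig_bin y k) \<le> card (q ` bin k) + 1"
    by (rule eigs_cut_subset[where y = y and X = "real k + 1" and S = "q ` bin k"]; use S in \<open>auto simp: eig_bin_def\<close>)+
  show "finite (eig_bin y k)" by fact
  have "card (q ` bin k) \<le> card (bin k)" by (intro card_image_le) simp
  then show "card (eig_bin y k) \<le> card (bin k) + 1" using * by linarith
qed

text \<open>Choose an eigenvalue in the gap to the right of each norm; the gap after the largest norm below \<open>X\<close> may
  contribute an eigenvalue beyond \<open>X\<close>.\<close>

lemma eigs_le_lower:
  "card (q ` {p. q p \<le> X}) \<le> card {\<mu>\<in>eigs y. \<mu> \<le> X} + 1"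
proof -
  let ?S = "q ` {p. q p \<le> X}"
  have finS: "finite ?S" by simp
  have ex: "\<exists>\<mu>. s < \<mu> \<and> \<mu> < next_norm s \<and> \<mu> \<in> eigs y" if "s \<in> range q" for s
    using that next_norm[of s] by (intro eigenvalue_in_gap) (auto simp: not_less, metis not_less)
  then obtain g where g: "\<And>s. s \<in> range q \<Longrightarrow> s < g s \<and> g s < next_norm s \<and> g s \<in> eigs y" by metis
  have mono: "g s < g t" if "s \<in> range q" "t \<in> range q" "s < t" for s t
    using g[OF that(1)] g[OF that(2)] next_norm(3)[of s] that by force
  have "card (?S - {Max ?S}) \<le> card {\<mu>\<in>eigs y. \<mu> \<le> X}"
  proof (rule card_inj_on_le[where f = g])
    show "inj_on g (?S - {Max ?S})"
      by (rule linorder_inj_onI') (use mono in \<open>fastforce simp: image_iff\<close>)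
    show "finite {\<mu>\<in>eigs y. \<mu> \<le> X}" by (rule eigs_le_upper)
    show "g ` (?S - {Max ?S}) \<subseteq> {\<mu>\<in>eigs y. \<mu> \<le> X}"
    proof
      fix x assume "x \<in> g ` (?S - {Max ?S})"
      then obtain s where s: "x = g s" "s \<in> ?S" "s \<noteq> Max ?S" by auto
      have "Max ?S \<in> ?S" using s finS by (intro Max_in) auto
      then obtain p where p: "Max ?S = q p" "q p \<le> X" by auto
      have "s < q p" using s p Max_ge[OF finS s(2)] by linarith
      then have "next_norm s \<le> X" using next_norm(3)[of s p] p by linarith
      then show "x \<in> {\<mu>\<in>eigs y. \<mu> \<le> X}" using g[of s] s by force
    qed
  qed
  moreover have "card ?S \<le> card (?S - {Max ?S}) + 1"
    using diff_card_le_card_Diff[of "{Max ?S}" ?S] by simp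
  ultimately show ?thesis by linarith
qed

end

section \<open>Sparse sets of perturbed eigenvalues\<close>

text \<open>Compare with the telescoping sum of \<open>4 / ((d + L) (d + 1 + L))\<close>.\<close>

lemma sum_cauchy_kernel_le:
  fixes L :: real
  assumes "L \<ge> 1"
  shows "(\<Sum>d<N. 1 / ((real d)\<^sup>2 + L\<^sup>2)) \<le> 4 / L"
proof -
  have "(\<Sum>d<N. 1 / ((real d)\<^sup>2 + L\<^sup>2)) \<le> 4 / L - 4 / (real N + L)"
  proof (induction N)
    case (Suc N)
    have pos: "real N + L > 0" using assms by linarith
    have "(real N + L) * (real (Suc N) + L) \<le> (real N + L) * (2 * (real N + L))"
      using assms pos by (intro mult_left_mono) auto
    also have "\<dots> \<le> 4 * ((real N)\<^sup>2 + L\<^sup>2)"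
      using sum_squares_bound[of "real N" L] by (simp add: power2_eq_square algebra_simps)
    finally have "4 / (4 * ((real N)\<^sup>2 + L\<^sup>2)) \<le> 4 / ((real N + L) * (real (Suc N) + L))"
    proof (intro divide_left_mono mult_pos_pos)
      have "L\<^sup>2 > 0" using assms by simp
      then show "(real N)\<^sup>2 + L\<^sup>2 > 0" by (simp add: add_nonneg_pos)
    qed (use pos in auto)
    also have "\<dots> = 4 / (real N + L) - 4 / (real (Suc N) + L)"
      using pos by (simp add: field_simps)
    finally have "4 / (4 * ((real N)\<^sup>2 + L\<^sup>2)) \<le> 4 / (real N + L) - 4 / (real (Suc N) + L)" .
    moreover have "4 / (4 * z) = 1 / z" for z :: real by simp
    ultimately have "1 / ((real N)\<^sup>2 + L\<^sup>2) \<le> 4 / (real N + L) - 4 / (real (Suc N) + L)" by metis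
    then show ?case using Suc.IH by simp
  qed simp
  moreover have "4 / (real N + L) \<ge> 0" using assms by simp
  ultimately show ?thesis by linarith
qed

lemma sum_cauchy_kernel_diff_le:
  fixes L :: real
  assumes "L \<ge> 1"
  shows "(\<Sum>k<M. 1 / ((real j - real k)\<^sup>2 + L\<^sup>2)) \<le> 8 / L"
proof -
  let ?f = "\<lambda>d::nat. 1 / ((real d)\<^sup>2 + L\<^sup>2)"
  have "(\<Sum>k<M. 1 / ((real j - real k)\<^sup>2 + L\<^sup>2)) \<le> (\<Sum>k\<in>{..j} \<union> {j..<j+M}. 1 / ((real j - real k)\<^sup>2 + L\<^sup>2))"
    by (intro sum_mono2) auto
  also have "\<dots> \<le> (\<Sum>k\<in>{..j}. 1 / ((real j - real k)\<^sup>2 + L\<^sup>2)) + (\<Sum>k\<in>{j..<j+M}. 1 / ((real j - real k)\<^sup>2 + L\<^sup>2))"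
    by (subst sum_Un) (auto intro!: sum_nonneg)
  also have "(\<Sum>k\<in>{..j}. 1 / ((real j - real k)\<^sup>2 + L\<^sup>2)) = (\<Sum>d<Suc j. ?f d)"
    by (rule sum.reindex_bij_witness[where i = "\<lambda>d. j - d" and j = "\<lambda>k. j - k"]) (auto simp: of_nat_diff)
  also have "(\<Sum>k\<in>{j..<j+M}. 1 / ((real j - real k)\<^sup>2 + L\<^sup>2)) = (\<Sum>d<M. ?f d)"
    by (rule sum.reindex_bij_witness[where i = "\<lambda>d. j + d" and j = "\<lambda>k. k - j"]) (auto simp: of_nat_diff power2_commute)
  finally show ?thesis using sum_cauchy_kernel_le[OF assms, of "Suc j"] sum_cauchy_kernel_le[OF assms, of M] by linarith
qed

context rect_torus begin

abbreviation count_upto :: "real set \<Rightarrow> real \<Rightarrow> real" where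
  "count_upto A X \<equiv> real (card {\<mu>\<in>A. \<mu> \<le> X})"

lemma card_eigs_upper: "\<exists>C>0. \<forall>X\<ge>1. count_upto (eigs y) X \<le> C * X"
proof -
  obtain C where C: "C > 0" "\<And>X. X \<ge> 1 \<Longrightarrow> real (card {p. q p \<le> X}) \<le> C * X" using card_q_le_upper by auto
  show ?thesis
  proof (intro exI[of _ "2 * C + 1"] conjI allI impI)
    show "2 * C + 1 > 0" using C by simp
    fix X :: real assume X: "X \<ge> 1"
    have "count_upto (eigs y) X \<le> real (card {p. q p \<le> X + 1}) + 1"
      using eigs_le_upper(2)[of y X] by linarith
    also have "\<dots> \<le> C * (X + 1) + 1" using C(2)[of "X + 1"] X by simp
    also have "\<dots> \<le> C * (2 * X) + X" using X C by (intro add_mono mult_left_mono) auto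
    finally show "count_upto (eigs y) X \<le> (2 * C + 1) * X" by (simp add: algebra_simps)
  qed
qed

lemma card_eigs_lower: "\<exists>c>0. \<forall>\<^sub>F X in at_top. c * X powr (199/200) \<le> count_upto (eigs y) X"
proof -
  obtain c where c: "c > 0" "\<And>X. X \<ge> 1 \<Longrightarrow> c * X powr (1 - 1/200) \<le> real (card (q ` {p. q p \<le> X}))"
    using card_norms_lower[of "1/200"] by auto
  have "\<forall>\<^sub>F X in at_top. 2 / c \<le> X powr (199/200)"
    using eventually_ge_at_top[of "(2 / c) powr (200/199)"]
  proof eventually_elim
    case (elim X)
    have "2 / c = ((2 / c) powr (200/199)) powr (199/200)" using c by (simp add: powr_powr)
    also have "\<dots> \<le> X powr (199/200)" using elim by (intro powr_mono2) auto
    finally show ?case .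
  qed
  then have "\<forall>\<^sub>F X in at_top. c / 2 * X powr (199/200) \<le> count_upto (eigs y) X"
    using eventually_ge_at_top[of 1]
  proof eventually_elim
    case (elim X)
    have "1 \<le> c / 2 * X powr (199/200)" using elim c by (simp add: field_simps)
    moreover have "c * X powr (199/200) \<le> count_upto (eigs y) X + 1"
      using c(2)[of X] elim eigs_le_lower[of X y] by simp
    ultimately show ?case by linarith
  qed
  then show ?thesis using c by (intro exI[of _ "c / 2"]) simp
qed

lemma sum_eig_bin_sq_le: "\<exists>C>0. \<forall>K\<ge>1. (\<Sum>k<K. (real (card (eig_bin y k)))\<^sup>2) \<le> C * real K powr (201/200)"
proof -
  obtain C where C: "C > 0" "\<And>K. K \<ge> 1 \<Longrightarrow> (\<Sum>k<K. (real (card (bin k)))\<^sup>2) \<le> C * real K powr (1 + 1/200)"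
    using sum_bin_sq_le[of "1/200"] by auto
  show ?thesis
  proof (intro exI[of _ "2 * C + 2"] conjI allI impI)
    show "2 * C + 2 > 0" using C by simp
    fix K :: nat assume K: "K \<ge> 1"
    have "(\<Sum>k<K. (real (card (eig_bin y k)))\<^sup>2) \<le> (\<Sum>k<K. 2 * (real (card (bin k)))\<^sup>2 + 2)"
    proof (intro sum_mono)
      fix k
      have "real (card (eig_bin y k)) \<le> real (card (bin k)) + 1" using eig_bin_le(2)[of y k] by linarith
      then have "(real (card (eig_bin y k)))\<^sup>2 \<le> (real (card (bin k)) + 1)\<^sup>2" by (intro power_mono) auto
      also have "\<dots> \<le> 2 * (real (card (bin k)))\<^sup>2 + 2"
        using sum_squares_bound[of "real (card (bin k))" 1] by (simp add: power2_eq_square algebra_simps)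
      finally show "(real (card (eig_bin y k)))\<^sup>2 \<le> 2 * (real (card (bin k)))\<^sup>2 + 2" .
    qed
    also have "\<dots> = 2 * (\<Sum>k<K. (real (card (bin k)))\<^sup>2) + 2 * real K" by (simp add: sum.distrib sum_distrib_left)
    also have "\<dots> \<le> 2 * (C * real K powr (201/200)) + 2 * real K powr (201/200)"
    proof (intro add_mono mult_left_mono)
      show "real K \<le> real K powr (201/200)" using powr_mono[of 1 "201/200" "real K"] K by simp
    qed (use C(2)[OF K] in auto)
    finally show "(\<Sum>k<K. (real (card (eig_bin y k)))\<^sup>2) \<le> (2 * C + 2) * real K powr (201/200)"
      by (simp add: algebra_simps)
  qed
qed

definition negligible_eigs :: "real \<Rightarrow> real set \<Rightarrow> bool" where
  "negligible_eigs y B \<longleftrightarrow> B \<subseteq> eigs y \<and>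
     ((\<lambda>X. count_upto B X / count_upto (eigs y) X) \<longlongrightarrow> 0) at_top"

text \<open>There are \<open>\<gg> X\<^bsup>199/200\<^esup>\<close> eigenvalues below \<open>X\<close>, and the \<open>O(sqrt X)\<close> eigenvalues below \<open>sqrt X\<close> may be ignored. The
  restriction to \<open>\<mu> > sqrt X\<close> allows thresholds in terms of \<open>\<mu>\<close> to be replaced by powers of \<open>X\<close>.\<close>

lemma negligible_eigsI:
  assumes B: "B \<subseteq> eigs y"
    and bound: "\<forall>\<^sub>F X in at_top. real (card {\<mu>\<in>B. sqrt X < \<mu> \<and> \<mu> \<le> X}) \<le> C * X powr (99/100)"
  shows "negligible_eigs y B"
  unfolding negligible_eigs_def
proof (intro conjI B)
  obtain C2 where C2: "C2 > 0" "\<And>X. X \<ge> 1 \<Longrightarrow> count_upto (eigs y) X \<le> C2 * X" using card_eigs_upper by blast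
  obtain c where c: "c > 0" "\<forall>\<^sub>F X in at_top. c * X powr (199/200) \<le> count_upto (eigs y) X"
    using card_eigs_lower by blast
  define A where "A = (C2 + \<bar>C\<bar>) / c"
  show "((\<lambda>X. count_upto B X / count_upto (eigs y) X) \<longlongrightarrow> 0) at_top"
  proof (rule tendsto_sandwich)
    show "\<forall>\<^sub>F X in at_top. 0 \<le> count_upto B X / count_upto (eigs y) X"
      by (intro always_eventually allI) simp
    show "\<forall>\<^sub>F X in at_top. count_upto B X / count_upto (eigs y) X \<le> A * X powr (-1/200)"
      using bound c(2) eventually_ge_at_top[of 1]
    proof eventually_elim
      case (elim X)
      have fin: "finite {\<mu>\<in>eigs y. \<mu> \<le> sqrt X}" "finite {\<mu>\<in>eigs y. \<mu> \<le> X}" by (rule eigs_le_upper)+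
      have "card {\<mu>\<in>B. \<mu> \<le> X} \<le> card ({\<mu>\<in>eigs y. \<mu> \<le> sqrt X} \<union> {\<mu>\<in>B. sqrt X < \<mu> \<and> \<mu> \<le> X})"
        using B fin finite_subset[OF _ fin(2), of "{\<mu>\<in>B. sqrt X < \<mu> \<and> \<mu> \<le> X}"] by (intro card_mono) auto
      also have "\<dots> \<le> card {\<mu>\<in>eigs y. \<mu> \<le> sqrt X} + card {\<mu>\<in>B. sqrt X < \<mu> \<and> \<mu> \<le> X}" by (rule card_Un_le)
      finally have "count_upto B X \<le> C2 * sqrt X + C * X powr (99/100)"
        using C2(2)[of "sqrt X"] elim by simp
      also have "\<dots> \<le> C2 * X powr (99/100) + \<bar>C\<bar> * X powr (99/100)"
      proof (intro add_mono mult_left_mono mult_right_mono)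
        show "sqrt X \<le> X powr (99/100)" using elim powr_mono[of "1/2" "99/100" X] by (simp add: powr_half_sqrt)
      qed (use C2 in auto)
      finally have num: "count_upto B X \<le> (C2 + \<bar>C\<bar>) * X powr (99/100)" by (simp add: algebra_simps)
      have "count_upto B X / count_upto (eigs y) X \<le> ((C2 + \<bar>C\<bar>) * X powr (99/100)) / (c * X powr (199/200))"
        using num elim c C2 by (intro frac_le) auto
      also have "\<dots> = A * (X powr (99/100) / X powr (199/200))" by (simp add: A_def)
      also have "X powr (99/100) / X powr (199/200) = X powr (-1/200)" by (simp add: powr_diff[symmetric])
      finally show ?case .
    qed
    have "((\<lambda>X::real. X powr (-1/200)) \<longlongrightarrow> 0) at_top" by (rule tendsto_neg_powr) (auto simp: filterlim_ident)
    then show "((\<lambda>X. A * X powr (-1/200)) \<longlongrightarrow> 0) at_top" by (intro tendsto_mult_right_zero)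
  qed simp
qed

lemma negligible_eigs_Un:
  assumes "negligible_eigs y A" "negligible_eigs y B"
  shows "negligible_eigs y (A \<union> B)"
  unfolding negligible_eigs_def
proof (intro conjI)
  show "A \<union> B \<subseteq> eigs y" using assms by (auto simp: negligible_eigs_def)
  show "((\<lambda>X. count_upto (A \<union> B) X / count_upto (eigs y) X) \<longlongrightarrow> 0) at_top"
  proof (rule tendsto_sandwich[of "\<lambda>_. 0"])
    show "((\<lambda>X. count_upto A X / count_upto (eigs y) X + count_upto B X / count_upto (eigs y) X) \<longlongrightarrow> 0) at_top"
      using assms unfolding negligible_eigs_def by (intro tendsto_add_zero) auto
    show "\<forall>\<^sub>F X in at_top. count_upto (A \<union> B) X / count_upto (eigs y) X
       \<le> count_upto A X / count_upto (eigs y) X + count_upto B X / count_upto (eigs y) X"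
    proof (intro always_eventually allI)
      fix X
      have "{\<mu>\<in>A \<union> B. \<mu> \<le> X} = {\<mu>\<in>A. \<mu> \<le> X} \<union> {\<mu>\<in>B. \<mu> \<le> X}" by auto
      then have "count_upto (A \<union> B) X \<le> count_upto A X + count_upto B X"
        using card_Un_le[of "{\<mu>\<in>A. \<mu> \<le> X}" "{\<mu>\<in>B. \<mu> \<le> X}"] by simp
      then show "count_upto (A \<union> B) X / count_upto (eigs y) X
       \<le> count_upto A X / count_upto (eigs y) X + count_upto B X / count_upto (eigs y) X"
        by (simp add: add_divide_distrib[symmetric] divide_right_mono)
    qed
  qed (auto intro!: always_eventually)
qed

lemma negligible_eigs_UN:
  assumes "\<And>i::nat. negligible_eigs y (B i)"
  shows "negligible_eigs y (\<Union>j\<le>i. B j)"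
proof (induction i)
  case (Suc i)
  have "(\<Union>j\<le>Suc i. B j) = (\<Union>j\<le>i. B j) \<union> B (Suc i)" by (auto simp: le_Suc_eq)
  then show ?case using Suc.IH assms by (simp add: negligible_eigs_Un)
qed (simp add: assms)

text \<open>Let \<open>B i\<close> act only beyond a point \<open>Z i\<close> after which the union of the sets up to \<open>B i\<close> has relative density at most
  \<open>1 / (i + 1)\<close>. Below \<open>X\<close> only the sets with \<open>Z i \<le> X\<close> matter.\<close>

lemma negligible_eigs_diagonal:
  assumes negl: "\<And>i::nat. negligible_eigs y (B i)"
  shows "\<exists>B'. negligible_eigs y B' \<and> (\<forall>i. \<exists>X. \<forall>\<mu>\<in>B i. X < \<mu> \<longrightarrow> \<mu> \<in> B')"
proof -
  define ratio where "ratio = (\<lambda>A X. count_upto A X / count_upto (eigs y) X)"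
  define U where "U = (\<lambda>i. \<Union>j\<le>i. B j)"
  have "\<exists>Y. \<forall>X\<ge>Y. ratio (U i) X \<le> 1 / real (Suc i)" for i
  proof -
    have "(ratio (U i) \<longlongrightarrow> 0) at_top"
      using negligible_eigs_UN[of y B i, OF negl] by (simp add: negligible_eigs_def U_def ratio_def)
    then have "\<forall>\<^sub>F X in at_top. ratio (U i) X < 1 / real (Suc i)" by (rule order_tendstoD) simp
    then show ?thesis unfolding eventually_at_top_linorder by (meson less_imp_le)
  qed
  then obtain Y where Y: "\<And>i X. X \<ge> Y i \<Longrightarrow> ratio (U i) X \<le> 1 / real (Suc i)" by metis
  \<comment> \<open>adding \<open>i\<close> makes the thresholds tend to infinity, so that only finitely many sets act below a given \<open>X\<close>\<close>
  define Z where "Z = (\<lambda>i::nat. Max ((\<lambda>j. \<bar>Y j\<bar>) ` {..i}) + real i)"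
  have Z_ge: "Y i \<le> Z i" "real i \<le> Z i" for i
  proof -
    have "\<bar>Y i\<bar> \<le> Max ((\<lambda>j. \<bar>Y j\<bar>) ` {..i})" by (intro Max_ge) auto
    then show "Y i \<le> Z i" "real i \<le> Z i" unfolding Z_def by linarith+
  qed
  define B' where "B' = (\<Union>i. {\<mu>\<in>B i. Z i < \<mu>})"
  have "B' \<subseteq> eigs y" using negl by (auto simp: B'_def negligible_eigs_def)
  moreover have "(ratio B' \<longlongrightarrow> 0) at_top"
  proof (rule tendstoI)
    fix e :: real assume e: "e > 0"
    obtain n where n: "1 / real (Suc n) < e" using e nat_approx_posE by (metis inverse_eq_divide of_nat_Suc)
    have "\<forall>X\<ge>Z n. dist (ratio B' X) 0 < e"
    proof (intro allI impI)
      fix X assume X: "X \<ge> Z n"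
      define I where "I = {i. Z i \<le> X}"
      have "I \<subseteq> {i. real i \<le> X}" using Z_ge(2) order_trans by (fastforce simp: I_def)
      moreover have "finite {i::nat. real i \<le> X}"
        by (rule finite_subset[of _ "{..nat \<lfloor>X\<rfloor>}"]) (auto simp: le_nat_floor)
      ultimately have finI: "finite I" by (rule finite_subset)
      define m where "m = Max I"
      have nI: "n \<in> I" using X by (simp add: I_def)
      have m: "m \<in> I" "n \<le> m" using finI nI by (auto simp: m_def intro: Max_in)
      have "{\<mu>\<in>B'. \<mu> \<le> X} \<subseteq> {\<mu>\<in>U m. \<mu> \<le> X}"
      proof
        fix \<mu> assume "\<mu> \<in> {\<mu>\<in>B'. \<mu> \<le> X}"
        then obtain i where i: "\<mu> \<in> B i" "Z i < \<mu>" "\<mu> \<le> X" by (auto simp: B'_def)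
        then have "i \<in> I" by (simp add: I_def)
        then have "i \<le> m" using finI by (simp add: m_def)
        then show "\<mu> \<in> {\<mu>\<in>U m. \<mu> \<le> X}" using i by (auto simp: U_def)
      qed
      moreover have "finite {\<mu>\<in>U m. \<mu> \<le> X}"
        using negl by (intro finite_subset[OF _ eigs_le_upper(1)[of y X]]) (auto simp: U_def negligible_eigs_def)
      ultimately have "ratio B' X \<le> ratio (U m) X"
        unfolding ratio_def by (intro divide_right_mono of_nat_mono card_mono) auto
      also have "\<dots> \<le> 1 / real (Suc m)"
        using m Z_ge(1)[of m] by (intro Y) (auto simp: I_def)
      also have "\<dots> \<le> 1 / real (Suc n)" using m by (intro divide_left_mono) auto
      finally have "ratio B' X < e" using n by linarith
      moreover have "ratio B' X \<ge> 0" by (simp add: ratio_def)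
      ultimately show "dist (ratio B' X) 0 < e" by simp
    qed
    then show "\<forall>\<^sub>F X in at_top. dist (ratio B' X) 0 < e" unfolding eventually_at_top_linorder by blast
  qed
  ultimately have "negligible_eigs y B'" by (simp add: negligible_eigs_def ratio_def[abs_def])
  moreover have "\<forall>i. \<exists>X. \<forall>\<mu>\<in>B i. X < \<mu> \<longrightarrow> \<mu> \<in> B'" by (auto simp: B'_def)
  ultimately show ?thesis by blast
qed

text \<open>By Parseval, \<open>green_energy\<close> is \<open>4 \<pi>\<^sup>2\<close> times the squared norm of the Green's function, and \<open>green_tail\<close> is the part
  of it that comes from frequencies whose eigenvalue is at distance at least \<open>L\<close> from \<open>\<mu>\<close>.\<close>

definition green_energy :: "real \<Rightarrow> real" where
  "green_energy \<mu> = (\<Sum>\<^sub>\<infinity>p. 1 / (q p - \<mu>)\<^sup>2)"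

definition green_tail :: "real \<Rightarrow> real \<Rightarrow> real" where
  "green_tail \<mu> L = (\<Sum>\<^sub>\<infinity>p\<in>{p. L \<le> \<bar>q p - \<mu>\<bar>}. 1 / (q p - \<mu>)\<^sup>2)"

lemma green_energy_ge:
  assumes "\<mu> \<notin> range q"
  shows "1 / (next_norm \<mu> - \<mu>)\<^sup>2 \<le> green_energy \<mu>"
proof -
  obtain p where p: "next_norm \<mu> = q p" using next_norm(1)[of \<mu>] by auto
  have "1 / (q p - \<mu>)\<^sup>2 = (\<Sum>\<^sub>\<infinity>r\<in>{p}. 1 / (q r - \<mu>)\<^sup>2)" by simp
  also have "\<dots> \<le> green_energy \<mu>"
    unfolding green_energy_def by (intro infsum_mono_neutral summable_on_inverse_shift_sq assms) auto
  finally show ?thesis by (simp add: p)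
qed

text \<open>The exponents \<open>1/50\<close>, \<open>1/20\<close> and \<open>1/5\<close> in the three families of exceptions are related as follows: outside the
  first family the energy is at least \<open>\<mu>\<^bsup>-1/25\<^esup>\<close>, which must dominate the tail bound \<open>\<mu>\<^bsup>-1/20\<^esup>\<close>; the tail beyond
  \<open>L = \<mu>\<^bsup>1/5\<^esup>\<close> must be smaller than \<open>\<mu>\<^bsup>-1/20\<^esup>\<close> on average; and \<open>L\<close> must be small enough for the strips of the
  third family to be sparse.\<close>

definition gap_exceptions :: "real \<Rightarrow> real set" where
  "gap_exceptions y = {\<mu>\<in>eigs y. \<mu> \<ge> 1 \<and> \<mu> powr (1/50) < next_norm \<mu> - \<mu>}"

text \<open>An eigenvalue whose next norm is farther away than \<open>K = X\<^bsup>1/100\<^esup>\<close> is farther than \<open>K\<close> from the next eigenvalue,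
  so at most about \<open>X / K\<close> such eigenvalues lie below \<open>X\<close>.\<close>

lemma negligible_gap_exceptions: "negligible_eigs y (gap_exceptions y)"
proof (rule negligible_eigsI)
  show "gap_exceptions y \<subseteq> eigs y" by (auto simp: gap_exceptions_def)
  show "\<forall>\<^sub>F X in at_top. real (card {\<mu>\<in>gap_exceptions y. sqrt X < \<mu> \<and> \<mu> \<le> X}) \<le> 3 * X powr (99/100)"
    using eventually_ge_at_top[of 1]
  proof eventually_elim
    case (elim X)
    let ?M = "{\<mu>\<in>gap_exceptions y. sqrt X < \<mu> \<and> \<mu> \<le> X}"
    define K where "K = X powr (1/100)"
    have K: "K > 0" using elim by (simp add: K_def)
    have gap: "K < next_norm \<mu> - \<mu>" if "\<mu> \<in> ?M" for \<mu>
    proof -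
      have "K = sqrt X powr (1/50)" using elim by (simp add: K_def powr_half_sqrt[symmetric] powr_powr)
      also have "\<dots> \<le> \<mu> powr (1/50)" using that elim by (intro powr_mono2) auto
      finally show ?thesis using that by (auto simp: gap_exceptions_def)
    qed
    have less: "\<lfloor>\<mu> / K\<rfloor> < \<lfloor>\<mu>' / K\<rfloor>" if "\<mu> \<in> ?M" "\<mu>' \<in> ?M" "\<mu> < \<mu>'" for \<mu> \<mu>'
    proof -
      have "next_norm \<mu> < \<mu>'" using that by (intro next_norm_less_eig[of \<mu> y]) (auto simp: gap_exceptions_def)
      then have "\<mu> + K < \<mu>'" using gap[OF that(1)] by linarith
      then have "(\<mu> + K) / K < \<mu>' / K" using K by (rule divide_strict_right_mono)
      then have "\<mu> / K + 1 < \<mu>' / K" using K by (simp add: add_divide_distrib)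
      then show ?thesis by linarith
    qed
    have "card ?M \<le> card {0..\<lfloor>X / K\<rfloor>}"
    proof (rule card_inj_on_le[where f = "\<lambda>\<mu>. \<lfloor>\<mu> / K\<rfloor>"])
      show "inj_on (\<lambda>\<mu>. \<lfloor>\<mu> / K\<rfloor>) ?M"
        by (rule linorder_inj_onI') (use less in \<open>blast dest: less_imp_neq\<close>)
      show "(\<lambda>\<mu>. \<lfloor>\<mu> / K\<rfloor>) ` ?M \<subseteq> {0..\<lfloor>X / K\<rfloor>}"
        using K by (auto simp: gap_exceptions_def intro!: floor_mono divide_right_mono)
    qed simp
    then have "real (card ?M) \<le> real_of_int (\<lfloor>X / K\<rfloor> + 1)"
    proof -
      assume "card ?M \<le> card {0..\<lfloor>X / K\<rfloor>}"
      moreover have "\<lfloor>X / K\<rfloor> \<ge> 0" using elim K by simp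
      ultimately have "int (card ?M) \<le> \<lfloor>X / K\<rfloor> + 1" unfolding card_atLeastAtMost_int by linarith
      then show ?thesis by (metis of_int_le_iff of_int_of_nat_eq)
    qed
    then have "real (card ?M) \<le> X / K + 1" by linarith
    also have "X / K = X powr (99/100)"
      using elim powr_diff[of X 1 "1/100"] by (simp add: K_def)
    also have "X powr (99/100) + 1 \<le> 3 * X powr (99/100)"
      using elim ge_one_powr_ge_zero[of X "99/100"] by simp
    finally show ?case .
  qed
qed

lemma green_energy_ge_powr:
  assumes "\<mu> \<in> eigs y" "\<mu> \<ge> 1" "\<mu> \<notin> gap_exceptions y"
  shows "\<mu> powr (-1/25) \<le> green_energy \<mu>"
proof -
  have g: "0 < next_norm \<mu> - \<mu>" "next_norm \<mu> - \<mu> \<le> \<mu> powr (1/50)"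
    using assms next_norm(2)[of \<mu>] by (auto simp: gap_exceptions_def)
  have "\<mu> powr (-1/25) = 1 / (\<mu> powr (1/50))\<^sup>2"
    using assms by (simp add: power2_eq_square powr_add[symmetric] powr_minus_divide)
  also have "\<dots> \<le> 1 / (next_norm \<mu> - \<mu>)\<^sup>2"
    using g assms by (intro divide_left_mono power_mono mult_pos_pos) auto
  also have "\<dots> \<le> green_energy \<mu>" using assms by (intro green_energy_ge) (auto simp: eigs_def)
  finally show ?thesis .
qed

abbreviation near_tail :: "real \<Rightarrow> real \<Rightarrow> real \<Rightarrow> real" where
  "near_tail K L \<mu> \<equiv> \<Sum>p\<in>{p. q p < 2 * K \<and> L \<le> \<bar>q p - \<mu>\<bar>}. 1 / (q p - \<mu>)\<^sup>2"

text \<open>Sort eigenvalues and frequencies into unit bins. The summand for bins \<open>j\<close> and \<open>k\<close> is at most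
  \<open>5 / ((j - k)\<^sup>2 + L\<^sup>2)\<close>, a kernel with row sums \<open>O(1 / L)\<close>, so the Schur test and the energy estimates for both kinds
  of bins apply.\<close>

lemma sum_eigs_sum_lattice_le:
  "\<exists>C>0. \<forall>K\<ge>1. \<forall>L\<ge>1. (\<Sum>\<mu>\<in>{\<mu>\<in>eigs y. 0 \<le> \<mu> \<and> \<mu> < real K}. near_tail (real K) L \<mu>)
      \<le> C * real K powr (201/200) / L"
proof -
  obtain C1 where C1: "C1 > 0" "\<And>K. K \<ge> 1 \<Longrightarrow> (\<Sum>k<K. (real (card (bin k)))\<^sup>2) \<le> C1 * real K powr (1 + 1/200)"
    using sum_bin_sq_le[of "1/200"] by auto
  obtain C2 where C2: "C2 > 0" "\<And>K. K \<ge> 1 \<Longrightarrow> (\<Sum>k<K. (real (card (eig_bin y k)))\<^sup>2) \<le> C2 * real K powr (201/200)"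
    using sum_eig_bin_sq_le by blast
  let ?D = "C1 * 2 powr (201/200) + C2"
  show ?thesis
  proof (intro exI[of _ "20 * ?D"] conjI allI impI)
    show "20 * ?D > 0" using C1 C2 by (simp add: add_pos_pos)
    fix K :: nat and L :: real assume K: "K \<ge> 1" and L: "L \<ge> 1"
    let ?w = "\<lambda>j k :: nat. 1 / ((real j - real k)\<^sup>2 + L\<^sup>2)"
    let ?n = "\<lambda>k. real (card (bin k))" and ?l = "\<lambda>j. real (card (eig_bin y j))"
    have L2: "L\<^sup>2 > 0" using L by simp
    have pointwise: "1 / (q p - \<mu>)\<^sup>2 \<le> 5 * ?w j k"
      if "\<mu> \<in> eig_bin y j" "p \<in> bin k" "L \<le> \<bar>q p - \<mu>\<bar>" for \<mu> p j k
    proof -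
      have *: "x \<le> d + 1 \<Longrightarrow> 1 \<le> d \<Longrightarrow> x \<le> 2 * d" for x d :: real by linarith
      have "\<bar>real j - real k\<bar> \<le> \<bar>q p - \<mu>\<bar> + 1" using that by (auto simp: eig_bin_def bin_def)
      moreover have "1 \<le> \<bar>q p - \<mu>\<bar>" using L that(3) by (rule order_trans)
      ultimately have "\<bar>real j - real k\<bar> \<le> 2 * \<bar>q p - \<mu>\<bar>" by (rule *)
      then have "\<bar>real j - real k\<bar>\<^sup>2 \<le> (2 * \<bar>q p - \<mu>\<bar>)\<^sup>2" by (intro power_mono) auto
      then have "(real j - real k)\<^sup>2 \<le> (2 * \<bar>q p - \<mu>\<bar>)\<^sup>2" by simp
      moreover have "L\<^sup>2 \<le> \<bar>q p - \<mu>\<bar>\<^sup>2" using that L by (intro power_mono) auto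
      ultimately have le: "(real j - real k)\<^sup>2 + L\<^sup>2 \<le> 5 * (q p - \<mu>)\<^sup>2" by (simp add: power_mult_distrib)
      have pos: "(real j - real k)\<^sup>2 + L\<^sup>2 > 0" using L2 by (simp add: add_nonneg_pos)
      then have "(q p - \<mu>)\<^sup>2 > 0" using le by linarith
      then show ?thesis using le pos by (simp add: divide_le_eq le_divide_eq)
    qed
    have inner: "near_tail (real K) L \<mu> \<le> (\<Sum>k<2*K. 5 * (?w j k * ?n k))"
      if \<mu>: "\<mu> \<in> eig_bin y j" for \<mu> j
    proof -
      have "near_tail (real K) L \<mu>
          \<le> (\<Sum>p\<in>(\<Union>k<2*K. {p\<in>bin k. L \<le> \<bar>q p - \<mu>\<bar>}). 1 / (q p - \<mu>)\<^sup>2)"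
      proof (rule sum_mono2)
        show "{p. q p < 2 * real K \<and> L \<le> \<bar>q p - \<mu>\<bar>} \<subseteq> (\<Union>k<2*K. {p\<in>bin k. L \<le> \<bar>q p - \<mu>\<bar>})"
        proof
          fix p assume p: "p \<in> {p. q p < 2 * real K \<and> L \<le> \<bar>q p - \<mu>\<bar>}"
          define k where "k = nat \<lfloor>q p\<rfloor>"
          have k: "real k \<le> q p" "q p < real k + 1"
            using q_nonneg[of p] by (simp_all add: k_def)
          have "real k < real (2 * K)" using k p by simp
          then have "k < 2 * K" by (simp only: of_nat_less_iff)
          then show "p \<in> (\<Union>k<2*K. {p\<in>bin k. L \<le> \<bar>q p - \<mu>\<bar>})" using k p by (auto simp: bin_def)
        qed
      qed auto
      also have "\<dots> = (\<Sum>k<2*K. \<Sum>p\<in>{p\<in>bin k. L \<le> \<bar>q p - \<mu>\<bar>}. 1 / (q p - \<mu>)\<^sup>2)"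
        by (rule sum.UNION_disjoint) (auto simp: bin_def)
      also have "\<dots> \<le> (\<Sum>k<2*K. 5 * (?w j k * ?n k))"
      proof (intro sum_mono)
        fix k
        have "(\<Sum>p\<in>{p\<in>bin k. L \<le> \<bar>q p - \<mu>\<bar>}. 1 / (q p - \<mu>)\<^sup>2) \<le> (\<Sum>p\<in>{p\<in>bin k. L \<le> \<bar>q p - \<mu>\<bar>}. 5 * ?w j k)"
          using pointwise[OF \<mu>] by (intro sum_mono) auto
        also have "\<dots> \<le> (\<Sum>p\<in>bin k. 5 * ?w j k)"
          by (intro sum_mono2) auto
        finally show "(\<Sum>p\<in>{p\<in>bin k. L \<le> \<bar>q p - \<mu>\<bar>}. 1 / (q p - \<mu>)\<^sup>2) \<le> 5 * (?w j k * ?n k)"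
          by (simp add: mult_ac)
      qed
      finally show ?thesis .
    qed
    have "{\<mu>\<in>eigs y. 0 \<le> \<mu> \<and> \<mu> < real K} = (\<Union>j<K. eig_bin y j)"
    proof (intro set_eqI iffI)
      fix \<mu> assume \<mu>: "\<mu> \<in> {\<mu>\<in>eigs y. 0 \<le> \<mu> \<and> \<mu> < real K}"
      define j where "j = nat \<lfloor>\<mu>\<rfloor>"
      have j: "real j \<le> \<mu>" "\<mu> < real j + 1" using \<mu> by (simp_all add: j_def)
      then have "real j < real K" using \<mu> by simp
      then show "\<mu> \<in> (\<Union>j<K. eig_bin y j)" using \<mu> j by (auto simp: eig_bin_def)
    next
      fix \<mu> assume "\<mu> \<in> (\<Union>j<K. eig_bin y j)"
      then obtain j where j: "j < K" "\<mu> \<in> eigs y" "real j \<le> \<mu>" "\<mu> < real j + 1" by (auto simp: eig_bin_def)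
      have "real j + 1 \<le> real K" using j(1) by linarith
      then show "\<mu> \<in> {\<mu>\<in>eigs y. 0 \<le> \<mu> \<and> \<mu> < real K}" using j by auto
    qed
    then have "(\<Sum>\<mu>\<in>{\<mu>\<in>eigs y. 0 \<le> \<mu> \<and> \<mu> < real K}. near_tail (real K) L \<mu>)
       = (\<Sum>j<K. \<Sum>\<mu>\<in>eig_bin y j. near_tail (real K) L \<mu>)"
      by (simp only:) (rule sum.UNION_disjoint; auto simp: eig_bin_le(1); auto simp: eig_bin_def)
    also have "\<dots> \<le> (\<Sum>j<K. \<Sum>\<mu>\<in>eig_bin y j. \<Sum>k<2*K. 5 * (?w j k * ?n k))"
      using inner by (intro sum_mono) auto
    also have "\<dots> = 5 * (\<Sum>j<K. \<Sum>k<2*K. ?w j k * (?l j * ?n k))"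
      by (simp add: sum_distrib_left mult_ac)
    also have "\<dots> \<le> 5 * ((8 / L) / 2 * ((\<Sum>j<K. (?l j)\<^sup>2) + (\<Sum>k<2*K. (?n k)\<^sup>2)))"
    proof (intro mult_left_mono schur_test)
      show "(\<Sum>k<2*K. ?w j k) \<le> 8 / L" for j by (rule sum_cauchy_kernel_diff_le[OF L])
      show "(\<Sum>j<K. ?w j k) \<le> 8 / L" for k
        using sum_cauchy_kernel_diff_le[OF L, of k K] by (simp add: power2_commute)
    qed auto
    also have "\<dots> \<le> 5 * ((8 / L) / 2 * (C2 * real K powr (201/200) + C1 * real (2 * K) powr (1 + 1/200)))"
      using C1(2)[of "2 * K"] C2(2)[OF K] K L by (intro mult_left_mono add_mono) auto
    also have "real (2 * K) powr (1 + 1/200) = 2 powr (201/200) * real K powr (201/200)"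
      by (simp add: powr_mult)
    also have "5 * ((8 / L) / 2 * (C2 * real K powr (201/200) + C1 * (2 powr (201/200) * real K powr (201/200))))
        = 20 * ?D * real K powr (201/200) / L" by (simp add: algebra_simps add_divide_distrib)
    finally show "(\<Sum>\<mu>\<in>{\<mu>\<in>eigs y. 0 \<le> \<mu> \<and> \<mu> < real K}. near_tail (real K) L \<mu>)
      \<le> 20 * ?D * real K powr (201/200) / L" .
  qed
qed

lemma green_tail_le_near_far:
  assumes "\<mu> \<notin> range q" "0 \<le> \<mu>" "\<mu> \<le> K" "K \<ge> 1"
  shows "green_tail \<mu> L \<le> near_tail K L \<mu>
           + 4 * (\<Sum>\<^sub>\<infinity>p\<in>{p. 2 * K \<le> q p}. 1 / (q p)\<^sup>2)"
proof -
  let ?f = "\<lambda>p. 1 / (q p - \<mu>)\<^sup>2"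
  let ?N = "{p. q p < 2 * K \<and> L \<le> \<bar>q p - \<mu>\<bar>}" and ?F = "{p. 2 * K \<le> q p \<and> L \<le> \<bar>q p - \<mu>\<bar>}"
  have sm: "?f summable_on A" for A by (rule summable_on_inverse_shift_sq[OF assms(1)])
  \<comment> \<open>beyond \<open>2 K\<close> the distance to \<open>\<mu> \<le> K\<close> is at least half of \<open>q p\<close>\<close>
  have le: "?f p \<le> 4 * (1 / (q p)\<^sup>2)" if "2 * K \<le> q p" for p
  proof -
    have "q p / 2 \<le> q p - \<mu>" "q p > 0" using that assms by linarith+
    then have "(q p / 2)\<^sup>2 \<le> (q p - \<mu>)\<^sup>2" "(q p / 2)\<^sup>2 > 0" by (auto intro: power_mono)
    then have "1 / (q p - \<mu>)\<^sup>2 \<le> 1 / (q p / 2)\<^sup>2" by (intro divide_left_mono mult_pos_pos) auto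
    then show ?thesis by (simp add: power_divide)
  qed
  have far: "(\<lambda>p. 4 * (1 / (q p)\<^sup>2)) summable_on {p. 2 * K \<le> q p}"
  proof (rule summable_on_cmult_right)
    show "(\<lambda>p. 1 / (q p)\<^sup>2) summable_on {p. 2 * K \<le> q p}"
      using infsum_far_tail assms(4) by (elim exE conjE allE[of _ "2 * K"]) simp
  qed
  have finN: "finite ?N" by (rule finite_subset[OF _ finite_q_less[of "2 * K"]]) auto
  have "{p. L \<le> \<bar>q p - \<mu>\<bar>} = ?N \<union> ?F" by auto
  then have "green_tail \<mu> L = infsum ?f (?N \<union> ?F)" unfolding green_tail_def by (rule arg_cong)
  also have "\<dots> = infsum ?f ?N + infsum ?f ?F"
  proof (rule infsum_Un_disjoint[OF sm sm])
    show "?N \<inter> ?F = {}" by fastforce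
  qed
  also have "infsum ?f ?N = sum ?f ?N" using finN by (rule infsum_finite)
  also have "infsum ?f ?F \<le> (\<Sum>\<^sub>\<infinity>p\<in>{p. 2 * K \<le> q p}. 4 * (1 / (q p)\<^sup>2))"
    using le by (intro infsum_mono_neutral sm far) auto
  also have "\<dots> = 4 * (\<Sum>\<^sub>\<infinity>p\<in>{p. 2 * K \<le> q p}. 1 / (q p)\<^sup>2)" by (rule infsum_cmult_right')
  finally show ?thesis by simp
qed

definition tail_exceptions :: "real \<Rightarrow> real set" where
  "tail_exceptions y = {\<mu>\<in>eigs y. \<mu> \<ge> 1 \<and> \<mu> powr (-1/20) < green_tail \<mu> (\<mu> powr (1/5))}"

text \<open>Markov's inequality. With \<open>L = X\<^bsup>1/10\<^esup>\<close>, the value of \<open>\<mu>\<^bsup>1/5\<^esup>\<close> at \<open>\<mu> = sqrt X\<close>, the near parts of the tails sum to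
  \<open>O(X\<^bsup>201/200 - 1/10\<^esup>) = O(X\<^bsup>181/200\<^esup>)\<close>, while each exception has a tail of at least \<open>X\<^bsup>-1/20\<^esup>\<close>, of which the far part is only \<open>O(X\<^bsup>-1/2\<^esup>)\<close>.\<close>

lemma negligible_tail_exceptions: "negligible_eigs y (tail_exceptions y)"
proof -
  obtain C1 where C1: "C1 > 0" "\<And>K L. K \<ge> 1 \<Longrightarrow> L \<ge> 1 \<Longrightarrow>
      (\<Sum>\<mu>\<in>{\<mu>\<in>eigs y. 0 \<le> \<mu> \<and> \<mu> < real K}. near_tail (real K) L \<mu>) \<le> C1 * real K powr (201/200) / L"
    using sum_eigs_sum_lattice_le by blast
  obtain C2 where C2: "C2 > 0" "\<And>X. X \<ge> 1 \<Longrightarrow> (\<Sum>\<^sub>\<infinity>p\<in>{p. X \<le> q p}. 1 / (q p)\<^sup>2) \<le> C2 * X powr (-1/2)"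
    using infsum_far_tail by blast
  obtain C3 where C3: "C3 > 0" "\<And>X. X \<ge> 1 \<Longrightarrow> count_upto (eigs y) X \<le> C3 * X" using card_eigs_upper by blast
  show ?thesis
  proof (rule negligible_eigsI)
    show "tail_exceptions y \<subseteq> eigs y" by (auto simp: tail_exceptions_def)
    show "\<forall>\<^sub>F X in at_top. real (card {\<mu>\<in>tail_exceptions y. sqrt X < \<mu> \<and> \<mu> \<le> X}) \<le> (C1 * 2 powr (201/200) + 4 * C2 * C3) * X powr (99/100)"
      using eventually_ge_at_top[of 1]
    proof eventually_elim
      case (elim X)
      let ?M = "{\<mu>\<in>tail_exceptions y. sqrt X < \<mu> \<and> \<mu> \<le> X}"
      define L where "L = X powr (1/10)"
      define K where "K = nat \<lfloor>X\<rfloor> + 1"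
      have L: "L \<ge> 1" using elim by (simp add: L_def ge_one_powr_ge_zero)
      have K: "X < real K" "real K \<le> 2 * X" "K \<ge> 1"
        using elim unfolding K_def by (rule nat_floor_succ)+
      have finE: "finite {\<mu>\<in>eigs y. \<mu> \<le> X}" by (rule eigs_le_upper)
      have finM: "finite ?M" by (rule finite_subset[OF _ finE]) (auto simp: tail_exceptions_def)
      have lower: "X powr (-1/20) \<le> near_tail (real K) L \<mu> + 4 * C2 * X powr (-1/2)" if "\<mu> \<in> ?M" for \<mu>
      proof -
        have \<mu>: "\<mu> \<in> eigs y" "\<mu> \<ge> 1" "sqrt X < \<mu>" "\<mu> \<le> X" "\<mu> powr (-1/20) < green_tail \<mu> (\<mu> powr (1/5))"
          using that by (auto simp: tail_exceptions_def)
        have \<mu>q: "\<mu> \<notin> range q" using \<mu> by (simp add: eigs_def)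
        have "X powr (-1/20) \<le> \<mu> powr (-1/20)" using \<mu> by (intro powr_mono2') auto
        also have "\<dots> \<le> green_tail \<mu> (\<mu> powr (1/5))" using \<mu> by simp
        also have "\<dots> \<le> green_tail \<mu> L"
        proof -
          have "L = sqrt X powr (1/5)" using elim by (simp add: L_def powr_half_sqrt[symmetric] powr_powr)
          also have "\<dots> \<le> \<mu> powr (1/5)" using \<mu> elim by (intro powr_mono2) auto
          finally show ?thesis unfolding green_tail_def
            by (intro infsum_mono_neutral summable_on_inverse_shift_sq[OF \<mu>q]) auto
        qed
        also have "\<dots> \<le> near_tail (real K) L \<mu> + 4 * (\<Sum>\<^sub>\<infinity>p\<in>{p. 2 * real K \<le> q p}. 1 / (q p)\<^sup>2)"
          using \<mu> K elim by (intro green_tail_le_near_far \<mu>q) auto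
        also have "\<dots> \<le> near_tail (real K) L \<mu> + 4 * (C2 * (2 * real K) powr (-1/2))"
          using C2(2)[of "2 * real K"] K by simp
        also have "(2 * real K) powr (-1/2) \<le> X powr (-1/2)" using K elim by (intro powr_mono2') auto
        finally show ?thesis using C2(1) by (simp add: mult_left_mono)
      qed
      have "X powr (-1/20) * real (card ?M) = (\<Sum>\<mu>\<in>?M. X powr (-1/20))" by simp
      also have "\<dots> \<le> (\<Sum>\<mu>\<in>?M. near_tail (real K) L \<mu> + 4 * C2 * X powr (-1/2))" by (intro sum_mono lower)
      also have "\<dots> = (\<Sum>\<mu>\<in>?M. near_tail (real K) L \<mu>) + real (card ?M) * (4 * C2 * X powr (-1/2))" by (simp add: sum.distrib)
      also have "(\<Sum>\<mu>\<in>?M. near_tail (real K) L \<mu>) \<le> (\<Sum>\<mu>\<in>{\<mu>\<in>eigs y. 0 \<le> \<mu> \<and> \<mu> < real K}. near_tail (real K) L \<mu>)"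
      proof (rule sum_mono2)
        show "finite {\<mu>\<in>eigs y. 0 \<le> \<mu> \<and> \<mu> < real K}"
          by (rule finite_subset[OF _ eigs_le_upper(1)[of y "real K"]]) auto
        show "?M \<subseteq> {\<mu>\<in>eigs y. 0 \<le> \<mu> \<and> \<mu> < real K}" using K by (auto simp: tail_exceptions_def)
      qed (auto intro: sum_nonneg)
      also have "\<dots> \<le> C1 * real K powr (201/200) / L" using C1(2) K L by blast
      also have "\<dots> \<le> C1 * (2 * X) powr (201/200) / L"
        using K L C1 elim by (intro divide_right_mono mult_left_mono powr_mono2) auto
      also have "\<dots> = C1 * 2 powr (201/200) * X powr (181/200)"
        using elim by (simp add: powr_mult L_def powr_diff[symmetric] flip: times_divide_eq_right)
      also have "real (card ?M) * (4 * C2 * X powr (-1/2)) \<le> (C3 * X) * (4 * C2 * X powr (-1/2))"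
      proof (intro mult_right_mono)
        have "card ?M \<le> card {\<mu>\<in>eigs y. \<mu> \<le> X}" using finE by (intro card_mono) (auto simp: tail_exceptions_def)
        then show "real (card ?M) \<le> C3 * X" using C3(2)[of X] elim by linarith
      qed (use C2 in auto)
      also have "\<dots> = 4 * C2 * C3 * X powr (1/2)"
        using elim powr_add[of X 1 "-1/2"] by simp
      also have "X powr (1/2) \<le> X powr (181/200)" using elim by (intro powr_mono) auto
      finally have "X powr (-1/20) * real (card ?M) \<le> (C1 * 2 powr (201/200) + 4 * C2 * C3) * X powr (181/200)"
        using C2 C3 by (simp add: algebra_simps)
      then have "X powr (1/20) * (X powr (-1/20) * real (card ?M)) \<le> X powr (1/20) * ((C1 * 2 powr (201/200) + 4 * C2 * C3) * X powr (181/200))"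
        by (intro mult_left_mono) auto
      also have "X powr (1/20) * (X powr (-1/20) * real (card ?M)) = real (card ?M)"
        using elim by (simp add: powr_add[symmetric] flip: mult.assoc)
      also have "X powr (1/20) * ((C1 * 2 powr (201/200) + 4 * C2 * C3) * X powr (181/200)) = (C1 * 2 powr (201/200) + 4 * C2 * C3) * X powr (191/200)"
        by (simp add: powr_add[symmetric] mult.left_commute)
      also have "\<dots> \<le> (C1 * 2 powr (201/200) + 4 * C2 * C3) * X powr (99/100)"
        using elim C1 C2 C3 by (intro mult_left_mono powr_mono) auto
      finally show ?case .
    qed
  qed
qed

lemma q_shift:
  "q (p + z) - q p = (2 * a\<^sup>2 * of_int (fst z)) * of_int (fst p) + (2 * of_int (snd z) / a\<^sup>2) * of_int (snd p) + q z"
  using a_pos by (simp add: q_def power2_eq_square field_simps)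

definition strip_exceptions :: "real \<Rightarrow> int \<times> int \<Rightarrow> real set" where
  "strip_exceptions y z = {\<mu>\<in>eigs y. \<mu> \<ge> 1 \<and> (\<exists>p. \<bar>q p - \<mu>\<bar> < \<mu> powr (1/5) \<and> \<bar>q (p + z) - \<mu>\<bar> < \<mu> powr (1/5))}"

text \<open>If \<open>\<xi>\<close> and \<open>\<xi> + \<zeta>\<close> both have norm within \<open>L = X\<^bsup>1/5\<^esup>\<close> of \<open>\<mu>\<close>, then \<open>2 \<langle>\<xi>, \<zeta>\<rangle> + |\<zeta>|\<^sup>2\<close> is less than \<open>2 L\<close> in modulus. So \<open>\<xi>\<close> lies
  in a strip with \<open>O(X\<^bsup>1/2 + 1/5\<^esup>)\<close> lattice points, and \<open>\<mu>\<close> in one of \<open>O(X\<^bsup>1/2 + 2/5\<^esup>)\<close> unit bins. By Cauchy--Schwarz and the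
  energy estimate for bins, these contain \<open>O(X\<^bsup>381/400\<^esup>)\<close> eigenvalues.\<close>

lemma negligible_strip_exceptions:
  assumes z: "z \<noteq> 0"
  shows "negligible_eigs y (strip_exceptions y z)"
proof -
  define b where "b = 2 * a\<^sup>2 * of_int (fst z)"
  define c where "c = 2 * of_int (snd z) / a\<^sup>2"
  have "b \<noteq> 0 \<or> c \<noteq> 0" using z a_pos by (auto simp: b_def c_def prod_eq_iff)
  from card_strip[OF this] obtain C where "0 < C \<and> (\<forall>X\<ge>1. \<forall>R\<ge>1.
      real (card {p. q p \<le> X \<and> in_strip b c R p}) \<le> C * (R * sqrt X))" ..
  then have C: "C > 0" "\<And>X R. X \<ge> 1 \<Longrightarrow> R \<ge> 1 \<Longrightarrow>
      real (card {p. q p \<le> X \<and> in_strip b c R p}) \<le> C * (R * sqrt X)"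
    by simp_all
  obtain C2 where C2: "C2 > 0" "\<And>K. K \<ge> 1 \<Longrightarrow> (\<Sum>k<K. (real (card (eig_bin y k)))\<^sup>2) \<le> C2 * real K powr (201/200)"
    using sum_eig_bin_sq_le by blast
  define A where "A = 5 * C * (2 + q z) * sqrt 2 * C2 * 2 powr (201/200)"
  have "2 + q z > 0" using q_nonneg[of z] by linarith
  then have A: "A > 0" unfolding A_def using C(1) C2(1) by (intro mult_pos_pos) simp_all
  show ?thesis
  proof (rule negligible_eigsI)
    show "strip_exceptions y z \<subseteq> eigs y" by (auto simp: strip_exceptions_def)
    show "\<forall>\<^sub>F X in at_top. real (card {\<mu>\<in>strip_exceptions y z. sqrt X < \<mu> \<and> \<mu> \<le> X}) \<le> sqrt A * X powr (99/100)"
      using eventually_ge_at_top[of 1]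
    proof eventually_elim
      case (elim X)
      let ?M = "{\<mu>\<in>strip_exceptions y z. sqrt X < \<mu> \<and> \<mu> \<le> X}"
      define L where "L = X powr (1/5)"
      define R where "R = (2 + q z) * L"
      define K where "K = nat \<lfloor>X\<rfloor> + 1"
      define S where "S = {p. q p \<le> 2 * X \<and> in_strip b c R p}"
      have L: "L \<ge> 1" using elim by (simp add: L_def ge_one_powr_ge_zero)
      have LX: "L \<le> X" using powr_mono[of "1/5" 1 X] elim by (simp add: L_def)
      have "1 * 1 \<le> (2 + q z) * L" using L q_nonneg[of z] by (intro mult_mono) auto
      then have R: "R \<ge> 1" by (simp add: R_def)
      have K: "X < real K" "real K \<le> 2 * X" "K \<ge> 1"
        using elim unfolding K_def by (rule nat_floor_succ)+
      have finS: "finite S" unfolding S_def by (rule finite_subset[OF _ finite_q_le[of "2 * X"]]) auto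
      \<comment> \<open>the bins that can contain an eigenvalue at distance less than \<open>L\<close> from \<open>q p\<close>\<close>
      define I where "I = (\<lambda>p. {j::int. q p - (L + 1) \<le> of_int j \<and> of_int j \<le> q p + (L + 1)})"
      define Z where "Z = {j. j < K \<and> int j \<in> (\<Union>p\<in>S. I p)}"
      have leI: "q p - (L + 1) \<le> q p + (L + 1)" for p using L by simp
      have finI: "finite (I p)" for p unfolding I_def by (rule card_int_interval_le(1)[OF leI])
      have cardI: "real (card (I p)) \<le> 5 * L" for p
        using card_int_interval_le(2)[OF leI[of p]] L unfolding I_def by simp
      have cardZ: "real (card Z) \<le> 5 * L * real (card S)"
      proof -
        have "card Z \<le> card (\<Union>p\<in>S. I p)"
          using finS finI by (intro card_inj_on_le[where f = int]) (auto simp: Z_def)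
        also have "\<dots> \<le> (\<Sum>p\<in>S. card (I p))" by (rule card_UN_le[OF finS])
        finally have "real (card Z) \<le> (\<Sum>p\<in>S. real (card (I p)))" by (metis of_nat_mono of_nat_sum)
        also have "\<dots> \<le> (\<Sum>p\<in>S. 5 * L)" by (intro sum_mono cardI)
        finally show ?thesis by (simp add: mult.commute)
      qed
      have finZ: "finite Z" by (rule finite_subset[of _ "{..<K}"]) (auto simp: Z_def)
      have sub: "?M \<subseteq> (\<Union>j\<in>Z. eig_bin y j)"
      proof
        fix \<mu> assume "\<mu> \<in> ?M"
        then obtain p where \<mu>: "\<mu> \<in> eigs y" "\<mu> \<ge> 1" "\<mu> \<le> X"
          and p: "\<bar>q p - \<mu>\<bar> < \<mu> powr (1/5)" "\<bar>q (p + z) - \<mu>\<bar> < \<mu> powr (1/5)"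
          by (auto simp: strip_exceptions_def)
        have "\<mu> powr (1/5) \<le> L" unfolding L_def using \<mu> by (intro powr_mono2) auto
        then have pL: "\<bar>q p - \<mu>\<bar> < L" "\<bar>q (p + z) - \<mu>\<bar> < L" using p by linarith+
        have "b * of_int (fst p) + c * of_int (snd p) = q (p + z) - q p - q z"
          using q_shift[of p z] by (simp add: b_def c_def)
        then have "\<bar>b * of_int (fst p) + c * of_int (snd p)\<bar> \<le> 2 * L + q z"
          using pL q_nonneg[of z] by linarith
        also have "\<dots> \<le> R" using L q_nonneg[of z] mult_left_mono[of 1 L "q z"] by (simp add: R_def distrib_right)
        finally have "p \<in> S" using pL LX \<mu> by (auto simp: S_def)
        define j where "j = nat \<lfloor>\<mu>\<rfloor>"
        have j: "real j \<le> \<mu>" "\<mu> < real j + 1" using \<mu> by (simp_all add: j_def)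
        have "real j < real K" using j \<mu> K by linarith
        moreover have "int j \<in> I p" using j pL unfolding I_def by auto
        ultimately have "j \<in> Z" using \<open>p \<in> S\<close> unfolding Z_def by auto
        then show "\<mu> \<in> (\<Union>j\<in>Z. eig_bin y j)" using j \<mu> by (auto simp: eig_bin_def)
      qed
      have "card ?M \<le> card (\<Union>j\<in>Z. eig_bin y j)"
        using finZ eig_bin_le(1) sub by (intro card_mono) auto
      also have "\<dots> \<le> (\<Sum>j\<in>Z. card (eig_bin y j))" by (rule card_UN_le[OF finZ])
      finally have "real (card ?M) \<le> (\<Sum>j\<in>Z. 1 * real (card (eig_bin y j)))"
        by (simp flip: of_nat_sum)
      then have "(real (card ?M))\<^sup>2 \<le> (\<Sum>j\<in>Z. 1 * real (card (eig_bin y j)))\<^sup>2" by (intro power_mono) auto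
      also have "\<dots> \<le> (\<Sum>j\<in>Z. 1\<^sup>2) * (\<Sum>j\<in>Z. (real (card (eig_bin y j)))\<^sup>2)"
        by (rule Cauchy_Schwarz_ineq_sum)
      also have "\<dots> \<le> (5 * L * (C * (R * sqrt (2 * X)))) * (C2 * (2 * X) powr (201/200))"
      proof (intro mult_mono)
        have "real (card S) \<le> C * (R * sqrt (2 * X))" unfolding S_def using C(2)[of "2 * X" R] R elim by simp
        then have "5 * L * real (card S) \<le> 5 * L * (C * (R * sqrt (2 * X)))" using L by (intro mult_left_mono) auto
        then show "(\<Sum>j\<in>Z. 1\<^sup>2) \<le> 5 * L * (C * (R * sqrt (2 * X)))" using cardZ by simp
        have "(\<Sum>j\<in>Z. (real (card (eig_bin y j)))\<^sup>2) \<le> (\<Sum>j<K. (real (card (eig_bin y j)))\<^sup>2)"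
          by (intro sum_mono2) (auto simp: Z_def)
        also have "\<dots> \<le> C2 * real K powr (201/200)" by (rule C2(2)[OF K(3)])
        also have "\<dots> \<le> C2 * (2 * X) powr (201/200)" using K C2 by (intro mult_left_mono powr_mono2) auto
        finally show "(\<Sum>j\<in>Z. (real (card (eig_bin y j)))\<^sup>2) \<le> C2 * (2 * X) powr (201/200)" .
      qed (use L C R elim in \<open>auto intro!: sum_nonneg mult_nonneg_nonneg\<close>)
      also have "\<dots> = A * (L * L * sqrt X * X powr (201/200))"
        using elim by (simp add: A_def R_def real_sqrt_mult powr_mult)
      also have "L * L * sqrt X * X powr (201/200) = X powr (381/200)"
        using elim by (simp add: L_def powr_half_sqrt[symmetric] powr_add[symmetric])
      also have "A * X powr (381/200) \<le> A * X powr (99/50)"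
        using A elim by (intro mult_left_mono powr_mono) auto
      also have "\<dots> = (sqrt A * X powr (99/100))\<^sup>2"
        using A by (simp add: power_mult_distrib power2_eq_square[of "X powr _"] powr_add[symmetric])
      finally show "real (card ?M) \<le> sqrt A * X powr (99/100)"
        using A by (simp add: abs_le_square_iff[symmetric])
    qed
  qed
qed

text \<open>Split according to whether \<open>p\<close> itself is far from the circle; otherwise \<open>p + z\<close> is. In either case one of the
  factors belongs to the tail and Cauchy--Schwarz applies.\<close>

lemma sum_shifted_products_le:
  assumes \<mu>: "\<mu> \<notin> range q" and L: "\<And>p. L \<le> \<bar>q p - \<mu>\<bar> \<or> L \<le> \<bar>q (p + z) - \<mu>\<bar>" and F: "finite F"
  shows "(\<Sum>p\<in>F. 1 / (\<bar>q p - \<mu>\<bar> * \<bar>q (p + z) - \<mu>\<bar>)) \<le> 2 * sqrt (green_energy \<mu> * green_tail \<mu> L)"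
proof -
  let ?f = "\<lambda>p. 1 / \<bar>q p - \<mu>\<bar>" and ?far = "{p. L \<le> \<bar>q p - \<mu>\<bar>}"
  have sm: "(\<lambda>p. 1 / (q p - \<mu>)\<^sup>2) summable_on A" for A by (rule summable_on_inverse_shift_sq[OF \<mu>])
  have energy: "(\<Sum>p\<in>A. (?f p)\<^sup>2) \<le> green_energy \<mu>" if "finite A" for A
    unfolding green_energy_def using that
    by (simp add: power_divide) (intro finite_sum_le_infsum sm; auto)
  have tail: "(\<Sum>p\<in>A. (?f p)\<^sup>2) \<le> green_tail \<mu> L" if "finite A" "A \<subseteq> ?far" for A
    unfolding green_tail_def using that
    by (simp add: power_divide) (intro finite_sum_le_infsum sm; auto)
  have inj: "inj_on (\<lambda>p. p + z) A" for A by (auto intro: inj_onI)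
  have CS: "(\<Sum>p\<in>A. f p * g p) \<le> sqrt (B1 * B2)"
    if "(\<Sum>p\<in>A. (f p)\<^sup>2) \<le> B1" "(\<Sum>p\<in>A. (g p)\<^sup>2) \<le> B2" for A and f g :: "int \<times> int \<Rightarrow> real" and B1 B2
  proof (rule real_le_rsqrt)
    have "(\<Sum>p\<in>A. f p * g p)\<^sup>2 \<le> (\<Sum>p\<in>A. (f p)\<^sup>2) * (\<Sum>p\<in>A. (g p)\<^sup>2)" by (rule Cauchy_Schwarz_ineq_sum)
    also have "\<dots> \<le> B1 * B2" using that by (intro mult_mono) (auto intro: sum_nonneg order_trans[OF sum_nonneg that(1)])
    finally show "(\<Sum>p\<in>A. f p * g p)\<^sup>2 \<le> B1 * B2" .
  qed
  have shift: "(\<Sum>p\<in>A. (?f (p + z))\<^sup>2) = (\<Sum>p\<in>(\<lambda>p. p + z) ` A. (?f p)\<^sup>2)" for A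
    by (simp add: sum.reindex[OF inj])
  let ?F1 = "F \<inter> ?far" and ?F2 = "F - ?far"
  have "(\<Sum>p\<in>F. ?f p * ?f (p + z)) = (\<Sum>p\<in>?F1. ?f p * ?f (p + z)) + (\<Sum>p\<in>?F2. ?f p * ?f (p + z))"
    using F by (rule sum.Int_Diff)
  also have "(\<Sum>p\<in>?F1. ?f p * ?f (p + z)) \<le> sqrt (green_tail \<mu> L * green_energy \<mu>)"
    using F by (intro CS tail) (auto simp: shift intro!: energy)
  also have "(\<Sum>p\<in>?F2. ?f p * ?f (p + z)) \<le> sqrt (green_energy \<mu> * green_tail \<mu> L)"
  proof (intro CS energy)
    have "(\<lambda>p. p + z) ` ?F2 \<subseteq> ?far" using L by blast
    then show "(\<Sum>p\<in>?F2. (?f (p + z))\<^sup>2) \<le> green_tail \<mu> L" using F unfolding shift by (intro tail) auto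
  qed (use F in auto)
  finally show ?thesis by (simp add: mult.commute)
qed

text \<open>The bound for the off-diagonal sums in the form in which the Fourier argument uses it.\<close>

abbreviation weakly_correlated :: "real \<Rightarrow> int \<times> int \<Rightarrow> bool" where
  "weakly_correlated \<mu> z \<equiv> \<forall>F. finite F \<longrightarrow>
     (\<Sum>p\<in>F. 1 / (\<bar>q p - \<mu>\<bar> * \<bar>q (p + z) - \<mu>\<bar>)) \<le> 2 * \<mu> powr (-1/200) * green_energy \<mu>"

lemma sum_shifted_products_le_energy:
  assumes z: "z \<noteq> 0"
  shows "\<exists>B. negligible_eigs y B \<and> (\<forall>\<mu>\<in>eigs y - B. \<mu> \<ge> 1 \<longrightarrow> weakly_correlated \<mu> z)"
proof (intro exI conjI ballI impI allI)
  let ?B = "gap_exceptions y \<union> tail_exceptions y \<union> strip_exceptions y z"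
  show "negligible_eigs y ?B"
    using z by (intro negligible_eigs_Un negligible_gap_exceptions negligible_tail_exceptions negligible_strip_exceptions)
  fix \<mu> F assume \<mu>: "\<mu> \<in> eigs y - ?B" "\<mu> \<ge> 1" and F: "finite (F :: (int \<times> int) set)"
  let ?L = "\<mu> powr (1/5)" and ?D = "green_energy \<mu>"
  have \<mu>q: "\<mu> \<notin> range q" using \<mu> by (auto simp: eigs_def)
  have D: "\<mu> powr (-1/25) \<le> ?D" using \<mu> by (intro green_energy_ge_powr) auto
  have T: "green_tail \<mu> ?L \<le> \<mu> powr (-1/20)" using \<mu> by (auto simp: tail_exceptions_def)
  have D0: "?D \<ge> 0" using D by (meson order_trans powr_ge_zero)
  have sep: "?L \<le> \<bar>q p - \<mu>\<bar> \<or> ?L \<le> \<bar>q (p + z) - \<mu>\<bar>" for p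
  proof (rule ccontr)
    assume "\<not> ?thesis"
    then have "\<bar>q p - \<mu>\<bar> < ?L \<and> \<bar>q (p + z) - \<mu>\<bar> < ?L" by linarith
    then have "\<mu> \<in> strip_exceptions y z" using \<mu> unfolding strip_exceptions_def by blast
    then show False using \<mu> by blast
  qed
  have "(\<Sum>p\<in>F. 1 / (\<bar>q p - \<mu>\<bar> * \<bar>q (p + z) - \<mu>\<bar>)) \<le> 2 * sqrt (?D * green_tail \<mu> ?L)"
    by (rule sum_shifted_products_le[OF \<mu>q sep F])
  also have "sqrt (?D * green_tail \<mu> ?L) \<le> sqrt ((\<mu> powr (-1/200) * ?D)\<^sup>2)"
  proof (intro real_sqrt_le_mono)
    \<comment> \<open>the margin \<open>1/20 - 1/25 = 1/100\<close> between the tail and the energy gives the decay rate\<close>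
    have "\<mu> powr (-1/20) = \<mu> powr (-1/100) * \<mu> powr (-1/25)" by (simp add: powr_add[symmetric])
    also have "\<dots> \<le> \<mu> powr (-1/100) * ?D" using D by (intro mult_left_mono) auto
    finally have "green_tail \<mu> ?L \<le> \<mu> powr (-1/100) * ?D" using T by linarith
    then have "?D * green_tail \<mu> ?L \<le> ?D * (\<mu> powr (-1/100) * ?D)" using D0 by (rule mult_left_mono)
    also have "\<dots> = (\<mu> powr (-1/200) * ?D)\<^sup>2"
      by (simp add: power_mult_distrib power2_eq_square powr_add[symmetric])
    finally show "?D * green_tail \<mu> ?L \<le> (\<mu> powr (-1/200) * ?D)\<^sup>2" .
  qed
  also have "\<dots> = \<mu> powr (-1/200) * ?D" using D0 by simp
  finally show "(\<Sum>p\<in>F. 1 / (\<bar>q p - \<mu>\<bar> * \<bar>q (p + z) - \<mu>\<bar>)) \<le> 2 * \<mu> powr (-1/200) * ?D" by simp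
qed

lemma almost_all_eigs_off_diagonal_small:
  "\<exists>B. negligible_eigs y B \<and> (\<forall>z. z \<noteq> 0 \<longrightarrow> (\<exists>X. \<forall>\<mu>\<in>eigs y - B. X < \<mu> \<longrightarrow> weakly_correlated \<mu> z))"
proof -
  define dec where "dec = (from_nat_into (UNIV - {0 :: int \<times> int}))"
  have ne: "UNIV - {0 :: int \<times> int} \<noteq> {}" 
  proof -
    have "(1, 0) \<in> UNIV - {0 :: int \<times> int}" by (simp add: zero_prod_def)
    then show ?thesis by blast
  qed
  have "dec i \<noteq> 0" for i using from_nat_into[OF ne, of i] by (simp add: dec_def)
  then have "\<exists>B. negligible_eigs y B \<and> (\<forall>\<mu>\<in>eigs y - B. \<mu> \<ge> 1 \<longrightarrow> weakly_correlated \<mu> (dec i))" for i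
    by (intro sum_shifted_products_le_energy)
  then have "\<forall>i. \<exists>B. negligible_eigs y B \<and> (\<forall>\<mu>\<in>eigs y - B. \<mu> \<ge> 1 \<longrightarrow> weakly_correlated \<mu> (dec i))" ..
  from choice[OF this] obtain B where
    "\<forall>i. negligible_eigs y (B i) \<and> (\<forall>\<mu>\<in>eigs y - B i. \<mu> \<ge> 1 \<longrightarrow> weakly_correlated \<mu> (dec i))" ..
  then have B: "\<And>i. negligible_eigs y (B i)"
    "\<And>i \<mu>. \<mu> \<in> eigs y - B i \<Longrightarrow> \<mu> \<ge> 1 \<Longrightarrow> weakly_correlated \<mu> (dec i)" by simp_all
  from negligible_eigs_diagonal[of y B, OF B(1)] obtain B' where
    "negligible_eigs y B' \<and> (\<forall>i. \<exists>X. \<forall>\<mu>\<in>B i. X < \<mu> \<longrightarrow> \<mu> \<in> B')" ..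
  then have B': "negligible_eigs y B'" "\<And>i. \<exists>X. \<forall>\<mu>\<in>B i. X < \<mu> \<longrightarrow> \<mu> \<in> B'" by simp_all
  show ?thesis
  proof (intro exI[of _ B'] conjI allI impI B'(1))
    fix z :: "int \<times> int" assume "z \<noteq> 0"
    then have z: "z \<in> UNIV - {0}" by simp
    have "countable (UNIV - {0 :: int \<times> int})" by simp
    from from_nat_into_surj[OF this z] obtain i where i: "dec i = z" unfolding dec_def ..
    from B'(2)[of i] obtain X where X: "\<forall>\<mu>\<in>B i. X < \<mu> \<longrightarrow> \<mu> \<in> B'" ..
    show "\<exists>X. \<forall>\<mu>\<in>eigs y - B'. X < \<mu> \<longrightarrow> weakly_correlated \<mu> z"
    proof (intro exI[of _ "max X 1"] ballI impI)
      fix \<mu> assume \<mu>: "\<mu> \<in> eigs y - B'" "max X 1 < \<mu>"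
      then have "X < \<mu>" "\<mu> \<ge> 1" by simp_all
      have "\<mu> \<notin> B i" using X \<mu>(1) \<open>X < \<mu>\<close> by blast
      then have "\<mu> \<in> eigs y - B i" using \<mu>(1) by simp
      from B(2)[OF this \<open>\<mu> \<ge> 1\<close>] show "weakly_correlated \<mu> z" unfolding i .
    qed
  qed
qed

end

section \<open>Fourier coefficients of the square of the Green's function\<close>

lemma integral_exp_full_period:
  fixes c L :: real and k :: int
  assumes L: "L > 0" and k: "k \<noteq> 0" and c: "c * L = 2 * pi * of_int k"
  shows "(\<integral>t. indicator {0..<L} t *\<^sub>R exp (\<i> * of_real (c * t)) \<partial>lborel) = 0"
proof -
  have c0: "c \<noteq> 0" using c k by auto
  have "(\<integral>t. indicator {0..<L} t *\<^sub>R exp (\<i> * of_real (c * t)) \<partial>lborel)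
      = (\<integral>t. indicator {0..L} t *\<^sub>R exp (\<i> * of_real (c * t)) \<partial>lborel)"
  proof (rule integral_cong_AE)
    show "AE t in lborel. indicator {0..<L} t *\<^sub>R exp (\<i> * of_real (c * t)) = indicator {0..L} t *\<^sub>R exp (\<i> * of_real (c * t))"
      using AE_lborel_singleton[of L] by eventually_elim (auto simp: indicator_def)
  qed measurable
  also have "\<dots> = exp (\<i> * of_real (c * L)) / (\<i> * of_real c) - exp (\<i> * of_real (c * 0)) / (\<i> * of_real c)"
  proof (rule integral_FTC_Icc)
    fix t :: real
    show "((\<lambda>t. exp (\<i> * of_real (c * t)) / (\<i> * of_real c)) has_vector_derivative exp (\<i> * of_real (c * t))) (at t within {0..L})"
    proof -
      have "((\<lambda>w. exp (\<i> * (of_real c * w)) / (\<i> * of_real c)) has_field_derivative exp (\<i> * (of_real c * of_real t))) (at (of_real t))"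
        using c0 by (auto intro!: derivative_eq_intros simp: complex_eq_iff)
      from has_vector_derivative_real_field[OF this, of "{0..L}"] show ?thesis by simp
    qed
  qed (use L in \<open>auto intro!: continuous_intros\<close>)
  also have "exp (\<i> * of_real (c * L)) = 1"
    unfolding c exp_eq_1 by (auto simp: mult.assoc)
  finally show ?thesis by simp
qed

lemma integral_lborel_prod_mult:
  fixes f g :: "real \<Rightarrow> complex"
  assumes f: "integrable lborel f" and g: "integrable lborel g"
  shows "integral\<^sup>L lborel (\<lambda>x. f (fst x) * g (snd x)) = integral\<^sup>L lborel f * integral\<^sup>L lborel g"
proof -
  have [measurable]: "f \<in> borel_measurable lborel" "g \<in> borel_measurable lborel" using f g by auto
  have int: "integrable (lborel \<Otimes>\<^sub>M lborel) (\<lambda>x. f (fst x) * g (snd x))"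
  proof (rule lborel_pair.Fubini_integrable)
    show "integrable lborel (\<lambda>x. \<integral>y. norm (f (fst (x, y)) * g (snd (x, y))) \<partial>lborel)"
      using f g by (simp add: norm_mult)
    show "AE x in lborel. integrable lborel (\<lambda>y. f (fst (x, y)) * g (snd (x, y)))"
      using g by simp
  qed measurable
  have "integral\<^sup>L (lborel \<Otimes>\<^sub>M lborel) (\<lambda>x. f (fst x) * g (snd x)) = (\<integral>x. (\<integral>y. f x * g y \<partial>lborel) \<partial>lborel)"
    using lborel_pair.integral_fst'[OF int] by simp
  also have "\<dots> = integral\<^sup>L lborel f * integral\<^sup>L lborel g" by simp
  finally show ?thesis by (simp add: lborel_prod)
qed

text \<open>Convergence of quadratic expressions under \<open>L\<^sup>2\<close>-convergence: \<open>N\<close> stands for the squared \<open>L\<^sup>2\<close>-error and \<open>B\<close> for the squared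
  norm of the limit. First \<open>t\<close> is chosen small, then the error.\<close>

lemma tendsto_of_quadratic_error:
  fixes A :: "'a \<Rightarrow> 'b::real_normed_vector"
  assumes N: "(N \<longlongrightarrow> 0) F" and B: "B \<ge> 0"
    and bound: "\<And>x t. t > 0 \<Longrightarrow> norm (A x - l) \<le> (1 + 1 / t) * N x + t * B"
  shows "(A \<longlongrightarrow> l) F"
proof (rule tendstoI)
  fix e :: real assume e: "e > 0"
  define t where "t = e / (2 * (B + 1))"
  have t: "t > 0" using e B by (simp add: t_def)
  have tB: "t * B \<le> e / 2" 
    using e B by (simp add: t_def field_simps)
  have "((\<lambda>x. (1 + 1 / t) * N x) \<longlongrightarrow> (1 + 1 / t) * 0) F" by (intro tendsto_intros N)
  then have "\<forall>\<^sub>F x in F. (1 + 1 / t) * N x < e / 2" using e by (intro order_tendstoD) auto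
  then show "\<forall>\<^sub>F x in F. dist (A x) l < e"
  proof eventually_elim
    case (elim x)
    then show ?case using bound[OF t, of x] tB unfolding dist_norm by linarith
  qed
qed

context rect_torus begin

definition character :: "int \<times> int \<Rightarrow> real \<times> real \<Rightarrow> complex" where
  "character z x = exp (\<i> * of_real (lattice_point z \<bullet> x))"

lemma character_0 [simp]: "character 0 x = 1"
  by (simp add: character_def lattice_point_def inner_prod_def)

lemma lattice_point_add: "lattice_point (z + w) = lattice_point z + lattice_point w"
  by (simp add: lattice_point_def distrib_right add_divide_distrib)

lemma lattice_point_uminus: "lattice_point (- z) = - lattice_point z"
  by (simp add: lattice_point_def)

lemma character_add: "character (z + w) x = character z x * character w x"
  by (simp add: character_def lattice_point_add inner_add_left distrib_left exp_add)

lemma cnj_character: "cnj (character z x) = character (- z) x"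
  by (simp add: character_def lattice_point_uminus exp_cnj)

lemma norm_character [simp]: "norm (character z x) = 1"
  by (simp add: character_def)

lemma continuous_on_character: "continuous_on A (character z)"
  unfolding character_def by (intro continuous_intros)

lemma borel_measurable_character [measurable]: "character z \<in> borel_measurable borel"
  by (intro borel_measurable_continuous_onI continuous_on_character)

lemma torus_dom_borel [measurable]: "torus_dom a \<in> sets borel"
  unfolding torus_dom_def by (intro borel_Times) auto

lemma emeasure_torus_dom: "emeasure lborel (torus_dom a) = ennreal (4 * pi\<^sup>2)"
proof -
  have "emeasure lborel (torus_dom a) = emeasure lborel {0..<2 * pi / a} * emeasure lborel {0..<2 * pi * a}"
    unfolding torus_dom_def by (subst lborel_prod[symmetric], subst lborel.emeasure_pair_measure_Times) auto
  also have "\<dots> = ennreal ((2 * pi / a) * (2 * pi * a))"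
    using a_pos by (subst ennreal_mult) auto
  also have "(2 * pi / a) * (2 * pi * a) = 4 * pi\<^sup>2"
    using a_pos by (simp add: power2_eq_square)
  finally show ?thesis .
qed

lemma torus_area_eq: "torus_area a = 4 * pi\<^sup>2"
  by (simp add: torus_area_def measure_def emeasure_torus_dom)

abbreviation torus_integrable :: "(real \<times> real \<Rightarrow> 'b::{banach, second_countable_topology}) \<Rightarrow> bool" where
  "torus_integrable \<equiv> set_integrable lborel (torus_dom a)"

abbreviation torus_mass :: "(real \<times> real \<Rightarrow> complex) \<Rightarrow> real" where
  "torus_mass G \<equiv> torus_integral a (\<lambda>x. (norm (G x))\<^sup>2)"

lemma torus_mass_nonneg: "0 \<le> torus_mass G"
  unfolding torus_integral_def set_lebesgue_integral_def by (intro integral_nonneg_AE always_eventually allI) simp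

lemma set_integrable_torus_bounded:
  fixes f :: "real \<times> real \<Rightarrow> 'b::{banach, second_countable_topology}"
  assumes [measurable]: "f \<in> borel_measurable borel" and "\<And>x. norm (f x) \<le> B"
  shows "torus_integrable f"
  unfolding set_integrable_def
proof (rule Bochner_Integration.integrable_bound)
  show "integrable lborel (\<lambda>x. indicator (torus_dom a) x * B)"
    by (intro integrable_mult_left integrable_real_indicator) (auto simp: emeasure_torus_dom)
  show "AE x in lborel. norm (indicator (torus_dom a) x *\<^sub>R f x) \<le> norm (indicator (torus_dom a) x * B)"
    using order_trans[OF assms(2) abs_ge_self] by (intro always_eventually allI) (auto simp: indicator_def)
qed measurable

lemma torus_integral_character: "torus_integral a (character z) = (if z = 0 then 4 * of_real pi ^ 2 else 0)"
proof (cases "z = 0")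
  case True
  have "torus_integral a (\<lambda>x. 1 :: complex) = of_real (measure lborel (torus_dom a))"
    unfolding torus_integral_def set_lebesgue_integral_def
    using emeasure_torus_dom by (subst integral_scaleR_left) (auto simp: of_real_def)
  moreover have "character z = (\<lambda>x. 1)" using True by auto
  ultimately show ?thesis using True torus_area_eq by (simp add: torus_area_def)
next
  case False
  let ?f = "\<lambda>t. indicator {0..<2 * pi / a} t *\<^sub>R exp (\<i> * of_real ((of_int (fst z) * a) * t)) :: complex"
  let ?g = "\<lambda>t. indicator {0..<2 * pi * a} t *\<^sub>R exp (\<i> * of_real ((of_int (snd z) / a) * t)) :: complex"
  have int: "integrable lborel (\<lambda>t. indicator {0..<L} t *\<^sub>R exp (\<i> * of_real (c * t)) :: complex)" for c L :: real
  proof (rule Bochner_Integration.integrable_bound)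
    show "integrable lborel (\<lambda>t. indicator {0..<L} t :: real)"
    proof (rule integrable_real_indicator)
      show "emeasure lborel {0..<L} < \<infinity>" by (cases "0 \<le> L") auto
    qed simp
    show "AE t in lborel. norm (indicator {0..<L} t *\<^sub>R exp (\<i> * of_real (c * t)) :: complex) \<le> norm (indicator {0..<L} t :: real)"
      by (intro always_eventually allI) (auto simp: indicator_def)
  qed measurable
  have "torus_integral a (character z) = integral\<^sup>L lborel (\<lambda>x. ?f (fst x) * ?g (snd x))"
    unfolding torus_integral_def set_lebesgue_integral_def
  proof (intro Bochner_Integration.integral_cong refl)
    fix x
    show "indicator (torus_dom a) x *\<^sub>R character z x = ?f (fst x) * ?g (snd x)"
      by (cases x) (simp add: torus_dom_def indicator_times character_def lattice_point_def inner_prod_def distrib_left exp_add scaleR_conv_of_real)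
  qed
  also have "\<dots> = integral\<^sup>L lborel ?f * integral\<^sup>L lborel ?g"
    by (rule integral_lborel_prod_mult[OF int int])
  also have "\<dots> = 0"
  proof (cases "fst z = 0")
    case True
    then have "snd z \<noteq> 0" using False by (simp add: prod_eq_iff)
    then have "integral\<^sup>L lborel ?g = 0"
      using a_pos by (intro integral_exp_full_period[where k = "snd z"]) auto
    then show ?thesis by simp
  next
    case False
    then have "integral\<^sup>L lborel ?f = 0"
      using a_pos by (intro integral_exp_full_period[where k = "fst z"]) auto
    then show ?thesis by simp
  qed
  finally show ?thesis using False by simp
qed

lemma torus_integral_sum:
  assumes "finite I" "\<And>i. i \<in> I \<Longrightarrow> torus_integrable (f i)"
  shows "torus_integral a (\<lambda>x. \<Sum>i\<in>I. f i x) = (\<Sum>i\<in>I. torus_integral a (f i) :: complex)"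
  unfolding torus_integral_def set_lebesgue_integral_def scaleR_sum_right
  using assms by (intro Bochner_Integration.integral_sum) (simp add: set_integrable_def)

lemma torus_integral_cmult: "torus_integral a (\<lambda>x. c * f x) = c * (torus_integral a f :: complex)"
  by (simp add: torus_integral_def)

lemma set_integrable_character: "torus_integrable (character z)"
  by (rule set_integrable_torus_bounded[where B = 1]) auto

lemma torus_integral_double_sum:
  assumes "finite F"
  shows "torus_integral a (\<lambda>x. \<Sum>p\<in>F. \<Sum>r\<in>F. c p r * character (w p r) x)
     = (\<Sum>p\<in>F. \<Sum>r\<in>F. c p r * (if w p r = 0 then 4 * of_real pi ^ 2 else 0))"
proof -
  have int: "torus_integrable (\<lambda>x. c p r * character (w p r) x)" for p r
    by (intro set_integrable_mult_right set_integrable_character)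
  have int2: "torus_integrable (\<lambda>x. \<Sum>r\<in>F. c p r * character (w p r) x)" for p
    using int unfolding set_integrable_def scaleR_sum_right by (intro Bochner_Integration.integrable_sum) auto
  have "torus_integral a (\<lambda>x. \<Sum>p\<in>F. \<Sum>r\<in>F. c p r * character (w p r) x)
     = (\<Sum>p\<in>F. torus_integral a (\<lambda>x. \<Sum>r\<in>F. c p r * character (w p r) x))"
    using assms int2 by (intro torus_integral_sum) auto
  also have "\<dots> = (\<Sum>p\<in>F. \<Sum>r\<in>F. torus_integral a (\<lambda>x. c p r * character (w p r) x))"
    using assms int by (intro sum.cong refl torus_integral_sum) auto
  finally show ?thesis by (simp add: torus_integral_cmult torus_integral_character)
qed

definition green_coeff :: "real \<times> real \<Rightarrow> real \<Rightarrow> int \<times> int \<Rightarrow> complex" where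
  "green_coeff x0 \<mu> p = - (1 / (4 * of_real pi ^ 2)) * character (- p) x0 / of_real (q p - \<mu>)"

text \<open>The partial sums of the Green's function, with the frequencies indexed by pairs of integers.\<close>

definition green_poly :: "real \<times> real \<Rightarrow> real \<Rightarrow> (int \<times> int) set \<Rightarrow> real \<times> real \<Rightarrow> complex" where
  "green_poly x0 \<mu> F x = (\<Sum>p\<in>F. green_coeff x0 \<mu> p * character p x)"

lemma green_partial_sum_eq: "green_partial_sum x0 \<mu> (lattice_point ` F) x = green_poly x0 \<mu> F x"
proof -
  have ch: "exp (\<i> * of_real (lattice_point p \<bullet> (x - x0))) = character (- p) x0 * character p x" for p
    by (simp add: character_def lattice_point_uminus inner_diff_right exp_add[symmetric] algebra_simps)
  have inj: "inj_on lattice_point F" using inj_lattice_point by (rule inj_on_subset) simp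
  show ?thesis
    unfolding green_partial_sum_def green_poly_def green_coeff_def sum.reindex[OF inj] o_def ch norm_lattice_point sum_distrib_left
    by (intro sum.cong refl) simp
qed

lemma borel_measurable_green_poly [measurable]: "green_poly x0 \<mu> F \<in> borel_measurable borel"
  unfolding green_poly_def[abs_def] by measurable

lemma norm_green_poly_le: "norm (green_poly x0 \<mu> F x) \<le> (\<Sum>p\<in>F. norm (green_coeff x0 \<mu> p))"
  unfolding green_poly_def by (rule order_trans[OF norm_sum]) (simp add: norm_mult)

lemma norm_green_coeff: "norm (green_coeff x0 \<mu> p) = 1 / (4 * pi\<^sup>2) * (1 / \<bar>q p - \<mu>\<bar>)"
  unfolding green_coeff_def norm_mult norm_divide norm_of_real by (simp add: norm_divide norm_mult norm_power)

lemma q_uminus: "q (- p) = q p"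
  by (simp add: q_def)

lemma torus_integral_green_poly_norm:
  assumes "finite F"
  shows "torus_mass (green_poly x0 \<mu> F) = 1 / (4 * pi\<^sup>2) * (\<Sum>p\<in>F. 1 / (q p - \<mu>)\<^sup>2)"
proof -
  let ?c = "green_coeff x0 \<mu>"
  have sq: "of_real ((norm (green_poly x0 \<mu> F x))\<^sup>2) = (\<Sum>p\<in>F. \<Sum>r\<in>F. (?c p * cnj (?c r)) * character (p - r) x)" for x
  proof -
    have "of_real ((norm (green_poly x0 \<mu> F x))\<^sup>2) = green_poly x0 \<mu> F x * cnj (green_poly x0 \<mu> F x)"
      by (simp only: complex_norm_square)
    also have "\<dots> = (\<Sum>p\<in>F. \<Sum>r\<in>F. (?c p * character p x) * cnj (?c r * character r x))"
      by (simp add: green_poly_def cnj_sum sum_product del: complex_cnj_mult)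
    also have "\<dots> = (\<Sum>p\<in>F. \<Sum>r\<in>F. (?c p * cnj (?c r)) * character (p - r) x)"
      by (intro sum.cong refl) (simp add: cnj_character character_add[of _ "- _", simplified] mult_ac)
    finally show ?thesis .
  qed
  have "of_real (torus_mass (green_poly x0 \<mu> F))
      = torus_integral a (\<lambda>x. of_real ((norm (green_poly x0 \<mu> F x))\<^sup>2) :: complex)"
    unfolding torus_integral_def by (rule set_integral_complex_of_real[symmetric])
  also have "\<dots> = (\<Sum>p\<in>F. \<Sum>r\<in>F. (?c p * cnj (?c r)) * (if p - r = 0 then 4 * of_real pi ^ 2 else 0))"
    unfolding sq by (rule torus_integral_double_sum[OF assms])
  also have "\<dots> = (\<Sum>p\<in>F. (?c p * cnj (?c p)) * (4 * of_real pi ^ 2))"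
  proof (intro sum.cong refl)
    fix p assume p: "p \<in> F"
    have "(\<Sum>r\<in>F. (?c p * cnj (?c r)) * (if p - r = 0 then 4 * of_real pi ^ 2 else 0))
       = (\<Sum>r\<in>F. if r = p then (?c p * cnj (?c p)) * (4 * of_real pi ^ 2) else 0)"
      by (intro sum.cong) auto
    also have "\<dots> = (?c p * cnj (?c p)) * (4 * of_real pi ^ 2)" using p assms by (simp add: sum.delta)
    finally show "(\<Sum>r\<in>F. (?c p * cnj (?c r)) * (if p - r = 0 then 4 * of_real pi ^ 2 else 0)) = (?c p * cnj (?c p)) * (4 * of_real pi ^ 2)" .
  qed
  also have "\<dots> = of_real (\<Sum>p\<in>F. (norm (?c p))\<^sup>2 * (4 * pi\<^sup>2))"
    by (simp only: complex_norm_square[symmetric] of_real_sum of_real_mult of_real_power of_real_numeral)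
  also have "(\<Sum>p\<in>F. (norm (?c p))\<^sup>2 * (4 * pi\<^sup>2)) = 1 / (4 * pi\<^sup>2) * (\<Sum>p\<in>F. 1 / (q p - \<mu>)\<^sup>2)"
    unfolding sum_distrib_left by (intro sum.cong refl) (simp add: norm_green_coeff power_mult_distrib power_divide power2_eq_square)
  finally show ?thesis by (simp only: of_real_eq_iff)
qed

text \<open>Only pairs of frequencies with \<open>z + p + r = 0\<close> survive. The square here is not an absolute square, so
  the second frequency is the reflection of \<open>p + z\<close>; its coefficient has the modulus of that of \<open>p + z\<close>.\<close>

lemma torus_integral_character_green_poly_sq:
  assumes F: "finite F"
  shows "torus_integral a (\<lambda>x. character z x * (green_poly x0 \<mu> F x)\<^sup>2)
     = 4 * of_real pi ^ 2 * (\<Sum>p\<in>{p\<in>F. - (p + z) \<in> F}. green_coeff x0 \<mu> p * green_coeff x0 \<mu> (- (p + z)))"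
proof -
  let ?c = "green_coeff x0 \<mu>"
  have "character z x * (green_poly x0 \<mu> F x)\<^sup>2 = (\<Sum>p\<in>F. \<Sum>r\<in>F. (?c p * ?c r) * character (z + p + r) x)" for x
    unfolding power2_eq_square green_poly_def sum_product unfolding sum_distrib_left
    by (intro sum.cong refl) (simp add: character_add mult_ac)
  then have "torus_integral a (\<lambda>x. character z x * (green_poly x0 \<mu> F x)\<^sup>2)
     = (\<Sum>p\<in>F. \<Sum>r\<in>F. (?c p * ?c r) * (if z + p + r = 0 then 4 * of_real pi ^ 2 else 0))"
    by (simp only:) (rule torus_integral_double_sum[OF F])
  also have "\<dots> = (\<Sum>p\<in>F. if - (p + z) \<in> F then 4 * of_real pi ^ 2 * (?c p * ?c (- (p + z))) else 0)"
  proof (intro sum.cong refl)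
    fix p
    have eq: "z + p + r = 0 \<longleftrightarrow> r = - (p + z)" for r
      by (metis add.commute add_eq_0_iff)
    have "(\<Sum>r\<in>F. (?c p * ?c r) * (if z + p + r = 0 then 4 * of_real pi ^ 2 else 0))
        = (\<Sum>r\<in>F. if r = - (p + z) then 4 * of_real pi ^ 2 * (?c p * ?c (- (p + z))) else 0)"
      unfolding eq by (intro sum.cong) auto
    then show "(\<Sum>r\<in>F. (?c p * ?c r) * (if z + p + r = 0 then 4 * of_real pi ^ 2 else 0))
        = (if - (p + z) \<in> F then 4 * of_real pi ^ 2 * (?c p * ?c (- (p + z))) else 0)"
      using F by (simp only: sum.delta)
  qed
  also have "\<dots> = 4 * of_real pi ^ 2 * (\<Sum>p\<in>{p\<in>F. - (p + z) \<in> F}. ?c p * ?c (- (p + z)))"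
    using F by (simp only: sum.inter_filter[symmetric] sum_distrib_left)
  finally show ?thesis .
qed

lemma set_integrable_torus_dominated:
  fixes f :: "real \<times> real \<Rightarrow> 'b::{banach, second_countable_topology}"
  assumes "f \<in> borel_measurable borel" "torus_integrable h" "\<And>x. norm (f x) \<le> (h x :: real)"
  shows "torus_integrable f"
proof (rule set_integrable_bound[OF assms(2)])
  show "set_borel_measurable lborel (torus_dom a) f"
    unfolding set_borel_measurable_def using assms(1) by measurable
  show "AE x in lborel. x \<in> torus_dom a \<longrightarrow> norm (f x) \<le> norm (h x)"
    using order_trans[OF assms(3) abs_ge_self] by (intro always_eventually allI) simp
qed

lemma norm_torus_integral_le:
  fixes f :: "real \<times> real \<Rightarrow> 'b::{banach, second_countable_topology}"
  assumes "f \<in> borel_measurable borel" "torus_integrable h" "\<And>x. norm (f x) \<le> (h x :: real)"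
  shows "norm (torus_integral a f) \<le> torus_integral a h"
proof -
  have f: "torus_integrable f" by (rule set_integrable_torus_dominated[OF assms])
  have "norm (torus_integral a f) \<le> torus_integral a (\<lambda>x. norm (f x))"
    unfolding torus_integral_def using f by (rule set_integral_norm_bound)
  also have "\<dots> \<le> torus_integral a h"
    unfolding torus_integral_def using f assms by (intro set_integral_mono set_integrable_norm) auto
  finally show ?thesis .
qed

text \<open>The weighted inequality \<open>2 |G| |P - G| \<le> |P - G|\<^sup>2 / t + t |G|\<^sup>2\<close>, integrated.\<close>

lemma norm_torus_integral_diff_le:
  fixes f g :: "real \<times> real \<Rightarrow> 'b::{banach, second_countable_topology}" and P G :: "real \<times> real \<Rightarrow> complex"
  assumes f: "torus_integrable f" "f \<in> borel_measurable borel"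
    and g: "torus_integrable g" "g \<in> borel_measurable borel"
    and d: "torus_integrable (\<lambda>x. (norm (P x - G x))\<^sup>2)"
    and G: "torus_integrable (\<lambda>x. (norm (G x))\<^sup>2)"
    and le: "\<And>x. norm (f x - g x) \<le> (norm (P x - G x))\<^sup>2 + 2 * norm (G x) * norm (P x - G x)"
    and t: "t > 0"
  shows "norm (torus_integral a f - torus_integral a g)
    \<le> (1 + 1 / t) * torus_integral a (\<lambda>x. (norm (P x - G x))\<^sup>2) + t * torus_mass G"
proof -
  let ?h = "\<lambda>x. (1 + 1 / t) * (norm (P x - G x))\<^sup>2 + t * (norm (G x))\<^sup>2"
  have "torus_integral a f - torus_integral a g = torus_integral a (\<lambda>x. f x - g x)"
    unfolding torus_integral_def using f g by simp
  also have "norm \<dots> \<le> torus_integral a ?h"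
  proof (rule norm_torus_integral_le)
    show "(\<lambda>x. f x - g x) \<in> borel_measurable borel" using f g by measurable
    show "torus_integrable ?h" using d G by auto
    fix x
    define u v where "u = norm (P x - G x)" and "v = norm (G x)"
    have "2 * (u / sqrt t) * (sqrt t * v) \<le> (u / sqrt t)\<^sup>2 + (sqrt t * v)\<^sup>2" by (rule sum_squares_bound)
    then have "2 * v * u \<le> u\<^sup>2 / t + t * v\<^sup>2" using t by (simp add: power_mult_distrib power_divide mult_ac)
    then have "u\<^sup>2 + 2 * v * u \<le> (1 + 1 / t) * u\<^sup>2 + t * v\<^sup>2" by (simp add: distrib_right)
    then show "norm (f x - g x) \<le> ?h x" using le[of x] by (simp add: u_def v_def)
  qed
  also have "\<dots> = (1 + 1 / t) * torus_integral a (\<lambda>x. (norm (P x - G x))\<^sup>2) + t * torus_mass G"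
    unfolding torus_integral_def using d G by simp
  finally show ?thesis .
qed

context
  fixes x0 :: "real \<times> real" and \<mu> :: real and G :: "real \<times> real \<Rightarrow> complex"
  assumes green: "is_green a x0 \<mu> G" and \<mu>: "\<mu> \<notin> range q"
begin

lemma green_measurable [measurable]: "G \<in> borel_measurable borel"
  using green by (simp add: is_green_def)

lemma green_sq_integrable: "torus_integrable (\<lambda>x. (norm (G x))\<^sup>2)"
  using green by (simp add: is_green_def)

lemma green_poly_error_integrable:
  "torus_integrable (\<lambda>x. (norm (green_poly x0 \<mu> F x - G x))\<^sup>2)"
proof -
  let ?B = "\<Sum>p\<in>F. norm (green_coeff x0 \<mu> p)"
  have 1: "torus_integrable (\<lambda>x. 2 * ?B\<^sup>2 + 2 * (norm (G x))\<^sup>2)"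
    using green_sq_integrable by (intro set_integral_add set_integrable_mult_right set_integrable_torus_bounded[of "\<lambda>_. 2 * ?B\<^sup>2" "\<bar>2 * ?B\<^sup>2\<bar>"]) auto
  show ?thesis
  proof (rule set_integrable_torus_dominated[OF _ 1])
    fix x
    have "norm (green_poly x0 \<mu> F x - G x) \<le> ?B + norm (G x)"
      using norm_triangle_ineq4[of "green_poly x0 \<mu> F x" "G x"] norm_green_poly_le[of x0 \<mu> F x] by linarith
    then have "(norm (green_poly x0 \<mu> F x - G x))\<^sup>2 \<le> (?B + norm (G x))\<^sup>2" by (intro power_mono) auto
    also have "\<dots> \<le> 2 * ?B\<^sup>2 + 2 * (norm (G x))\<^sup>2"
      using sum_squares_bound[of ?B "norm (G x)"] by (simp add: power2_sum)
    finally show "norm ((norm (green_poly x0 \<mu> F x - G x))\<^sup>2) \<le> 2 * ?B\<^sup>2 + 2 * (norm (G x))\<^sup>2" by simp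
  qed measurable
qed

lemma green_poly_L2_tendsto:
  "((\<lambda>F. torus_integral a (\<lambda>x. (norm (green_poly x0 \<mu> F x - G x))\<^sup>2)) \<longlongrightarrow> 0) (finite_subsets_at_top UNIV)"
proof -
  have "((\<lambda>F. torus_integral a (\<lambda>x. (norm (green_partial_sum x0 \<mu> F x - G x))\<^sup>2)) \<longlongrightarrow> 0)
       (filtermap ((`) lattice_point) (finite_subsets_at_top UNIV))"
    using green filtermap_image_finite_subsets_at_top[OF inj_lattice_point] by (simp add: is_green_def dual_lattice_eq)
  then show ?thesis by (simp add: filterlim_filtermap green_partial_sum_eq)
qed

lemma green_sq_mult_integrable:
  fixes v :: "real \<times> real \<Rightarrow> complex"
  assumes [measurable]: "v \<in> borel_measurable borel" and B: "\<And>x. norm (v x) \<le> B"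
  shows "torus_integrable (\<lambda>x. v x * (G x)\<^sup>2)"
    and "norm (torus_integral a (\<lambda>x. v x * (G x)\<^sup>2)) \<le> B * torus_mass G"
proof -
  have int: "torus_integrable (\<lambda>x. B * (norm (G x))\<^sup>2)" using green_sq_integrable by simp
  have le: "norm (v x * (G x)\<^sup>2) \<le> B * (norm (G x))\<^sup>2" for x
    unfolding norm_mult norm_power using B[of x] by (intro mult_right_mono) auto
  show "torus_integrable (\<lambda>x. v x * (G x)\<^sup>2)"
    by (rule set_integrable_torus_dominated[OF _ int le]) measurable
  have "norm (torus_integral a (\<lambda>x. v x * (G x)\<^sup>2)) \<le> torus_integral a (\<lambda>x. B * (norm (G x))\<^sup>2)"
    by (rule norm_torus_integral_le[OF _ int le]) measurable
  then show "norm (torus_integral a (\<lambda>x. v x * (G x)\<^sup>2)) \<le> B * torus_mass G"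
    by (simp add: torus_integral_def)
qed

lemma tendsto_torus_integral_green_poly_sq:
  assumes [measurable]: "v \<in> borel_measurable borel" and v: "\<And>x. norm (v x) \<le> (1 :: real)"
  shows "((\<lambda>F. torus_integral a (\<lambda>x. v x * (green_poly x0 \<mu> F x)\<^sup>2)) \<longlongrightarrow> torus_integral a (\<lambda>x. v x * (G x)\<^sup>2))
     (finite_subsets_at_top UNIV)"
proof (rule tendsto_of_quadratic_error[OF green_poly_L2_tendsto])
  show "0 \<le> torus_mass G" by (rule torus_mass_nonneg)
  fix F and t :: real assume t: "t > 0"
  show "norm (torus_integral a (\<lambda>x. v x * (green_poly x0 \<mu> F x)\<^sup>2) - torus_integral a (\<lambda>x. v x * (G x)\<^sup>2))
     \<le> (1 + 1 / t) * torus_integral a (\<lambda>x. (norm (green_poly x0 \<mu> F x - G x))\<^sup>2) + t * torus_mass G"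
  proof (rule norm_torus_integral_diff_le[OF _ _ _ _ green_poly_error_integrable green_sq_integrable _ t])
    show "torus_integrable (\<lambda>x. v x * (green_poly x0 \<mu> F x)\<^sup>2)"
    proof (rule set_integrable_torus_bounded)
      fix x
      have "norm (v x * (green_poly x0 \<mu> F x)\<^sup>2) \<le> 1 * (\<Sum>p\<in>F. norm (green_coeff x0 \<mu> p))\<^sup>2"
        unfolding norm_mult norm_power using v norm_green_poly_le by (intro mult_mono power_mono) auto
      then show "norm (v x * (green_poly x0 \<mu> F x)\<^sup>2) \<le> (\<Sum>p\<in>F. norm (green_coeff x0 \<mu> p))\<^sup>2" by simp
    qed measurable
    show "torus_integrable (\<lambda>x. v x * (G x)\<^sup>2)" by (rule green_sq_mult_integrable(1)[OF assms])
    fix x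
    let ?d = "green_poly x0 \<mu> F x - G x"
    have "v x * (green_poly x0 \<mu> F x)\<^sup>2 - v x * (G x)\<^sup>2 = v x * (?d\<^sup>2 + 2 * G x * ?d)"
      by (simp add: power2_eq_square algebra_simps)
    then have "norm (v x * (green_poly x0 \<mu> F x)\<^sup>2 - v x * (G x)\<^sup>2) \<le> 1 * norm (?d\<^sup>2 + 2 * G x * ?d)"
      unfolding norm_mult using v[of x] by (simp add: mult_left_le_one_le norm_mult)
    also have "norm (?d\<^sup>2 + 2 * G x * ?d) \<le> norm (?d\<^sup>2) + norm (2 * G x * ?d)" by (rule norm_triangle_ineq)
    finally show "norm (v x * (green_poly x0 \<mu> F x)\<^sup>2 - v x * (G x)\<^sup>2) \<le> (norm ?d)\<^sup>2 + 2 * norm (G x) * norm ?d"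
      by (simp add: norm_mult norm_power)
  qed measurable
qed

lemma tendsto_torus_integral_green_poly_norm:
  "((\<lambda>F. torus_mass (green_poly x0 \<mu> F)) \<longlongrightarrow> torus_mass G)
     (finite_subsets_at_top UNIV)"
proof (rule tendsto_of_quadratic_error[OF green_poly_L2_tendsto])
  show "0 \<le> torus_mass G" by (rule torus_mass_nonneg)
  fix F and t :: real assume t: "t > 0"
  show "norm (torus_mass (green_poly x0 \<mu> F) - torus_mass G)
     \<le> (1 + 1 / t) * torus_integral a (\<lambda>x. (norm (green_poly x0 \<mu> F x - G x))\<^sup>2) + t * torus_mass G"
  proof (rule norm_torus_integral_diff_le[OF _ _ green_sq_integrable _ green_poly_error_integrable green_sq_integrable _ t])
    show "torus_integrable (\<lambda>x. (norm (green_poly x0 \<mu> F x))\<^sup>2)"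
    proof (rule set_integrable_torus_bounded)
      show "norm ((norm (green_poly x0 \<mu> F x))\<^sup>2) \<le> (\<Sum>p\<in>F. norm (green_coeff x0 \<mu> p))\<^sup>2" for x
        using norm_green_poly_le[of x0 \<mu> F x] by (simp add: power_mono)
    qed measurable
    fix x
    let ?u = "norm (green_poly x0 \<mu> F x)" and ?v = "norm (G x)" and ?d = "norm (green_poly x0 \<mu> F x - G x)"
    have uv: "\<bar>?u - ?v\<bar> \<le> ?d" by (rule norm_triangle_ineq3)
    have "\<bar>?u\<^sup>2 - ?v\<^sup>2\<bar> = \<bar>?u - ?v\<bar> * (?u + ?v)"
      by (simp add: power2_eq_square square_diff_square_factored abs_mult mult.commute)
    also have "\<dots> \<le> ?d * (?d + 2 * ?v)" using uv by (intro mult_mono) auto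
    finally show "norm (?u\<^sup>2 - ?v\<^sup>2) \<le> ?d\<^sup>2 + 2 * ?v * ?d" by (simp add: power2_eq_square algebra_simps)
  qed measurable
qed

lemma torus_integral_green_norm_sq:
  "torus_mass G = 1 / (4 * pi\<^sup>2) * green_energy \<mu>"
proof (rule tendsto_unique[OF _ tendsto_torus_integral_green_poly_norm])
  have "((\<lambda>p. 1 / (q p - \<mu>)\<^sup>2) has_sum green_energy \<mu>) UNIV"
    unfolding green_energy_def by (rule has_sum_infsum[OF summable_on_inverse_shift_sq[OF \<mu>]])
  then have "((\<lambda>F. 1 / (4 * pi\<^sup>2) * (\<Sum>p\<in>F. 1 / (q p - \<mu>)\<^sup>2)) \<longlongrightarrow> 1 / (4 * pi\<^sup>2) * green_energy \<mu>) (finite_subsets_at_top UNIV)"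
    unfolding has_sum_def by (intro tendsto_intros)
  then show "((\<lambda>F. torus_mass (green_poly x0 \<mu> F)) \<longlongrightarrow> 1 / (4 * pi\<^sup>2) * green_energy \<mu>) (finite_subsets_at_top UNIV)"
    by (rule Lim_transform_eventually) (auto intro!: eventually_finite_subsets_at_top_weakI simp: torus_integral_green_poly_norm)
qed simp

lemma torus_integral_green_norm_sq_pos: "0 < torus_mass G"
proof -
  \<comment> \<open>a single frequency already contributes a positive amount\<close>
  have "0 < 1 / (next_norm \<mu> - \<mu>)\<^sup>2" using next_norm(2)[of \<mu>] by simp
  also have "\<dots> \<le> green_energy \<mu>" by (rule green_energy_ge[OF \<mu>])
  finally show ?thesis unfolding torus_integral_green_norm_sq by simp
qed

lemma norm_torus_integral_character_green_sq_le:
  assumes "\<And>F. finite F \<Longrightarrow> (\<Sum>p\<in>F. 1 / (\<bar>q p - \<mu>\<bar> * \<bar>q (p + z) - \<mu>\<bar>)) \<le> \<kappa>"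
  shows "norm (torus_integral a (\<lambda>x. character z x * (G x)\<^sup>2)) \<le> 1 / (4 * pi\<^sup>2) * \<kappa>"
proof (rule tendsto_upperbound)
  show "((\<lambda>F. norm (torus_integral a (\<lambda>x. character z x * (green_poly x0 \<mu> F x)\<^sup>2)))
      \<longlongrightarrow> norm (torus_integral a (\<lambda>x. character z x * (G x)\<^sup>2))) (finite_subsets_at_top UNIV)"
    by (intro tendsto_norm tendsto_torus_integral_green_poly_sq) auto
  show "\<forall>\<^sub>F F in finite_subsets_at_top UNIV. norm (torus_integral a (\<lambda>x. character z x * (green_poly x0 \<mu> F x)\<^sup>2)) \<le> 1 / (4 * pi\<^sup>2) * \<kappa>"
  proof (rule eventually_finite_subsets_at_top_weakI)
    fix F :: "(int \<times> int) set" assume F: "finite F"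
    let ?F = "{p\<in>F. - (p + z) \<in> F}" and ?c = "green_coeff x0 \<mu>"
    have "norm (torus_integral a (\<lambda>x. character z x * (green_poly x0 \<mu> F x)\<^sup>2))
        = 4 * pi\<^sup>2 * norm (\<Sum>p\<in>?F. ?c p * ?c (- (p + z)))"
      by (simp add: torus_integral_character_green_poly_sq[OF F] norm_mult norm_power)
    also have "\<dots> \<le> 4 * pi\<^sup>2 * (\<Sum>p\<in>?F. norm (?c p * ?c (- (p + z))))"
      by (intro mult_left_mono norm_sum) simp
    also have "(\<Sum>p\<in>?F. norm (?c p * ?c (- (p + z)))) = (\<Sum>p\<in>?F. 1 / (4 * pi\<^sup>2)\<^sup>2 * (1 / (\<bar>q p - \<mu>\<bar> * \<bar>q (p + z) - \<mu>\<bar>)))"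
      unfolding norm_mult norm_green_coeff q_uminus by (simp add: power2_eq_square mult_ac)
    also have "4 * pi\<^sup>2 * \<dots> = 1 / (4 * pi\<^sup>2) * (\<Sum>p\<in>?F. 1 / (\<bar>q p - \<mu>\<bar> * \<bar>q (p + z) - \<mu>\<bar>))"
      unfolding sum_distrib_left[symmetric] by (simp add: power2_eq_square)
    also have "\<dots> \<le> 1 / (4 * pi\<^sup>2) * \<kappa>" using F by (intro mult_left_mono assms) auto
    finally show "norm (torus_integral a (\<lambda>x. character z x * (green_poly x0 \<mu> F x)\<^sup>2)) \<le> 1 / (4 * pi\<^sup>2) * \<kappa>" .
  qed
qed simp

text \<open>This expresses that the Green's function is real. Along finite sets of frequencies that are symmetric
  under reflection, the integral of the square and of the absolute square of the partial sum agree, since the coefficients of \<open>p\<close>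
  and \<open>-p\<close> are conjugate; and symmetric sets are cofinal.\<close>

lemma torus_integral_green_sq: "torus_integral a (\<lambda>x. (G x)\<^sup>2) = of_real (torus_mass G)"
proof (rule tendsto_unique)
  let ?S = "\<lambda>F :: (int \<times> int) set. F \<union> uminus ` F"
  have S: "filterlim ?S (finite_subsets_at_top UNIV) (finite_subsets_at_top UNIV)"
    unfolding filterlim_finite_subsets_at_top
    by (auto simp: eventually_finite_subsets_at_top)
  show "((\<lambda>F. torus_integral a (\<lambda>x. 1 * (green_poly x0 \<mu> (?S F) x)\<^sup>2)) \<longlongrightarrow> torus_integral a (\<lambda>x. (G x)\<^sup>2)) (finite_subsets_at_top UNIV)"
    using filterlim_compose[OF tendsto_torus_integral_green_poly_sq[of "\<lambda>_. 1"] S] by simp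
  have "((\<lambda>F. of_real (torus_mass (green_poly x0 \<mu> (?S F))) :: complex)
      \<longlongrightarrow> of_real (torus_mass G)) (finite_subsets_at_top UNIV)"
    by (intro tendsto_of_real filterlim_compose[OF tendsto_torus_integral_green_poly_norm S])
  then show "((\<lambda>F. torus_integral a (\<lambda>x. 1 * (green_poly x0 \<mu> (?S F) x)\<^sup>2)) \<longlongrightarrow> of_real (torus_mass G)) (finite_subsets_at_top UNIV)"
  proof (rule Lim_transform_eventually, intro eventually_finite_subsets_at_top_weakI)
    fix F :: "(int \<times> int) set" assume F: "finite F"
    let ?c = "green_coeff x0 \<mu>"
    have fin: "finite (?S F)" using F by simp
    have "torus_integral a (\<lambda>x. 1 * (green_poly x0 \<mu> (?S F) x)\<^sup>2) = 4 * of_real pi ^ 2 * (\<Sum>p\<in>{p\<in>?S F. - (p + 0) \<in> ?S F}. ?c p * ?c (- (p + 0)))"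
      using torus_integral_character_green_poly_sq[OF fin, of 0 x0 \<mu>] by simp
    also have "{p\<in>?S F. - (p + 0) \<in> ?S F} = ?S F" by (auto simp: image_iff)
    also have "(\<Sum>p\<in>?S F. ?c p * ?c (- (p + 0))) = (\<Sum>p\<in>?S F. of_real (1 / (4 * pi\<^sup>2)\<^sup>2 * (1 / (q p - \<mu>)\<^sup>2)))"
    proof (intro sum.cong refl)
      fix p
      have "character (- p) x0 * character p x0 = 1" using character_add[of "-p" p x0] by simp
      then have "?c p * ?c (- p) = (1 / (4 * of_real pi ^ 2))\<^sup>2 * (1 / of_real (q p - \<mu>))\<^sup>2 * 1"
        by (simp only: green_coeff_def q_uminus minus_minus) (simp add: power2_eq_square field_simps)
      then show "?c p * ?c (- (p + 0)) = of_real (1 / (4 * pi\<^sup>2)\<^sup>2 * (1 / (q p - \<mu>)\<^sup>2))"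
        by (simp add: power_divide)
    qed
    also have "4 * of_real pi ^ 2 * \<dots> = of_real (4 * pi\<^sup>2 * (\<Sum>p\<in>?S F. 1 / (4 * pi\<^sup>2)\<^sup>2 * (1 / (q p - \<mu>)\<^sup>2)))"
      by (simp only: of_real_sum of_real_mult of_real_power of_real_numeral)
    also have "4 * pi\<^sup>2 * (\<Sum>p\<in>?S F. 1 / (4 * pi\<^sup>2)\<^sup>2 * (1 / (q p - \<mu>)\<^sup>2)) = 1 / (4 * pi\<^sup>2) * (\<Sum>p\<in>?S F. 1 / (q p - \<mu>)\<^sup>2)"
      unfolding sum_distrib_left[symmetric] by (simp add: power2_eq_square)
    also have "\<dots> = torus_mass (green_poly x0 \<mu> (?S F))"
      by (rule torus_integral_green_poly_norm[OF fin, symmetric])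
    finally show "of_real (torus_mass (green_poly x0 \<mu> (?S F))) = torus_integral a (\<lambda>x. 1 * (green_poly x0 \<mu> (?S F) x)\<^sup>2)" ..
  qed
qed simp

lemma torus_integral_L2_normalize_sq:
  "torus_integral a (\<lambda>x. f x * (L2_normalize a G x)\<^sup>2)
     = torus_integral a (\<lambda>x. f x * (G x)\<^sup>2) / of_real (torus_mass G)"
proof -
  let ?E = "torus_mass G"
  have "(L2_normalize a G x)\<^sup>2 = (1 / of_real ?E) * (G x)\<^sup>2" for x
    unfolding L2_normalize_def torus_L2_norm_def power_divide
    using torus_integral_green_norm_sq_pos by (simp flip: of_real_power)
  then have "torus_integral a (\<lambda>x. f x * (L2_normalize a G x)\<^sup>2) = torus_integral a (\<lambda>x. (1 / of_real ?E) * (f x * (G x)\<^sup>2))"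
    by (simp only: mult.left_commute)
  also have "\<dots> = (1 / of_real ?E) * torus_integral a (\<lambda>x. f x * (G x)\<^sup>2)" by (rule torus_integral_cmult)
  finally show ?thesis by simp
qed

lemma norm_torus_integral_L2_normalize_sq_le:
  assumes [measurable]: "f \<in> borel_measurable borel" and B: "\<And>x. norm (f x) \<le> B"
  shows "norm (torus_integral a (\<lambda>x. f x * (L2_normalize a G x)\<^sup>2)) \<le> B"
  using green_sq_mult_integrable(2)[OF assms] torus_integral_green_norm_sq_pos
  by (simp add: torus_integral_L2_normalize_sq norm_divide divide_le_eq)

lemma set_integrable_L2_normalize_sq:
  assumes [measurable]: "f \<in> borel_measurable borel" and B: "\<And>x. norm (f x) \<le> B"
  shows "torus_integrable (\<lambda>x. f x * (L2_normalize a G x)\<^sup>2)"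
proof -
  have "torus_integrable (\<lambda>x. f x * (G x)\<^sup>2)" by (rule green_sq_mult_integrable(1)[OF assms])
  then have "torus_integrable (\<lambda>x. 1 / (of_real (torus_L2_norm a G))\<^sup>2 * (f x * (G x)\<^sup>2))"
    by (intro set_integrable_mult_right)
  then show ?thesis by (simp add: L2_normalize_def power_divide)
qed

end

end

section \<open>Trigonometric polynomials and equidistribution\<close>

context rect_torus begin

text \<open>An inductive definition, so that statements linear in the function follow by induction, without
  manipulating finite sums.\<close>

inductive trig_poly :: "(real \<times> real \<Rightarrow> complex) \<Rightarrow> bool" where
  trig_poly_character: "trig_poly (character z)"
| trig_poly_scale: "trig_poly f \<Longrightarrow> trig_poly (\<lambda>x. c * f x)"
| trig_poly_add: "trig_poly f \<Longrightarrow> trig_poly g \<Longrightarrow> trig_poly (\<lambda>x. f x + g x)"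

lemma trig_poly_mult:
  assumes "trig_poly f" "trig_poly g"
  shows "trig_poly (\<lambda>x. f x * g x)"
  using assms(1)
proof induction
  case (trig_poly_character z)
  show ?case using assms(2)
  proof induction
    case (trig_poly_character w)
    have "(\<lambda>x. character z x * character w x) = character (z + w)" by (simp add: fun_eq_iff character_add)
    then show ?case by (simp add: trig_poly.trig_poly_character)
  next
    case (trig_poly_scale f c)
    then show ?case using trig_poly.trig_poly_scale[of "\<lambda>x. character z x * f x" c] by (simp add: mult_ac)
  next
    case (trig_poly_add f g)
    then show ?case using trig_poly.trig_poly_add by (fastforce simp: distrib_left)
  qed
next
  case (trig_poly_scale f c)
  then show ?case using trig_poly.trig_poly_scale[of "\<lambda>x. f x * g x" c] by (simp add: mult_ac)
next
  case (trig_poly_add f h)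
  then show ?case using trig_poly.trig_poly_add[of "\<lambda>x. f x * g x" "\<lambda>x. h x * g x"] by (simp add: distrib_right)
qed

lemma trig_poly_const: "trig_poly (\<lambda>x. c)"
  using trig_poly_scale[OF trig_poly_character[of 0], of c] by simp

lemma trig_poly_bounded: "trig_poly f \<Longrightarrow> f \<in> borel_measurable borel \<and> (\<exists>B. \<forall>x. norm (f x) \<le> B)"
proof (induction rule: trig_poly.induct)
  case (trig_poly_character z)
  then show ?case by (auto intro: exI[of _ 1])
next
  case (trig_poly_scale f c)
  then obtain B where "\<And>x. norm (f x) \<le> B" by auto
  then have "norm (c * f x) \<le> norm c * B" for x by (simp add: norm_mult mult_left_mono)
  then show ?case using trig_poly_scale by auto
next
  case (trig_poly_add f g)
  then obtain B C where "\<And>x. norm (f x) \<le> B" "\<And>x. norm (g x) \<le> C" by auto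
  then have "norm (f x + g x) \<le> B + C" for x by (intro norm_triangle_mono)
  then show ?case using trig_poly_add by auto
qed

text \<open>The two generating characters embed the torus into \<open>\<complex>\<^sup>2\<close> as a compact set, where the Stone--Weierstrass theorem
  is available. Real polynomials on \<open>\<complex>\<^sup>2\<close> pull back to trigonometric polynomials.\<close>

definition torus_embedding :: "real \<times> real \<Rightarrow> complex \<times> complex" where
  "torus_embedding x = (character (1, 0) x, character (0, 1) x)"

lemma trig_poly_real_polynomial:
  "real_polynomial_function p \<Longrightarrow> trig_poly (\<lambda>x. of_real (p (torus_embedding x)))"
proof (induction rule: real_polynomial_function.induct)
  case (linear h)
  interpret h: bounded_linear h by fact
  have Re: "trig_poly (\<lambda>x. of_real (Re (character z x)))" for z
  proof -
    have "(\<lambda>x. of_real (Re (character z x))) = (\<lambda>x. (1/2) * (character z x + character (-z) x))"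
      by (simp add: fun_eq_iff cnj_character[symmetric] complex_add_cnj)
    then show ?thesis by (simp only:) (intro trig_poly.intros)
  qed
  have Im: "trig_poly (\<lambda>x. of_real (Im (character z x)))" for z
  proof -
    have "(\<lambda>x. of_real (Im (character z x))) = (\<lambda>x. (- \<i> / 2) * (character z x + (- 1) * character (-z) x))"
      by (simp add: fun_eq_iff cnj_character[symmetric] complex_eq_iff)
    then show ?thesis by (simp only:) (intro trig_poly.intros)
  qed
  have h: "h (u, v) = Re u * h (1, 0) + Im u * h (\<i>, 0) + Re v * h (0, 1) + Im v * h (0, \<i>)" for u v
  proof -
    have "(u, v) = Re u *\<^sub>R (1, 0) + Im u *\<^sub>R (\<i>, 0) + Re v *\<^sub>R (0, 1) + Im v *\<^sub>R (0, \<i>)"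
      by (simp add: complex_eq_iff)
    then have "h (u, v) = h (Re u *\<^sub>R (1, 0) + Im u *\<^sub>R (\<i>, 0) + Re v *\<^sub>R (0, 1) + Im v *\<^sub>R (0, \<i>))" by simp
    then show ?thesis by (simp only: h.add h.scaleR real_scaleR_def)
  qed
  have "(\<lambda>x. of_real (h (torus_embedding x))) = (\<lambda>x. of_real (h (1, 0)) * of_real (Re (character (1, 0) x)) + of_real (h (\<i>, 0)) * of_real (Im (character (1, 0) x))
      + of_real (h (0, 1)) * of_real (Re (character (0, 1) x)) + of_real (h (0, \<i>)) * of_real (Im (character (0, 1) x)) :: complex)"
  proof
    fix x
    show "of_real (h (torus_embedding x)) = of_real (h (1, 0)) * of_real (Re (character (1, 0) x)) + of_real (h (\<i>, 0)) * of_real (Im (character (1, 0) x))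
      + of_real (h (0, 1)) * of_real (Re (character (0, 1) x)) + of_real (h (0, \<i>)) * (of_real (Im (character (0, 1) x)) :: complex)"
      unfolding torus_embedding_def h[of "character (1, 0) x" "character (0, 1) x"]
      by (simp only: of_real_add of_real_mult mult.commute)
  qed
  moreover have "trig_poly \<dots>"
    by (intro trig_poly_add trig_poly_scale Re Im)
  ultimately show ?case by simp
next
  case (const c)
  show ?case by (rule trig_poly_const)
next
  case (add f g)
  then show ?case by (simp add: trig_poly_add)
next
  case (mult f g)
  then show ?case by (simp add: trig_poly_mult)
qed

lemma trig_poly_polynomial:
  assumes "polynomial_function (g :: complex \<times> complex \<Rightarrow> complex)"
  shows "trig_poly (\<lambda>x. g (torus_embedding x))"
proof -
  have "real_polynomial_function (Re \<circ> g)" "real_polynomial_function (Im \<circ> g)"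
    using assms bounded_linear_Re bounded_linear_Im unfolding polynomial_function_def by blast+
  then have "trig_poly (\<lambda>x. of_real ((Re \<circ> g) (torus_embedding x)) + \<i> * of_real ((Im \<circ> g) (torus_embedding x)))"
    by (intro trig_poly_add trig_poly_scale trig_poly_real_polynomial)
  then show ?thesis by (simp add: complex_eq[symmetric])
qed

lemma torus_embedding_eq_imp_eq:
  assumes f: "torus_periodic a f" and eq: "torus_embedding x = torus_embedding y"
  shows "f x = f y"
proof -
  have "exp (\<i> * of_real (a * fst x)) = exp (\<i> * of_real (a * fst y))"
    "exp (\<i> * of_real (snd x / a)) = exp (\<i> * of_real (snd y / a))"
    using eq by (simp_all add: torus_embedding_def character_def lattice_point_def inner_prod_def)
  then obtain m n :: int where
    "\<i> * of_real (a * fst x) = \<i> * of_real (a * fst y) + (of_int (2 * m) * pi) * \<i>"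
    "\<i> * of_real (snd x / a) = \<i> * of_real (snd y / a) + (of_int (2 * n) * pi) * \<i>"
    unfolding exp_eq by blast
  then have "a * fst x = a * fst y + 2 * pi * of_int m" "snd x / a = snd y / a + 2 * pi * of_int n"
    by (simp_all add: complex_eq_iff)
  then have "fst x = fst y + 2 * pi * (of_int m / a)" "snd x = snd y + 2 * pi * (of_int n * a)"
    using a_pos by (simp_all add: field_simps)
  then have "x = y + (2 * pi * (of_int m / a), 2 * pi * (of_int n * a))" by (simp add: prod_eq_iff)
  moreover have "(2 * pi * (of_int m / a), 2 * pi * (of_int n * a)) \<in> period_lattice a"
    unfolding period_lattice_def by blast
  then have "f (y + (2 * pi * (of_int m / a), 2 * pi * (of_int n * a))) = f y"
    using f unfolding torus_periodic_def by blast
  ultimately show ?thesis by (simp only:)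
qed

lemma torus_embedding_rectangle: "torus_embedding ` cbox (0, 0) (2 * pi / a, 2 * pi * a) = range torus_embedding"
proof (intro subset_antisym subsetI)
  fix u assume "u \<in> range torus_embedding"
  then obtain x where u: "u = torus_embedding x" by auto
  define m where "m = \<lfloor>fst x / (2 * pi / a)\<rfloor>"
  define n where "n = \<lfloor>snd x / (2 * pi * a)\<rfloor>"
  define y where "y = (fst x - 2 * pi / a * of_int m, snd x - 2 * pi * a * of_int n)"
  have reduce: "0 \<le> t - d * of_int \<lfloor>t / d\<rfloor>" "t - d * of_int \<lfloor>t / d\<rfloor> \<le> d" if "d > 0" for t d :: real
    using floor_divide_lower[OF that, of t] floor_divide_upper[OF that, of t] by (simp_all add: algebra_simps)
  have "y \<in> cbox (0, 0) (2 * pi / a, 2 * pi * a)"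
    using reduce[of "2 * pi / a" "fst x"] reduce[of "2 * pi * a" "snd x"] a_pos
    unfolding y_def m_def n_def cbox_Pair_eq by simp
  moreover have "torus_embedding y = torus_embedding x"
  proof -
    have "exp (\<i> * of_real (a * fst y)) = exp (\<i> * of_real (a * fst x))"
      unfolding exp_eq by (rule exI[of _ "- m"]) (use a_pos in \<open>simp add: y_def complex_eq_iff field_simps\<close>)
    moreover have "exp (\<i> * of_real (snd y / a)) = exp (\<i> * of_real (snd x / a))"
      unfolding exp_eq by (rule exI[of _ "- n"]) (use a_pos in \<open>simp add: y_def complex_eq_iff field_simps\<close>)
    ultimately show ?thesis by (simp add: torus_embedding_def character_def lattice_point_def inner_prod_def)
  qed
  ultimately show "u \<in> torus_embedding ` cbox (0, 0) (2 * pi / a, 2 * pi * a)" using u by (metis imageI)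
qed auto

text \<open>A periodic function factors through the embedding. The factor is continuous because its graph is the
  image of the compact fundamental rectangle.\<close>

lemma trig_poly_dense:
  assumes cont: "continuous_on UNIV f" and per: "torus_periodic a f" and e: "e > 0"
  shows "\<exists>P. trig_poly P \<and> (\<forall>x. norm (f x - P x) \<le> (e :: real))"
proof -
  let ?R = "cbox (0, 0) (2 * pi / a, 2 * pi * a) :: (real \<times> real) set"
  define K where "K = range torus_embedding"
  define F where "F = (\<lambda>u. f (inv torus_embedding u))"
  have F: "F (torus_embedding x) = f x" for x
    unfolding F_def by (rule torus_embedding_eq_imp_eq[OF per]) (simp add: f_inv_into_f)
  have K: "K = torus_embedding ` ?R" unfolding K_def by (rule torus_embedding_rectangle[symmetric])
  have contE: "continuous_on ?R torus_embedding"
    unfolding torus_embedding_def by (intro continuous_intros continuous_on_character)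
  have contf: "continuous_on ?R f" using cont by (rule continuous_on_subset) simp
  have compK: "compact K" unfolding K by (intro compact_continuous_image contE compact_cbox)
  have contF: "continuous_on K F"
  proof (rule continuous_from_closed_graph)
    show "compact (f ` ?R)" by (intro compact_continuous_image contf compact_cbox)
    show "F \<in> K \<rightarrow> f ` ?R" unfolding K by (auto simp: F)
    have "(\<lambda>u. (u, F u)) ` K = (\<lambda>x. (torus_embedding x, f x)) ` ?R"
      unfolding K by (auto simp: F image_image)
    moreover have "compact ((\<lambda>x. (torus_embedding x, f x)) ` ?R)"
      by (intro compact_continuous_image continuous_on_Pair contE contf compact_cbox)
    ultimately show "closed ((\<lambda>u. (u, F u)) ` K)" by (simp add: compact_imp_closed)
  qed
  obtain g where g: "polynomial_function g" "\<And>u. u \<in> K \<Longrightarrow> norm (F u - g u) < e"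
    using Stone_Weierstrass_polynomial_function[OF compK contF e] by blast
  show ?thesis
  proof (intro exI[of _ "\<lambda>x. g (torus_embedding x)"] conjI allI)
    show "trig_poly (\<lambda>x. g (torus_embedding x))" by (rule trig_poly_polynomial[OF g(1)])
    show "norm (f x - g (torus_embedding x)) \<le> e" for x
      using g(2)[of "torus_embedding x"] by (simp add: F K_def less_imp_le)
  qed
qed

lemma density_one_complement:
  assumes "negligible_eigs y B"
  shows "density_one_subset (eigs y - B) (eigs y)"
  unfolding density_one_subset_def
proof (intro conjI)
  obtain c where c: "c > 0" "\<forall>\<^sub>F X in at_top. c * X powr (199/200) \<le> count_upto (eigs y) X"
    using card_eigs_lower by blast
  have B: "B \<subseteq> eigs y" using assms by (simp add: negligible_eigs_def)
  have "((\<lambda>X. 1 - count_upto B X / count_upto (eigs y) X) \<longlongrightarrow> 1 - 0) at_top"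
    using assms unfolding negligible_eigs_def by (intro tendsto_intros) auto
  moreover have "\<forall>\<^sub>F X in at_top. 1 - count_upto B X / count_upto (eigs y) X
      = count_upto (eigs y - B) X / count_upto (eigs y) X"
    using c(2) eventually_ge_at_top[of 1]
  proof eventually_elim
    case (elim X)
    have "0 < c * X powr (199/200)" using c elim by simp
    then have pos: "0 < count_upto (eigs y) X" using elim by linarith
    have fin: "finite {\<mu>\<in>eigs y. \<mu> \<le> X}" by (rule eigs_le_upper)
    have sub: "{\<mu>\<in>B. \<mu> \<le> X} \<subseteq> {\<mu>\<in>eigs y. \<mu> \<le> X}" using B by auto
    have "{\<mu>\<in>eigs y - B. \<mu> \<le> X} = {\<mu>\<in>eigs y. \<mu> \<le> X} - {\<mu>\<in>B. \<mu> \<le> X}" by auto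
    then have "count_upto (eigs y - B) X = count_upto (eigs y) X - count_upto B X"
      using card_Diff_subset[OF finite_subset[OF sub fin] sub] card_mono[OF fin sub] by (simp add: of_nat_diff)
    then show ?case using pos by (simp add: diff_divide_distrib)
  qed
  ultimately show "((\<lambda>X. count_upto (eigs y - B) X / count_upto (eigs y) X) \<longlongrightarrow> 1) at_top"
    by (simp add: tendsto_cong)
qed auto

definition equidistributed :: "real set \<Rightarrow> (real \<Rightarrow> real \<times> real \<Rightarrow> complex) \<Rightarrow> (real \<times> real \<Rightarrow> complex) \<Rightarrow> bool" where
  "equidistributed S G f \<longleftrightarrow> ((\<lambda>\<mu>. torus_integral a (\<lambda>x. f x * (L2_normalize a (G \<mu>) x)\<^sup>2))
     \<longlongrightarrow> (1 / of_real (torus_area a)) * torus_integral a f) (inf at_top (principal S))"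

context
  fixes x0 :: "real \<times> real" and y :: real and S :: "real set" and G :: "real \<Rightarrow> real \<times> real \<Rightarrow> complex"
  assumes S: "S \<subseteq> eigs y" and green: "\<And>\<mu>. \<mu> \<in> S \<Longrightarrow> is_green a x0 \<mu> (G \<mu>)"
    and decay: "\<And>z. z \<noteq> 0 \<Longrightarrow> \<exists>X. \<forall>\<mu>\<in>S. X < \<mu> \<longrightarrow> weakly_correlated \<mu> z"
begin

lemma not_in_spectrum: "\<mu> \<in> S \<Longrightarrow> \<mu> \<notin> range q"
  using S by (auto simp: eigs_def)

lemma eventually_in_S: "\<forall>\<^sub>F \<mu> in inf at_top (principal S). \<mu> \<in> S"
  by (simp add: eventually_inf_principal)

lemma equidistributed_character: "equidistributed S G (character z)"
proof (cases "z = 0")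
  case True
  have "(1 / of_real (torus_area a)) * torus_integral a (character z) = 1"
    using True by (simp add: torus_integral_character torus_area_eq)
  moreover have "\<forall>\<^sub>F \<mu> in inf at_top (principal S). 1 = torus_integral a (\<lambda>x. character z x * (L2_normalize a (G \<mu>) x)\<^sup>2)"
    using eventually_in_S
  proof eventually_elim
    case (elim \<mu>)
    note hyp = green[OF elim] not_in_spectrum[OF elim]
    show ?case
      using True torus_integral_green_norm_sq_pos[OF hyp]
      by (simp add: torus_integral_L2_normalize_sq[OF hyp] torus_integral_green_sq[OF hyp] torus_integral_L2_normalize_sq[OF hyp, of "\<lambda>_. 1", simplified])
  qed
  ultimately show ?thesis unfolding equidistributed_def
    by (simp only:) (rule tendsto_eventually, erule eventually_mono, simp)
next
  case False
  obtain X where X: "\<forall>\<mu>\<in>S. X < \<mu> \<longrightarrow> weakly_correlated \<mu> z"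
    using decay[OF False] ..
  have "((\<lambda>\<mu>. torus_integral a (\<lambda>x. character z x * (L2_normalize a (G \<mu>) x)\<^sup>2)) \<longlongrightarrow> 0) (inf at_top (principal S))"
  proof (rule Lim_null_comparison)
    have "\<forall>\<^sub>F \<mu> in at_top. X < \<mu>" by (rule eventually_gt_at_top)
    then have "\<forall>\<^sub>F \<mu> in inf at_top (principal S). X < \<mu>" by (rule filter_leD[OF inf_le1])
    then show "\<forall>\<^sub>F \<mu> in inf at_top (principal S). norm (torus_integral a (\<lambda>x. character z x * (L2_normalize a (G \<mu>) x)\<^sup>2)) \<le> 2 * \<mu> powr (-1/200)"
      using eventually_in_S
    proof eventually_elim
      case (elim \<mu>)
      note hyp = green[OF elim(2)] not_in_spectrum[OF elim(2)]
      let ?E = "torus_mass (G \<mu>)"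
      have "norm (torus_integral a (\<lambda>x. character z x * (G \<mu> x)\<^sup>2)) \<le> 1 / (4 * pi\<^sup>2) * (2 * \<mu> powr (-1/200) * green_energy \<mu>)"
        using X elim by (intro norm_torus_integral_character_green_sq_le[OF hyp]) blast
      also have "\<dots> = 2 * \<mu> powr (-1/200) * ?E"
        by (simp add: torus_integral_green_norm_sq[OF hyp])
      finally show ?case
        using torus_integral_green_norm_sq_pos[OF hyp]
        by (simp add: torus_integral_L2_normalize_sq[OF hyp] norm_divide divide_le_eq)
    qed
    have "((\<lambda>\<mu>::real. \<mu> powr (-1/200)) \<longlongrightarrow> 0) at_top" by (rule tendsto_neg_powr) (auto simp: filterlim_ident)
    then have "((\<lambda>\<mu>::real. 2 * \<mu> powr (-1/200)) \<longlongrightarrow> 0) at_top" by (rule tendsto_mult_right_zero)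
    then show "((\<lambda>\<mu>::real. 2 * \<mu> powr (-1/200)) \<longlongrightarrow> 0) (inf at_top (principal S))"
      by (rule tendsto_mono[OF inf_le1])
  qed
  then show ?thesis using False by (simp add: equidistributed_def torus_integral_character)
qed

lemma equidistributed_trig_poly: "trig_poly f \<Longrightarrow> equidistributed S G f"
proof (induction rule: trig_poly.induct)
  case (trig_poly_character z)
  show ?case by (rule equidistributed_character)
next
  case (trig_poly_scale f c)
  have "torus_integral a (\<lambda>x. c * f x * (L2_normalize a (G \<mu>) x)\<^sup>2) = c * torus_integral a (\<lambda>x. f x * (L2_normalize a (G \<mu>) x)\<^sup>2)" for \<mu>
    by (simp add: torus_integral_cmult[symmetric] mult.assoc)
  then show ?case using tendsto_mult_left[OF trig_poly_scale.IH[unfolded equidistributed_def], of c]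
    by (simp add: equidistributed_def torus_integral_cmult mult.left_commute)
next
  case (trig_poly_add f g)
  obtain B C where f: "f \<in> borel_measurable borel" "\<And>x. norm (f x) \<le> B" and g: "g \<in> borel_measurable borel" "\<And>x. norm (g x) \<le> C"
    using trig_poly_bounded trig_poly_add by metis
  have "torus_integral a (\<lambda>x. f x + g x) = torus_integral a f + torus_integral a g"
    unfolding torus_integral_def using set_integrable_torus_bounded[OF f] set_integrable_torus_bounded[OF g] by simp
  moreover have "((\<lambda>\<mu>. torus_integral a (\<lambda>x. f x * (L2_normalize a (G \<mu>) x)\<^sup>2) + torus_integral a (\<lambda>x. g x * (L2_normalize a (G \<mu>) x)\<^sup>2))
     \<longlongrightarrow> (1 / of_real (torus_area a)) * torus_integral a f + (1 / of_real (torus_area a)) * torus_integral a g) (inf at_top (principal S))"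
    by (intro tendsto_add trig_poly_add.IH[unfolded equidistributed_def])
  moreover have "\<forall>\<^sub>F \<mu> in inf at_top (principal S). torus_integral a (\<lambda>x. f x * (L2_normalize a (G \<mu>) x)\<^sup>2) + torus_integral a (\<lambda>x. g x * (L2_normalize a (G \<mu>) x)\<^sup>2)
     = torus_integral a (\<lambda>x. (f x + g x) * (L2_normalize a (G \<mu>) x)\<^sup>2)"
    using eventually_in_S
  proof eventually_elim
    case (elim \<mu>)
    note hyp = green[OF elim] not_in_spectrum[OF elim]
    show ?case unfolding torus_integral_def distrib_right
      using set_integrable_L2_normalize_sq[OF hyp f] set_integrable_L2_normalize_sq[OF hyp g] by simp
  qed
  ultimately show ?case unfolding equidistributed_def
    by (simp only: distrib_left) (rule Lim_transform_eventually)
qed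

text \<open>Since \<open>|g\<^sub>\<mu>|\<^sup>2\<close> has integral \<open>1\<close>, replacing \<open>f\<close> by a trigonometric polynomial that is uniformly close changes both
  sides by little, uniformly in \<open>\<mu>\<close>.\<close>

lemma equidistributed_continuous:
  assumes cont: "continuous_on UNIV f" and per: "torus_periodic a f"
  shows "equidistributed S G f"
  unfolding equidistributed_def
proof (rule tendstoI)
  fix e :: real assume e: "e > 0"
  obtain P where P: "trig_poly P" and fP: "\<And>x. norm (f x - P x) \<le> e / 4"
    using trig_poly_dense[OF cont per, of "e / 4"] e by auto
  obtain B where Pm: "P \<in> borel_measurable borel" and PB: "\<And>x. norm (P x) \<le> B"
    using trig_poly_bounded[OF P] by auto
  have fm: "f \<in> borel_measurable borel" using cont by (rule borel_measurable_continuous_onI)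
  have fB: "norm (f x) \<le> B + e / 4" for x
    using norm_triangle_ineq[of "P x" "f x - P x"] PB[of x] fP[of x] by simp
  let ?h = "\<lambda>f \<mu>. torus_integral a (\<lambda>x. f x * (L2_normalize a (G \<mu>) x)\<^sup>2)"
  let ?m = "\<lambda>f. (1 / of_real (torus_area a)) * torus_integral a f"
  have dm: "(\<lambda>x. f x - P x) \<in> borel_measurable borel" using fm Pm by measurable
  have m: "norm (?m f - ?m P) \<le> e / 4"
  proof -
    have "torus_integral a f - torus_integral a P = torus_integral a (\<lambda>x. f x - P x)"
      unfolding torus_integral_def using set_integrable_torus_bounded[OF fm fB] set_integrable_torus_bounded[OF Pm PB] by simp
    also have "norm \<dots> \<le> torus_integral a (\<lambda>x. e / 4)"
      by (rule norm_torus_integral_le[OF dm _ fP]) (rule set_integrable_torus_bounded[of _ "e / 4"], use e in auto)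
    also have "\<dots> = torus_area a * (e / 4)"
      unfolding torus_integral_def set_lebesgue_integral_def torus_area_def
      using emeasure_torus_dom by simp
    finally have "norm (torus_integral a f - torus_integral a P) \<le> torus_area a * (e / 4)" .
    moreover have "torus_area a > 0" by (simp add: torus_area_eq)
    moreover have "?m f - ?m P = (1 / of_real (torus_area a)) * (torus_integral a f - torus_integral a P)" by (simp add: right_diff_distrib)
    ultimately show ?thesis by (simp add: norm_mult norm_divide divide_le_eq mult.commute)
  qed
  have "\<forall>\<^sub>F \<mu> in inf at_top (principal S). dist (?h P \<mu>) (?m P) < e / 4"
    using equidistributed_trig_poly[OF P] e unfolding equidistributed_def by (intro tendstoD) auto
  then show "\<forall>\<^sub>F \<mu> in inf at_top (principal S). dist (?h f \<mu>) (?m f) < e"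
    using eventually_in_S
  proof eventually_elim
    case (elim \<mu>)
    note hyp = green[OF elim(2)] not_in_spectrum[OF elim(2)]
    have "?h f \<mu> - ?h P \<mu> = ?h (\<lambda>x. f x - P x) \<mu>"
      unfolding torus_integral_def left_diff_distrib
      using set_integrable_L2_normalize_sq[OF hyp fm fB] set_integrable_L2_normalize_sq[OF hyp Pm PB] by simp
    also have "norm \<dots> \<le> e / 4" by (rule norm_torus_integral_L2_normalize_sq_le[OF hyp dm fP])
    finally have "dist (?h f \<mu>) (?h P \<mu>) \<le> e / 4" by (simp add: dist_norm)
    moreover have "dist (?m P) (?m f) \<le> e / 4" using m by (simp add: dist_norm norm_minus_commute)
    moreover have "dist (?h f \<mu>) (?m f) \<le> dist (?h f \<mu>) (?h P \<mu>) + (dist (?h P \<mu>) (?m P) + dist (?m P) (?m f))"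
      by (meson add_left_mono dist_triangle order_trans)
    ultimately show ?case using elim(1) e by linarith
  qed
qed

end

end

theorem theorem1p1:
  fixes a \<phi> :: real and x0 :: "real \<times> real"
  assumes "a > 0" and "\<phi> \<in> {-pi<..<pi}"
  shows "\<exists>\<Lambda>'. density_one_subset \<Lambda>' (perturbed_eigenvalues a \<phi>) \<and>
    (\<forall>G :: real \<Rightarrow> real \<times> real \<Rightarrow> complex. (\<forall>\<mu>\<in>\<Lambda>'. is_green a x0 \<mu> (G \<mu>)) \<longrightarrow>
      (\<forall>f\<in>torus_smooth a.
        ((\<lambda>\<mu>. torus_integral a (\<lambda>x. f x * (L2_normalize a (G \<mu>) x)\<^sup>2))
          \<longlongrightarrow> (1 / of_real (torus_area a)) * torus_integral a f)
        (inf at_top (principal \<Lambda>'))))"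
proof -
  interpret rect_torus a by unfold_locales fact
  define y where "y = scatterer_c0 a * tan (\<phi> / 2)"
  have eigs: "perturbed_eigenvalues a \<phi> = eigs y" by (simp add: y_def perturbed_eigenvalues_eq)
  from almost_all_eigs_off_diagonal_small[of y] obtain B where *: "negligible_eigs y B \<and> (\<forall>z. z \<noteq> 0 \<longrightarrow> (\<exists>X. \<forall>\<mu>\<in>eigs y - B. X < \<mu> \<longrightarrow>
     weakly_correlated \<mu> z))" ..
  note B = conjunct1[OF *] and decay = conjunct2[OF *, THEN spec, THEN mp]
  show ?thesis
  proof (intro exI[of _ "eigs y - B"] conjI allI impI ballI)
    show "density_one_subset (eigs y - B) (perturbed_eigenvalues a \<phi>)"
      unfolding eigs by (rule density_one_complement[OF B])
    fix G :: "real \<Rightarrow> real \<times> real \<Rightarrow> complex" and f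
    assume G: "\<forall>\<mu>\<in>eigs y - B. is_green a x0 \<mu> (G \<mu>)" and f: "f \<in> torus_smooth a"
    have "Ck 0 f" "torus_periodic a f" using f by (auto simp: torus_smooth_def simp del: Ck.simps)
    then have "equidistributed (eigs y - B) G f"
    proof (intro equidistributed_continuous[OF Diff_subset])
      show "is_green a x0 \<mu> (G \<mu>)" if "\<mu> \<in> eigs y - B" for \<mu> using G that by (rule bspec)
      show "continuous_on UNIV f" using \<open>Ck 0 f\<close> by simp
      show "\<exists>X. \<forall>\<mu>\<in>eigs y - B. X < \<mu> \<longrightarrow> weakly_correlated \<mu> z"
        if "z \<noteq> 0" for z :: "int \<times> int"
        by (rule decay[OF that])
      show "torus_periodic a f" by fact
    qed
    then show "((\<lambda>\<mu>. torus_integral a (\<lambda>x. f x * (L2_normalize a (G \<mu>) x)\<^sup>2))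
          \<longlongrightarrow> (1 / of_real (torus_area a)) * torus_integral a f)
        (inf at_top (principal (eigs y - B)))"
      by (simp add: equidistributed_def)
  qed
qed

end
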